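(* Let $a=(a_1<a_2<\dots<a_k)$ be integers with $0<a_1$, $a_k<n$, and set $a_0=0$, $a_{k+1}=n$. Let $w\in S_n(a)$ be different from the identity. Choose $p\le k$ maximal such that $w(a_p+1)\ne a_p+1$, define $u\in S_n(a)$ by $$u(i)=\begin{cases} w(i)&\text{if } i\le a_p \text{ and } w(i)<w(a_p+1),\\ w(i)-1&\text{if } i\le a_p\text{ and } w(i)>w(a_p+1),\\ w(i+1)-1&\text{if } i>a_p,\end{cases}$$ with the convention $w(n+1)=n+1$, and set $\alpha=s_{w(a_p+1)}\cdots s_{a_p-1}s_{a_p}\in S_n(a)$. Then the partial quantum Schubert polynomials satisfy $$\mathfrak{S}^q_w=\mathfrak{S}^q_u\cdot E^p_{a_p+1-w(a_p+1)}-\sum_{u\xrightarrow{\alpha}v\ne w}\mathfrak{S}^q_v ,$$ where the sum is over all $v\ne w$ with $u\xrightarrow{\alpha}v$.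
   Context: $S_n$ is the symmetric group, $\ell$ is Coxeter length, $s_i=(i,i+1)$, $t_{ij}$ is the transposition of $i$ and $j$, products are compositions of functions. $S_n(a)\subset S_n$ is the set of permutations whose descent positions lie in $\{a_1,\dots,a_k\}$. For $\alpha=s_rs_{r+1}\cdots s_m\in S_n$ ($1\le r\le m\le n-1$), of length $\ell=m-r+1$, and $u,v\in S_n$, $u\xrightarrow{\alpha}v$ means that there are integers $b_1,\dots,b_\ell$, $c_1,\dots,c_\ell$ in $\{1,\dots,n\}$ with (1) $b_i\le m<c_i$ for all $i$; (2) $v=u\,t_{b_1c_1}\cdots t_{b_\ell c_\ell}$; (3) $\ell(u\,t_{b_1c_1}\cdots t_{b_ic_i})=\ell(u)+i$ for $1\le i\le\ell$; (4) $b_1,\dots,b_\ell$ are distinct. Schubert polynomials $\mathfrak{S}_w$, $w\in S_n$: $\mathfrak{S}_{w_0}=x_1^{n-1}x_2^{n-2}\cdots x_{n-1}$ for the longest permutation $w_0$, and if $\ell(ws_i)=\ell(w)+1$ then $\mathfrak{S}_w=\bigl(\mathfrak{S}_{ws_i}-\mathfrak{S}_{ws_i}|_{x_i\leftrightarrow x_{i+1}}\bigr)/(x_i-x_{i+1})$. For a sequence $(i_{a_1},\dots,i_{n-1})$ with $0\le i_r\le a_p$ whenever $a_p\le r<a_{p+1}$ $(1\le p\le k)$, set $e^{(a)}_{i_{a_1},\dots,i_{n-1}}=\prod_{p=1}^k\prod_{r=a_p}^{a_{p+1}-1}e_{i_r}(x_1,\dots,x_{a_p})$, with $e_i$ the elementary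 symmetric polynomials. For $w\in S_n(a)$ there are unique integers $c_{i_{a_1},\dots,i_{n-1}}$, indexed by such sequences satisfying also $i_{a_p}\le i_{a_p+1}\le\dots\le i_{a_{p+1}-1}$ for all $p$, with $\mathfrak{S}_w=\sum c_{i_{a_1},\dots,i_{n-1}}\,e^{(a)}_{i_{a_1},\dots,i_{n-1}}$. $\mathbb{Z}[y,q]$ is the polynomial ring in $q_1,\dots,q_k$ and $y^j_i$ for $1\le j\le k+1$, $1\le i\le a_j-a_{j-1}$. Define $E^j_i\in\mathbb{Z}[y,q]$ by $E^0_0=1$; $E^j_i=0$ if $j<0$ or $i<0$ or $i>a_j$; and for $0\le i\le a_j\ne0$, $$E^j_i=E^{j-1}_i+\sum_{r=1}^{a_j-a_{j-1}}y^j_r\,E^{j-1}_{i-r}-(-1)^{a_j-a_{j-1}}q_{j-1}\,E^{j-2}_{i-a_j+a_{j-2}}$$ (the last term being $0$ for $j=1$). Set $E^{(a)}_{i_{a_1},\dots,i_{n-1}}=\prod_{p=1}^k\prod_{r=a_p}^{a_{p+1}-1}E^p_{i_r}$. For $w\in S_n(a)$ the partial quantum Schubert polynomial is $\mathfrak{S}^q_w=\sum c_{i_{a_1},\dots,i_{n-1}}\,E^{(a)}_{i_{a_1},\dots,i_{n-1}}$ with the same coefficients as in the expansion of $\mathfrak{S}_w$. *)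

theory Defs
  imports "HOL-Library.Poly_Mapping" "HOL-Combinatorics.Permutations"
begin

(* Polynomials with integer coefficients in variables indexed by 'v: a finitely supported map
   from exponent vectors to coefficients. *)

type_synonym 'v mpol = "('v \<Rightarrow>\<^sub>0 nat) \<Rightarrow>\<^sub>0 int"

definition var :: "'v \<Rightarrow> 'v mpol" where
  "var x = Poly_Mapping.single (Poly_Mapping.single x 1) 1"

(* The coefficient of the exponent vector m in swap_vars i f is that of
   m \<circ> transpose i (i + 1) in f. *)

definition swap_vars :: "nat \<Rightarrow> nat mpol \<Rightarrow> nat mpol" where
  "swap_vars i f = Poly_Mapping.map_key (Poly_Mapping.map_key (transpose i (i + 1))) f"

definition elem_sym :: "nat \<Rightarrow> nat \<Rightarrow> nat mpol" where
  "elem_sym m i = (\<Sum>A | A \<subseteq> {1..m} \<and> card A = i. \<Prod>j\<in>A. var j)"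


(* S_n is {w. w permutes {1..n}}; such w are the identity outside {1..n}. *)

definition simple_word :: "nat list \<Rightarrow> nat \<Rightarrow> nat" where
  "simple_word js = foldr (\<lambda>j f. transpose j (j + 1) \<circ> f) js id"

definition coxeter_length :: "nat \<Rightarrow> (nat \<Rightarrow> nat) \<Rightarrow> nat" where
  "coxeter_length n w =
     (LEAST d. \<exists>js. length js = d \<and> set js \<subseteq> {1..<n} \<and> w = simple_word js)"

definition perms_with_descents_in :: "nat \<Rightarrow> nat \<Rightarrow> (nat \<Rightarrow> nat) \<Rightarrow> (nat \<Rightarrow> nat) set" where
  "perms_with_descents_in n k a =
     {w. w permutes {1..n} \<and> (\<forall>i\<in>{1..<n}. w i > w (i + 1) \<longrightarrow> i \<in> a ` {1..k})}"

definition cycle_perm :: "nat \<Rightarrow> nat \<Rightarrow> nat \<Rightarrow> nat" where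
  "cycle_perm r m = simple_word [r..<Suc m]"

primrec chain :: "(nat \<Rightarrow> nat) \<Rightarrow> (nat \<Rightarrow> nat) \<Rightarrow> (nat \<Rightarrow> nat) \<Rightarrow> nat \<Rightarrow> (nat \<Rightarrow> nat)" where
  "chain u b c 0 = u"
| "chain u b c (Suc i) = chain u b c i \<circ> transpose (b (Suc i)) (c (Suc i))"

definition pieri_step ::
    "nat \<Rightarrow> (nat \<Rightarrow> nat) \<Rightarrow> (nat \<Rightarrow> nat) \<Rightarrow> (nat \<Rightarrow> nat) \<Rightarrow> bool" where
  "pieri_step n \<alpha> u v \<longleftrightarrow>
     u permutes {1..n} \<and> v permutes {1..n} \<and>
     (\<exists>r m. 1 \<le> r \<and> r \<le> m \<and> m < n \<and> \<alpha> = cycle_perm r m \<and>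
       (\<exists>b c. (\<forall>i\<in>{1..m - r + 1}. b i \<in> {1..n} \<and> c i \<in> {1..n} \<and> b i \<le> m \<and> m < c i) \<and>
              v = chain u b c (m - r + 1) \<and>
              (\<forall>i\<in>{1..m - r + 1}.
                 coxeter_length n (chain u b c i) = coxeter_length n u + i) \<and>
              inj_on b {1..m - r + 1}))"


(* schubert_rel n w f: f is obtained for w by descending from the longest permutation by
   divided differences; g is the quotient (f - swap_vars i f) / (x_i - x_(i+1)) in the integral
   domain of polynomials. That f is determined by w is a theorem. *)

inductive schubert_rel :: "nat \<Rightarrow> (nat \<Rightarrow> nat) \<Rightarrow> nat mpol \<Rightarrow> bool" for n where
  longest:
    "is_arg_max (coxeter_length n) (\<lambda>w. w permutes {1..n}) w0 \<Longrightarrow>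
     schubert_rel n w0 (\<Prod>i = 1..<n. var i ^ (n - i))"
| divided_difference:
    "schubert_rel n (w \<circ> transpose i (i + 1)) f \<Longrightarrow>
     w permutes {1..n} \<Longrightarrow> 1 \<le> i \<Longrightarrow> i < n \<Longrightarrow>
     coxeter_length n (w \<circ> transpose i (i + 1)) = coxeter_length n w + 1 \<Longrightarrow>
     (var i - var (i + 1)) * g = f - swap_vars i f \<Longrightarrow>
     schubert_rel n w g"

definition schubert :: "nat \<Rightarrow> (nat \<Rightarrow> nat) \<Rightarrow> nat mpol" where
  "schubert n w = (THE f. schubert_rel n w f)"


(* A sequence a_1 < ... < a_k with a_0 = 0 and a_(k+1) = n is a function a on {0..k+1}.
   Index sequences (i_r), for a_1 \<le> r < n, are functions that vanish outside that range. *)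

definition std_indices :: "nat \<Rightarrow> (nat \<Rightarrow> nat) \<Rightarrow> (nat \<Rightarrow> nat) set" where
  "std_indices k a =
     {I. (\<forall>r. r \<notin> {a 1..<a (k + 1)} \<longrightarrow> I r = 0) \<and>
         (\<forall>p\<in>{1..k}. (\<forall>r\<in>{a p..<a (p + 1)}. I r \<le> a p) \<and> mono_on {a p..<a (p + 1)} I)}"

definition elem_prod :: "nat \<Rightarrow> (nat \<Rightarrow> nat) \<Rightarrow> (nat \<Rightarrow> nat) \<Rightarrow> nat mpol" where
  "elem_prod k a I = (\<Prod>p = 1..k. \<Prod>r = a p..<a (p + 1). elem_sym (a p) (I r))"

definition schubert_coeffs ::
    "nat \<Rightarrow> nat \<Rightarrow> (nat \<Rightarrow> nat) \<Rightarrow> (nat \<Rightarrow> nat) \<Rightarrow> (nat \<Rightarrow> nat) \<Rightarrow> int" where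
  "schubert_coeffs n k a w =
     (THE c. (\<forall>I. I \<notin> std_indices k a \<longrightarrow> c I = 0) \<and>
             schubert n w = (\<Sum>I\<in>std_indices k a. of_int (c I) * elem_prod k a I))"


(* Y j i stands for the variable y^j_i. *)

datatype qvar = Y nat nat | Q nat

(* The index i of E^j_i is an integer, so that i - r may become negative. *)

fun qE :: "(nat \<Rightarrow> nat) \<Rightarrow> nat \<Rightarrow> int \<Rightarrow> qvar mpol" where
  "qE a 0 i = (if i = 0 then 1 else 0)"
| "qE a (Suc 0) i =
     (if i < 0 \<or> i > int (a 1) then 0
      else qE a 0 i + (\<Sum>r = 1..a 1 - a 0. var (Y 1 r) * qE a 0 (i - int r)))"
| "qE a (Suc (Suc j)) i =
     (if i < 0 \<or> i > int (a (j + 2)) then 0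
      else qE a (Suc j) i
         + (\<Sum>r = 1..a (j + 2) - a (j + 1). var (Y (j + 2) r) * qE a (Suc j) (i - int r))
         - (- 1) ^ (a (j + 2) - a (j + 1)) * var (Q (j + 1))
             * qE a j (i - int (a (j + 2)) + int (a j)))"

definition qE_prod :: "nat \<Rightarrow> (nat \<Rightarrow> nat) \<Rightarrow> (nat \<Rightarrow> nat) \<Rightarrow> qvar mpol" where
  "qE_prod k a I = (\<Prod>p = 1..k. \<Prod>r = a p..<a (p + 1). qE a p (int (I r)))"

definition qschubert :: "nat \<Rightarrow> nat \<Rightarrow> (nat \<Rightarrow> nat) \<Rightarrow> (nat \<Rightarrow> nat) \<Rightarrow> qvar mpol" where
  "qschubert n k a w =
     (\<Sum>I\<in>std_indices k a. of_int (schubert_coeffs n k a w I) * qE_prod k a I)"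

end

theory Submission
  imports Defs
begin

text \<open>The recursion for \<open>E\<close> plays no role beyond \<open>E\<^sup>p\<^sub>0 = 1\<close>. The theorem is a classical identity in
  disguise: since \<open>u\<close> has no descent after \<open>m = a p\<close>, Pieri's formula expands \<open>e\<^sub>l(x\<^sub>1, \<dots>, x\<^sub>m) S\<^sub>u\<close>,
  with \<open>l = m + 1 - w (m + 1)\<close>, as the sum of all \<open>S\<^sub>v\<close> with \<open>u \<rightarrow> v\<close>, one of which is \<open>S\<^sub>w\<close>.
  Every \<open>v \<noteq> w\<close> has \<open>v (m + 1) < w (m + 1)\<close> and \<open>u\<close> fixes one more point than \<open>w\<close>, so this
  identity also computes all \<open>S\<^sub>w\<close> recursively and expands them in the products \<open>e\<^sup>(\<^sup>a\<^sup>)\<close>. In the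
  expansion of \<open>S\<^sub>u\<close> each product has a trivial factor at level \<open>p\<close>, which the multiplication by
  \<open>e\<^sub>l\<close> fills. As the products are independent, the same computation is valid for their
  quantizations.\<close>

section \<open>Inversions and Coxeter length\<close>

text \<open>A Pieri step quantifies over chains of transpositions, while the sum in the theorem runs
  over their endpoints, and many chains share an endpoint. So endpoints are classified by the set
  \<open>B\<close> of left positions of a chain: if \<open>u\<close> increases on the tail,
  \<open>B\<close> and the endpoint determine each other, and Pieri's formula becomes a sum over
  admissible subsets of {1..m}, on which adjacent transpositions act.

  The coefficients behind \<open>qschubert\<close> are a definite description, so nothing can be
  computed with them before expansions are known to exist and to be unique. Existence comes from the
  transition identity itself; uniqueness comes from counting, since there are no more index
  sequences than permutations in \<open>Sn\<close>. During the existence proof the classical and the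
  quantum side are built in parallel with the same coefficients, so uniqueness turns the classical
  identity into the quantum one.

  The free factor at level \<open>p\<close> is guaranteed by a bound \<open>N\<close> with a p < N
  \<le> a (p+1) above which \<open>w\<close> fixes all points: \<open>u\<close> fixes everything
  above \<open>N - 1\<close>, and then the index at position \<open>a p\<close>, the first of its
  block, has to be 0.\<close>

definition inversions :: "nat \<Rightarrow> (nat \<Rightarrow> nat) \<Rightarrow> nat" where
  "inversions n w = (\<Sum>i=1..n. \<Sum>j=1..n. if i < j \<and> w i > w j then 1 else 0)"

lemma permutes_comp_transpose:
  "v permutes S \<Longrightarrow> b \<in> S \<Longrightarrow> c \<in> S \<Longrightarrow> v \<circ> transpose b c permutes S"
  by (intro permutes_compose permutes_swap_id)

lemma permutes_eq_iff: "w permutes S \<Longrightarrow> w i = w j \<longleftrightarrow> i = j"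
  by (metis permutes_inj injD)

lemma permutes_apply_in: "w permutes {1..n::nat} \<Longrightarrow> 1 \<le> i \<Longrightarrow> i \<le> n \<Longrightarrow> 1 \<le> w i \<and> w i \<le> n"
  by (metis atLeastAtMost_iff permutes_in_image)

lemma permutes_apply_out: "w permutes {1..n::nat} \<Longrightarrow> n < i \<Longrightarrow> w i = i"
  by (rule permutes_not_in) auto

lemma sum_remove_pair:
  fixes f :: "nat \<Rightarrow> int"
  assumes "finite S" "b \<in> S" "c \<in> S" "b \<noteq> c"
  shows "sum f S = f b + f c + sum f (S - {b, c})"
proof -
  have "sum f S = f b + sum f (S - {b})" using assms by (simp add: sum.remove)
  also have "sum f (S - {b}) = f c + sum f (S - {b} - {c})" using assms by (intro sum.remove) auto
  finally show ?thesis by (simp add: Diff_insert2[symmetric] insert_commute)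
qed

text \<open>Only the pairs that meet \<open>{b, c}\<close> change. A position outside \<open>{b..c}\<close> contributes the same
  total before and after, a position strictly between gains \<open>2\<close> exactly if its value lies
  strictly between.\<close>

lemma inversions_comp_transpose:
  assumes bc: "1 \<le> b" "b < c" "c \<le> n" and lt: "v b < v c" and inj: "inj v"
  shows "inversions n (v \<circ> transpose b c) =
    inversions n v + 1 + 2 * card {j. b < j \<and> j < c \<and> v b < v j \<and> v j < v c}"
proof -
  define g :: "(nat \<Rightarrow> nat) \<Rightarrow> nat \<Rightarrow> nat \<Rightarrow> int"
    where "g w i j = (if i < j \<and> w i > w j then 1 else 0)" for w i j
  let ?S = "{1..n}" let ?R = "?S - {b, c}"
  have S: "finite ?S" "b \<in> ?S" "c \<in> ?S" "b \<noteq> c" using bc by auto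
  \<comment> \<open>These are the four terms with exactly one index in {b, c}. Only they and the two
    terms formed by \<open>b\<close> and \<open>c\<close> themselves can react to the
    transposition.\<close>
  define h where "h w j = g w b j + g w c j + g w j b + g w j c" for w j
  have dec: "int (inversions n w) = g w b c + g w c b + sum (h w) ?R + (\<Sum>i\<in>?R. \<Sum>j\<in>?R. g w i j)" for w
  proof -
    have "int (inversions n w) = (\<Sum>i\<in>?S. \<Sum>j\<in>?S. g w i j)"
      by (simp add: inversions_def g_def if_distrib[of int] cong: if_cong)
    also have "\<dots> = (\<Sum>j\<in>?S. g w b j) + (\<Sum>j\<in>?S. g w c j) + (\<Sum>i\<in>?R. \<Sum>j\<in>?S. g w i j)"
      by (rule sum_remove_pair[OF S])
    also have "\<dots> = g w b c + g w c b + sum (h w) ?R + (\<Sum>i\<in>?R. \<Sum>j\<in>?R. g w i j)"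
      unfolding sum_remove_pair[OF S] h_def sum.distrib by (simp add: g_def)
    finally show ?thesis .
  qed
  let ?w = "v \<circ> transpose b c"
  let ?P = "\<lambda>j. b < j \<and> j < c \<and> v b < v j \<and> v j < v c"
  have h: "h ?w j = h v j + 2 * (if ?P j then 1 else 0)" if "j \<in> ?R" for j
  proof -
    have jb: "v j \<noteq> v b" "v j \<noteq> v c" "j \<noteq> b" "j \<noteq> c" using that inj by (auto dest: injD)
    have w: "?w b = v c" "?w c = v b" "?w j = v j" using jb by auto
    show ?thesis unfolding h_def g_def w using lt bc jb by auto
  qed
  have "(\<Sum>j\<in>?R. if ?P j then (1::int) else 0) = int (card {j. ?P j})"
  proof -
    have "(\<Sum>j\<in>?R. if ?P j then (1::int) else 0) = (\<Sum>j\<in>{j. ?P j}. 1)"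
      using bc by (intro sum.mono_neutral_cong_right) auto
    then show ?thesis by simp
  qed
  then have "sum (h ?w) ?R = sum (h v) ?R + 2 * int (card {j. ?P j})"
    by (simp add: h sum.distrib sum_distrib_left[symmetric])
  moreover have "(\<Sum>i\<in>?R. \<Sum>j\<in>?R. g ?w i j) = (\<Sum>i\<in>?R. \<Sum>j\<in>?R. g v i j)"
    by (intro sum.cong) (auto simp: g_def)
  moreover have "g ?w b c + g ?w c b = 1" "g v b c + g v c b = 0"
    using lt bc by (auto simp: g_def)
  ultimately have "int (inversions n ?w) = int (inversions n v) + 1 + 2 * int (card {j. ?P j})"
    by (simp only: dec)
  then show ?thesis by linarith
qed

text \<open>The increase is 1 plus twice the number of positions in between with values in between.
  If \<open>v c < v b\<close>, the same count with the roles of \<open>v\<close> and the product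
  exchanged shows a decrease. This is the covering relation of the Bruhat order.\<close>

lemma inversions_comp_transpose_Suc_iff:
  assumes "1 \<le> b" "b < c" "c \<le> n" "inj v"
  shows "inversions n (v \<circ> transpose b c) = inversions n v + 1 \<longleftrightarrow>
    v b < v c \<and> (\<forall>j. b < j \<and> j < c \<longrightarrow> \<not> (v b < v j \<and> v j < v c))"
proof (cases "v b < v c")
  case True
  have "finite {j. b < j \<and> j < c \<and> v b < v j \<and> v j < v c}"
    by (rule finite_subset[of _ "{..c}"]) auto
  then show ?thesis
    unfolding inversions_comp_transpose[OF assms(1-3) True assms(4)] using True by auto
next
  case False
  then have lt: "v c < v b" using assms by (metis injD linorder_neqE_nat less_irrefl)
  let ?w = "v \<circ> transpose b c"
  have "inversions n (?w \<circ> transpose b c) =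
    inversions n ?w + 1 + 2 * card {j. b < j \<and> j < c \<and> ?w b < ?w j \<and> ?w j < ?w c}"
    using lt assms by (intro inversions_comp_transpose inj_compose) auto
  moreover have "?w \<circ> transpose b c = v" by (simp add: comp_assoc)
  ultimately show ?thesis using False by simp
qed

lemma inversions_adjacent:
  assumes "1 \<le> i" "i < n" "inj v"
  shows "inversions n (v \<circ> transpose i (i+1)) = inversions n v + 1 \<longleftrightarrow> v i < v (i+1)"
  using inversions_comp_transpose_Suc_iff[of i "i+1" n v] assms by auto

lemma inversions_adjacent_descent:
  assumes "1 \<le> i" "i < n" "inj v" "v (i+1) < v i"
  shows "inversions n v = inversions n (v \<circ> transpose i (i+1)) + 1"
proof -
  have "inversions n ((v \<circ> transpose i (i+1)) \<circ> transpose i (i+1)) =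
      inversions n (v \<circ> transpose i (i+1)) + 1"
    using assms by (subst inversions_adjacent) (auto intro: inj_compose)
  then show ?thesis by (simp only: comp_assoc transpose_comp_involutory comp_id)
qed

lemma inversions_id [simp]: "inversions n id = 0"
  by (auto simp: inversions_def)

lemma no_descent_imp_id:
  assumes w: "w permutes {1..n::nat}" and asc: "\<And>i. 1 \<le> i \<Longrightarrow> i < n \<Longrightarrow> w i < w (i+1)"
  shows "w = id"
proof -
  have ge: "i \<le> w i" if "1 \<le> i" "i \<le> n" for i
    using that
  proof (induction i rule: nat_induct_at_least)
    case base then show ?case using permutes_apply_in[OF w, of 1] by simp
  next
    case (Suc i) then show ?case using asc[of i] by simp
  qed
  have eq: "w i = i" if "1 \<le> i" "i \<le> n" for i
    using that
  proof (induction "n - i" arbitrary: i rule: less_induct)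
    case less
    show ?case
    proof (cases "i = n")
      case True then show ?thesis using permutes_apply_in[OF w, of n] ge[of n] less.prems by simp
    next
      case False
      then have "w (i+1) = i+1" using less by (intro less.hyps) auto
      then show ?thesis using asc[of i] ge[of i] less.prems False by simp
    qed
  qed
  show ?thesis
  proof
    fix i show "w i = id i" using eq w by (cases "i \<in> {1..n}") (auto simp: permutes_def)
  qed
qed

section \<open>Words in the simple transpositions and the length as an inversion count\<close>

lemma simple_word_Nil [simp]: "simple_word [] = id"
  by (simp add: simple_word_def)

lemma simple_word_Cons [simp]: "simple_word (j # js) = transpose j (j+1) \<circ> simple_word js"
  by (simp add: simple_word_def)

lemma simple_word_append: "simple_word (js @ ks) = simple_word js \<circ> simple_word ks"
  by (induction js) (auto simp: comp_assoc)

lemma simple_word_permutes: "set js \<subseteq> {1..<n} \<Longrightarrow> simple_word js permutes {1..n}"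
  by (induction js) (auto simp: permutes_id intro!: permutes_compose permutes_swap_id)

lemma inversions_simple_word_le:
  "set js \<subseteq> {1..<n} \<Longrightarrow> inversions n (simple_word js) \<le> length js"
proof (induction js rule: rev_induct)
  case Nil show ?case by (simp add: inversions_def)
next
  case (snoc j js)
  let ?v = "simple_word js"
  have inj: "inj ?v" using snoc.prems by (intro permutes_inj[OF simple_word_permutes]) auto
  have j: "1 \<le> j" "j < n" using snoc.prems by auto
  have eq: "simple_word (js @ [j]) = ?v \<circ> transpose j (j+1)" by (simp add: simple_word_append)
  have IH: "inversions n ?v \<le> length js" using snoc by auto
  have "inversions n (?v \<circ> transpose j (j+1)) \<le> inversions n ?v + 1"
  proof (cases "?v j < ?v (j+1)")
    case True then show ?thesis
      using inversions_adjacent[OF j inj] by simp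
  next
    case False
    then have "?v (j+1) < ?v j" using inj by (metis injD linorder_neqE_nat n_not_Suc_n Suc_eq_plus1)
    then show ?thesis using inversions_adjacent_descent[OF j inj] by linarith
  qed
  also have "\<dots> \<le> length (js @ [j])" using IH by simp
  finally show ?case unfolding eq .
qed

text \<open>Sorting by adjacent exchanges: as long as there is a descent, undoing it removes exactly
  one inversion and contributes one letter.\<close>

lemma exists_reduced_word:
  assumes "w permutes {1..n}"
  shows "\<exists>js. length js = inversions n w \<and> set js \<subseteq> {1..<n} \<and> w = simple_word js"
  using assms
proof (induction "inversions n w" arbitrary: w rule: less_induct)
  case less
  show ?case
  proof (cases "\<exists>i. 1 \<le> i \<and> i < n \<and> w (i+1) < w i")
    case True
    then obtain i where i: "1 \<le> i" "i < n" "w (i+1) < w i" by auto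
    let ?v = "w \<circ> transpose i (i+1)"
    have v: "?v permutes {1..n}" using i less.prems by (intro permutes_comp_transpose) auto
    have inv: "inversions n w = inversions n ?v + 1"
      using inversions_adjacent_descent i permutes_inj[OF less.prems] by blast
    obtain js where js: "length js = inversions n ?v" "set js \<subseteq> {1..<n}" "?v = simple_word js"
      using less.hyps[OF _ v] inv by auto
    have "simple_word (js @ [i]) = ?v \<circ> transpose i (i+1)"
      unfolding js(3) by (simp add: simple_word_append)
    then have "simple_word (js @ [i]) = w" by (simp only: comp_assoc transpose_comp_involutory comp_id)
    then show ?thesis using js inv i by (intro exI[of _ "js @ [i]"]) auto
  next
    case False
    have "w i < w (i+1)" if "1 \<le> i" "i < n" for i
    proof -
      have "w i \<noteq> w (i+1)" using permutes_eq_iff[OF less.prems, of i "i+1"] by simp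
      then show ?thesis using False that by (meson linorder_neqE_nat)
    qed
    then have "w = id" using less.prems by (intro no_descent_imp_id)
    then show ?thesis by (intro exI[of _ "[]"]) auto
  qed
qed

text \<open>A letter raises the number of inversions by at most one, so no word is shorter than this
  number; the sorting word attains it.\<close>

lemma coxeter_length_eq_inversions:
  assumes "w permutes {1..n}"
  shows "coxeter_length n w = inversions n w"
  unfolding coxeter_length_def
proof (rule Least_equality)
  show "\<exists>js. length js = inversions n w \<and> set js \<subseteq> {1..<n} \<and> w = simple_word js"
    using assms by (rule exists_reduced_word)
qed (use inversions_simple_word_le in blast)

lemma coxeter_length_Suc_iff:
  assumes "v permutes {1..n}" "1 \<le> b" "b < c" "c \<le> n"
  shows "coxeter_length n (v \<circ> transpose b c) = coxeter_length n v + 1 \<longleftrightarrow>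
    v b < v c \<and> (\<forall>j. b < j \<and> j < c \<longrightarrow> \<not> (v b < v j \<and> v j < v c))"
proof -
  have "v \<circ> transpose b c permutes {1..n}" using assms by (intro permutes_comp_transpose) auto
  then show ?thesis
    using inversions_comp_transpose_Suc_iff[OF assms(2-4) permutes_inj[OF assms(1)]] assms(1)
    by (simp add: coxeter_length_eq_inversions)
qed

text \<open>A crude bound, which makes \<open>n * n - inversions n w\<close> a measure for
  inductions that descend from the longest permutation.\<close>

lemma inversions_le: "inversions n w \<le> n * n"
proof -
  have "inversions n w \<le> (\<Sum>i=1..n. \<Sum>j=1..n. 1)"
    unfolding inversions_def by (intro sum_mono) auto
  then show ?thesis by simp
qed

lemma no_ascent_imp_longest:
  assumes w: "w permutes {1..n}" and desc: "\<And>i. 1 \<le> i \<Longrightarrow> i < n \<Longrightarrow> w (i+1) < w i"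
  shows "is_arg_max (coxeter_length n) (\<lambda>w. w permutes {1..n}) w"
proof -
  have dec: "w j < w i" if "1 \<le> i" "i < j" "j \<le> n" for i j
    using that(2,3)
  proof (induction j)
    case (Suc j) then show ?case using desc[of j] that(1) by (cases "i = j") auto
  qed simp
  have "inversions n v \<le> inversions n w" for v
    unfolding inversions_def using dec by (intro sum_mono) auto
  then show ?thesis
    using w by (auto simp: is_arg_max_linorder coxeter_length_eq_inversions)
qed

lemma longest_imp_no_ascent:
  assumes "is_arg_max (coxeter_length n) (\<lambda>w. w permutes {1..n}) w" "1 \<le> i" "i < n"
  shows "w (i+1) < w i"
proof (rule ccontr)
  have w: "w permutes {1..n}" using assms by (simp add: is_arg_max_linorder)
  assume "\<not> ?thesis"
  then have lt: "w i < w (i+1)" using permutes_eq_iff[OF w, of i "i+1"] by simp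
  let ?v = "w \<circ> transpose i (i+1)"
  have v: "?v permutes {1..n}" using assms w by (intro permutes_comp_transpose) auto
  have "coxeter_length n ?v = coxeter_length n w + 1"
    using lt assms w by (subst coxeter_length_Suc_iff) auto
  then show False using assms(1) v by (auto simp: is_arg_max_linorder)
qed

section \<open>Divided differences\<close>

lemma poly_mapping_sum_single: "f = (\<Sum>m\<in>Poly_Mapping.keys f. Poly_Mapping.single m (Poly_Mapping.lookup f m))"
  by (rule poly_mapping_eqI) (simp add: lookup_sum lookup_single when_def in_keys_iff)

lemma single_eq_prod_var:
  fixes m :: "'v \<Rightarrow>\<^sub>0 nat"
  shows "Poly_Mapping.single m 1 = (\<Prod>x\<in>Poly_Mapping.keys m. var x ^ Poly_Mapping.lookup m x)"
proof -
  have pow: "var x ^ k = Poly_Mapping.single (Poly_Mapping.single x k) 1" for x :: 'v and k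
  proof (induction k)
    case (Suc k)
    have "Poly_Mapping.single x (Suc k) = Poly_Mapping.single x 1 + Poly_Mapping.single x k"
      by (simp add: single_add[symmetric])
    then show ?case unfolding power_Suc Suc by (simp add: var_def mult_single)
  qed simp
  have "(\<Prod>x\<in>A. var x ^ Poly_Mapping.lookup m x)
      = Poly_Mapping.single (\<Sum>x\<in>A. Poly_Mapping.single x (Poly_Mapping.lookup m x)) 1"
    if "finite A" for A
    using that by induction (simp_all add: pow mult_single)
  then show ?thesis by (simp only: finite_keys poly_mapping_sum_single[symmetric])
qed

lemma single_zero_eq_of_int: "Poly_Mapping.single 0 c = (of_int c :: 'v mpol)"
  using single_of_int[of c, where ?'a = "'v \<Rightarrow>\<^sub>0 nat" and ?'b = int] by (simp only: of_int_eq_id id_apply)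

text \<open>Every polynomial is a finite sum of integer multiples of products of variables.
  Identities between ring maps, such as the braid relation of \<open>swap_vars\<close>, thus need to
  be checked only on constants and variables.\<close>

lemma mpol_induct [case_names const var add mult]:
  fixes f :: "'v mpol"
  assumes const: "\<And>c. P (of_int c)" and var: "\<And>x. P (var x)"
    and add: "\<And>f g. P f \<Longrightarrow> P g \<Longrightarrow> P (f + g)" and mult: "\<And>f g. P f \<Longrightarrow> P g \<Longrightarrow> P (f * g)"
  shows "P f"
proof -
  have 0: "P 0" and 1: "P 1" using const[of 0] const[of 1] by simp_all
  have pow: "P (g ^ k)" if "P g" for g k using that 1 mult by (induction k) auto
  have "P (\<Prod>x\<in>A. var x ^ k x)" if "finite A" for A k
    using that by induction (auto intro: 1 mult pow var)
  then have "P (of_int c * Poly_Mapping.single m 1)" for c m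
    unfolding single_eq_prod_var by (intro mult const) auto
  moreover have "of_int c * Poly_Mapping.single m 1 = (Poly_Mapping.single m c :: 'v mpol)" for c m
    unfolding single_zero_eq_of_int[symmetric] by (simp add: mult_single)
  ultimately have "P (Poly_Mapping.single m c)" for c m by metis
  moreover have "P (sum F A)" if "finite A" "\<And>x. P (F x)" for A and F :: "('v \<Rightarrow>\<^sub>0 nat) \<Rightarrow> 'v mpol"
    using that(1) by induction (auto intro: 0 add that(2))
  ultimately show ?thesis by (subst poly_mapping_sum_single) auto
qed

section \<open>The exchange of two variables as a ring automorphism\<close>

lemma map_key_transpose_involutory:
  "Poly_Mapping.map_key (transpose i j) (Poly_Mapping.map_key (transpose i j) m) = (m :: 'v \<Rightarrow>\<^sub>0 nat)"
  using map_key_compose[OF inj_transpose inj_transpose, of i j i j m] map_key_id[of m]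
  by (simp only: transpose_comp_involutory id_def)

lemma inj_map_key_transpose: "inj (Poly_Mapping.map_key (transpose i j) :: ('v \<Rightarrow>\<^sub>0 nat) \<Rightarrow> 'v \<Rightarrow>\<^sub>0 nat)"
  by (rule inj_on_inverseI) (rule map_key_transpose_involutory)

lemma swap_vars_add [simp]: "swap_vars i (f + g) = swap_vars i f + swap_vars i g"
  unfolding swap_vars_def by (rule map_key_plus[OF inj_map_key_transpose])

lemma swap_vars_0 [simp]: "swap_vars i 0 = 0"
  unfolding swap_vars_def by (rule map_key_zero[OF inj_map_key_transpose])

lemma swap_vars_single:
  "swap_vars i (Poly_Mapping.single m c) = Poly_Mapping.single (Poly_Mapping.map_key (transpose i (i + 1)) m) c"
  unfolding swap_vars_def
  by (subst map_key_transpose_involutory[of i "i+1" m, symmetric])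
     (simp only: map_key_single[OF inj_map_key_transpose])

lemma swap_vars_sum [simp]: "swap_vars i (sum F A) = (\<Sum>x\<in>A. swap_vars i (F x))"
  by (induction A rule: infinite_finite_induct) auto

lemma swap_vars_of_int [simp]: "swap_vars i (of_int c) = of_int c"
  unfolding single_zero_eq_of_int[symmetric] swap_vars_single by (simp add: map_key_zero)

lemma swap_vars_1 [simp]: "swap_vars i 1 = 1"
  using swap_vars_of_int[of i 1] by simp

text \<open>On monomials this is additivity of the action on exponents; the general case follows by
  expanding both factors into monomials.\<close>

lemma swap_vars_mult [simp]: "swap_vars i (f * g) = swap_vars i f * swap_vars i g"
proof -
  let ?L = "Poly_Mapping.lookup" and ?K = "Poly_Mapping.keys" and ?s = "Poly_Mapping.single"
  have s: "swap_vars i (?s m c * ?s m' c') = swap_vars i (?s m c) * swap_vars i (?s m' c')" for m m' c c'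
    by (simp add: swap_vars_single mult_single map_key_plus)
  have "f * g = (\<Sum>m\<in>?K f. \<Sum>m'\<in>?K g. ?s m (?L f m) * ?s m' (?L g m'))"
    using arg_cong2[where f = "(*)", OF poly_mapping_sum_single[of f] poly_mapping_sum_single[of g]]
    by (simp only: sum_product)
  then have "swap_vars i (f * g) = swap_vars i (\<Sum>m\<in>?K f. ?s m (?L f m)) * swap_vars i (\<Sum>m\<in>?K g. ?s m (?L g m))"
    by (simp only: s sum_product swap_vars_sum)
  then show ?thesis by (simp only: poly_mapping_sum_single[symmetric])
qed

lemma swap_vars_minus [simp]: "swap_vars i (- f) = - swap_vars i f"
  using swap_vars_add[of i f "- f"] by (simp add: eq_neg_iff_add_eq_0 add.commute)

lemma swap_vars_diff [simp]: "swap_vars i (f - g) = swap_vars i f - swap_vars i g"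
  by (simp only: diff_conv_add_uminus swap_vars_add swap_vars_minus)

lemma swap_vars_var [simp]: "swap_vars i (var j) = var (transpose i (i+1) j)"
proof -
  have "Poly_Mapping.map_key (transpose i (i+1)) (Poly_Mapping.single j 1) = Poly_Mapping.single (transpose i (i+1) j) (1::nat)"
    using map_key_single[of "transpose i (i+1)" "transpose i (i+1) j" "1::nat"]
    by (simp only: inj_transpose transpose_involutory)
  then show ?thesis by (simp add: var_def swap_vars_single)
qed

lemma swap_vars_power [simp]: "swap_vars i (f ^ k) = swap_vars i f ^ k"
  by (induction k) auto

lemma swap_vars_prod [simp]: "swap_vars i (prod F A) = (\<Prod>x\<in>A. swap_vars i (F x))"
  by (induction A rule: infinite_finite_induct) auto

lemma swap_vars_involutory [simp]: "swap_vars i (swap_vars i f) = f"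
  by (induction f rule: mpol_induct) auto

lemma swap_vars_commute:
  assumes "i + 1 < j"
  shows "swap_vars i (swap_vars j f) = swap_vars j (swap_vars i f)"
  by (induction f rule: mpol_induct) (use assms in \<open>auto simp: transpose_def\<close>)

lemma swap_vars_braid:
  "swap_vars i (swap_vars (i+1) (swap_vars i f)) = swap_vars (i+1) (swap_vars i (swap_vars (i+1) f))"
  by (induction f rule: mpol_induct) (auto simp: transpose_def)

lemma var_eq_iff [simp]: "var x = var y \<longleftrightarrow> x = y"
proof
  assume "var x = (var y :: 'a mpol)"
  then have "Poly_Mapping.keys (var x) = Poly_Mapping.keys (var y :: 'a mpol)" by simp
  then have "Poly_Mapping.single x (1::nat) = Poly_Mapping.single y 1" by (simp add: var_def)
  then have "Poly_Mapping.keys (Poly_Mapping.single x (1::nat)) = Poly_Mapping.keys (Poly_Mapping.single y (1::nat))" by simp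
  then show "x = y" by simp
qed simp

definition divided_diff :: "nat \<Rightarrow> nat mpol \<Rightarrow> nat mpol" where
  "divided_diff i f = (THE g. (var i - var (i+1)) * g = f - swap_vars i f)"

lemma divided_diff_unique: "(var i - var (i+1)) * g = f - swap_vars i f \<Longrightarrow> divided_diff i f = g"
  unfolding divided_diff_def
proof (rule the_equality)
  fix h assume g: "(var i - var (i+1)) * g = f - swap_vars i f" and "(var i - var (i+1)) * h = f - swap_vars i f"
  then have "(var i - var (i+1)) * h = (var i - var (i+1)) * g" by simp
  then show "h = g" by (subst (asm) mult_left_cancel) auto
qed

text \<open>Divisibility is shown by induction on \<open>f\<close>. In the product case the quotient
  is given by the twisted Leibniz rule, with one factor exchanged in the second term.\<close>

lemma divided_diff: "(var i - var (i+1)) * divided_diff i f = f - swap_vars i f"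
proof -
  have "\<exists>g. (var i - var (i+1)) * g = f - swap_vars i f"
  proof (induction f rule: mpol_induct)
    case (const c) show ?case by (intro exI[of _ 0]) simp
  next
    case (var j)
    show ?case
      by (rule exI[of _ "if j = i then 1 else if j = i + 1 then -1 else 0"]) auto
  next
    case (add f g)
    then obtain f' g' where "(var i - var (i+1)) * f' = f - swap_vars i f" "(var i - var (i+1)) * g' = g - swap_vars i g"
      by auto
    then have "(var i - var (i+1)) * (f' + g') = f + g - swap_vars i (f + g)" by (simp add: distrib_left)
    then show ?case by blast
  next
    case (mult f g)
    then obtain f' g' where fg: "(var i - var (i+1)) * f' = f - swap_vars i f" "(var i - var (i+1)) * g' = g - swap_vars i g"
      by auto
    have "(var i - var (i+1)) * (f' * g + swap_vars i f * g')
        = ((var i - var (i+1)) * f') * g + swap_vars i f * ((var i - var (i+1)) * g')"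
      by (simp add: algebra_simps)
    also have "\<dots> = f * g - swap_vars i (f * g)" unfolding fg by (simp add: algebra_simps)
    finally show ?case by blast
  qed
  then show ?thesis using divided_diff_unique by blast
qed

lemma divided_diff_add: "divided_diff i (f + g) = divided_diff i f + divided_diff i g"
  by (rule divided_diff_unique) (simp only: distrib_left divided_diff swap_vars_add, simp add: algebra_simps)

lemma divided_diff_mult_sym:
  "swap_vars i f = f \<Longrightarrow> divided_diff i (f * g) = f * divided_diff i g"
  by (rule divided_diff_unique) (simp only: mult.left_commute divided_diff swap_vars_mult right_diff_distrib)

lemma divided_diff_of_int_mult: "divided_diff i (of_int c * f) = of_int c * divided_diff i f"
  by (rule divided_diff_mult_sym) simp

lemma divided_diff_0 [simp]: "divided_diff i 0 = 0"
  by (rule divided_diff_unique) simp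

lemma divided_diff_sum: "divided_diff i (sum F A) = (\<Sum>x\<in>A. divided_diff i (F x))"
  by (induction A rule: infinite_finite_induct) (auto simp: divided_diff_add)

text \<open>Numerator and denominator of the quotient both change sign under the exchange.\<close>

lemma swap_vars_divided_diff: "swap_vars i (divided_diff i f) = divided_diff i f"
proof -
  have "swap_vars i ((var i - var (i+1)) * divided_diff i f) = swap_vars i (f - swap_vars i f)"
    by (simp only: divided_diff)
  then have "(var (i+1) - var i) * swap_vars i (divided_diff i f) = swap_vars i f - f" by simp
  then have "(var i - var (i+1)) * swap_vars i (divided_diff i f) = (var i - var (i+1)) * divided_diff i f"
    unfolding divided_diff by (simp add: algebra_simps)
  then show ?thesis by (subst (asm) mult_left_cancel) auto
qed

lemma divided_diff_sym: "swap_vars i f = f \<Longrightarrow> divided_diff i f = 0"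
  by (rule divided_diff_unique) simp

text \<open>Each denominator is invariant under the other exchange, so after multiplication by both
  denominators the two sides are the same alternating sum of four terms.\<close>

lemma divided_diff_commute:
  assumes ij: "i + 1 < j"
  shows "divided_diff i (divided_diff j f) = divided_diff j (divided_diff i f)"
proof -
  let ?x = "var i - var (i+1)" and ?y = "var j - var (j+1)"
  have si: "swap_vars i ?y = ?y" and sj: "swap_vars j ?x = ?x" using ij by (auto simp: transpose_def)
  have "?x * (?y * divided_diff i (divided_diff j f)) = ?x * divided_diff i (?y * divided_diff j f)"
    unfolding divided_diff_mult_sym[OF si] ..
  also have "\<dots> = f - swap_vars i f - swap_vars j (f - swap_vars i f)"
    unfolding divided_diff by (simp add: swap_vars_commute[OF ij])
  also have "\<dots> = ?y * divided_diff j (?x * divided_diff i f)" unfolding divided_diff ..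
  also have "\<dots> = ?x * (?y * divided_diff j (divided_diff i f))"
    unfolding divided_diff_mult_sym[OF sj] by (simp add: mult.left_commute)
  finally have "?x * (?y * divided_diff i (divided_diff j f)) = ?x * (?y * divided_diff j (divided_diff i f))" .
  moreover have "?x \<noteq> 0" "?y \<noteq> 0" by simp_all
  ultimately show ?thesis by (simp only: mult_cancel_left simp_thms)
qed

text \<open>Both sides are the antisymmetrization of \<open>f\<close> over the three variables, divided by their
  Vandermonde product.\<close>

lemma divided_diff_braid:
  "divided_diff i (divided_diff (i+1) (divided_diff i f)) =
   divided_diff (i+1) (divided_diff i (divided_diff (i+1) f))"
proof -
  define s t where "s = swap_vars i" and "t = swap_vars (i+1)"
  define x y z :: "nat mpol" where "x = var i" and "y = var (i+1)" and "z = var (i+2)"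
  have ne: "x - y \<noteq> 0" "y - z \<noteq> 0" "x - z \<noteq> 0" by (auto simp: x_def y_def z_def)
  have s: "s x = y" "s y = x" "s z = z" and t: "t x = x" "t y = z" "t z = y"
    by (auto simp: s_def t_def x_def y_def z_def transpose_def)
  have hom: "s (g - h) = s g - s h" "t (g - h) = t g - t h" "s (g * h) = s g * s h" "t (g * h) = t g * t h" for g h
    by (simp_all add: s_def t_def)
  have dx: "(x - y) * divided_diff i g = g - s g" and dy: "(y - z) * divided_diff (i+1) g = g - t g" for g
    using divided_diff[of i g] divided_diff[of "i+1" g] by (simp_all add: x_def y_def z_def s_def t_def)
  have inv: "s (s g) = g" "t (t g) = g" for g by (simp_all add: s_def t_def)
  have fix_s: "s (divided_diff i g) = divided_diff i g" and fix_t: "t (divided_diff (i+1) g) = divided_diff (i+1) g" for g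
    by (simp_all only: s_def t_def swap_vars_divided_diff)
  have L: "(x - y) * ((y - z) * ((x - z) * divided_diff i (divided_diff (i+1) (divided_diff i f))))
      = f - s f - t f + s (t f) + t (s f) - s (t (s f))"
  proof -
    define g where "g = divided_diff i f"
    define h where "h = divided_diff (i+1) g"
    have g: "(x - y) * g = f - s f" "s g = g" unfolding g_def by (rule dx, rule fix_s)
    have h: "(y - z) * h = g - t g" unfolding h_def by (rule dy)
    \<comment> \<open>The exchange \<open>s\<close> carries the denominator \<open>y - z\<close> to
      \<open>x - z\<close>; in this way the third Vandermonde factor enters.\<close>
    have sh: "(x - z) * s h = g - s (t g)" using arg_cong[OF h, of s] by (simp add: hom s g)
    have tg: "(x - z) * t g = t f - t (s f)" using arg_cong[OF g(1), of t] by (simp add: hom t)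
    have stg: "(y - z) * s (t g) = s (t f) - s (t (s f))" using arg_cong[OF tg, of s] by (simp add: hom s)
    have "(x - y) * ((y - z) * ((x - z) * divided_diff i h)) = (y - z) * ((x - z) * ((x - y) * divided_diff i h))"
      by (simp only: ac_simps)
    also have "\<dots> = (x - z) * ((y - z) * h) - (y - z) * ((x - z) * s h)"
      unfolding dx by (simp add: algebra_simps)
    also have "\<dots> = (x - y) * g - (x - z) * t g + (y - z) * s (t g)"
      unfolding h sh by (simp add: algebra_simps)
    also have "\<dots> = f - s f - t f + s (t f) + t (s f) - s (t (s f))"
      unfolding g(1) tg stg by (simp add: algebra_simps)
    finally show ?thesis by (simp only: h_def g_def)
  qed
  have R: "(x - y) * ((y - z) * ((x - z) * divided_diff (i+1) (divided_diff i (divided_diff (i+1) f))))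
      = f - s f - t f + s (t f) + t (s f) - t (s (t f))"
  proof -
    define g where "g = divided_diff (i+1) f"
    define h where "h = divided_diff i g"
    have g: "(y - z) * g = f - t f" "t g = g" unfolding g_def by (rule dy, rule fix_t)
    have h: "(x - y) * h = g - s g" unfolding h_def by (rule dx)
    have sh: "(x - z) * t h = g - t (s g)" using arg_cong[OF h, of t] by (simp add: hom t g)
    have tg: "(x - z) * s g = s f - s (t f)" using arg_cong[OF g(1), of s] by (simp add: hom s)
    have stg: "(x - y) * t (s g) = t (s f) - t (s (t f))" using arg_cong[OF tg, of t] by (simp add: hom t)
    have "(x - y) * ((y - z) * ((x - z) * divided_diff (i+1) h)) = (x - y) * ((x - z) * ((y - z) * divided_diff (i+1) h))"
      by (simp only: ac_simps)
    also have "\<dots> = (x - z) * ((x - y) * h) - (x - y) * ((x - z) * t h)"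
      unfolding dy by (simp add: algebra_simps)
    also have "\<dots> = (y - z) * g - (x - z) * s g + (x - y) * t (s g)"
      unfolding h sh by (simp add: algebra_simps)
    also have "\<dots> = f - s f - t f + s (t f) + t (s f) - t (s (t f))"
      unfolding g(1) tg stg by (simp add: algebra_simps)
    finally show ?thesis by (simp only: h_def g_def)
  qed
  have "s (t (s f)) = t (s (t f))" unfolding s_def t_def by (rule swap_vars_braid)
  then have "(x - y) * ((y - z) * ((x - z) * divided_diff i (divided_diff (i+1) (divided_diff i f)))) =
    (x - y) * ((y - z) * ((x - z) * divided_diff (i+1) (divided_diff i (divided_diff (i+1) f))))"
    unfolding L R by simp
  then show ?thesis using ne by simp
qed

lemma elem_sym_0 [simp]: "elem_sym m 0 = 1"
proof -
  have "{A. A \<subseteq> {1..m} \<and> card A = 0} = {{}}" by (auto simp: card_eq_0_iff dest: finite_subset)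
  then show ?thesis by (simp only: elem_sym_def) simp
qed

lemma swap_vars_elem_sym:
  assumes i: "1 \<le> i" "i < m"
  shows "swap_vars i (elem_sym m l) = elem_sym m l"
proof -
  let ?s = "transpose i (i+1)"
  let ?F = "{A. A \<subseteq> {1..m} \<and> card A = l}"
  have im: "?s ` {1..m} = {1..m}" using i by (intro transpose_image_eq) auto
  have "swap_vars i (elem_sym m l) = (\<Sum>A\<in>?F. \<Prod>j\<in>A. var (?s j))"
    by (simp add: elem_sym_def)
  also have "\<dots> = (\<Sum>A\<in>?F. \<Prod>j\<in>?s ` A. var j)"
    by (simp add: prod.reindex inj_on_transpose)
  also have "\<dots> = (\<Sum>A\<in>?F. \<Prod>j\<in>A. var j)"
  proof -
    have mem: "?s ` A \<in> ?F" if "A \<in> ?F" for A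
    proof -
      have "?s ` A \<subseteq> ?s ` {1..m}" "card (?s ` A) = l"
        using that by (blast, simp add: card_image inj_on_transpose)
      then show ?thesis using im by simp
    qed
    then show ?thesis
      by (intro sum.reindex_bij_witness[of _ "image ?s" "image ?s"]) (simp_all only: image_image transpose_involutory image_ident)
  qed
  finally show ?thesis by (simp add: elem_sym_def)
qed

section \<open>Schubert polynomials\<close>

lemma schubert_rel_permutes: "schubert_rel n w f \<Longrightarrow> w permutes {1..n}"
  by (induction rule: schubert_rel.induct) (auto simp: is_arg_max_def)

lemma coxeter_length_adjacent:
  "w permutes {1..n} \<Longrightarrow> 1 \<le> i \<Longrightarrow> i < n \<Longrightarrow>
    coxeter_length n (w \<circ> transpose i (i+1)) = coxeter_length n w + 1 \<longleftrightarrow> w i < w (i+1)"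
  using coxeter_length_Suc_iff[of w n i "i+1"] by auto

lemma permutes_comp_adjacent:
  "w permutes {1..n::nat} \<Longrightarrow> 1 \<le> i \<Longrightarrow> i < n \<Longrightarrow> w \<circ> transpose i (i+1) permutes {1..n}"
  by (intro permutes_comp_transpose) auto

lemma inversions_adjacent_ascent:
  "w permutes {1..n} \<Longrightarrow> 1 \<le> i \<Longrightarrow> i < n \<Longrightarrow> w i < w (i+1) \<Longrightarrow>
    inversions n (w \<circ> transpose i (i+1)) = inversions n w + 1"
  by (subst inversions_adjacent) (auto dest: permutes_inj)

lemma schubert_rel_divided_diff:
  assumes "w permutes {1..n}" "1 \<le> i" "i < n" "w i < w (i+1)"
    and "schubert_rel n (w \<circ> transpose i (i+1)) f"
  shows "schubert_rel n w (divided_diff i f)"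
  using assms(5,1-3)
  by (rule schubert_rel.divided_difference)
     (use assms coxeter_length_adjacent[of w n i] divided_diff in auto)

text \<open>Inversion of the inductive definition in workable terms: ascents in place of lengths,
  and the operator \<open>divided_diff\<close> in place of an unnamed quotient.\<close>

lemma schubert_rel_cases:
  assumes "schubert_rel n w f"
  obtains (longest) "\<And>i. 1 \<le> i \<Longrightarrow> i < n \<Longrightarrow> w (i+1) < w i" "f = (\<Prod>i = 1..<n. var i ^ (n - i))"
  | (ascent) i F where "1 \<le> i" "i < n" "w i < w (i+1)"
      "schubert_rel n (w \<circ> transpose i (i+1)) F" "f = divided_diff i F"
  using assms
proof (cases rule: schubert_rel.cases)
  case longest
  then show ?thesis using longest_imp_no_ascent that(1) by blast
next
  case (divided_difference i F)
  then have "w i < w (i+1)" using coxeter_length_adjacent[of w n i] by simp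
  then show ?thesis using that(2)[of i F] divided_difference divided_diff_unique by metis
qed

lemma schubert_rel_exists:
  assumes "w permutes {1..n}"
  shows "\<exists>f. schubert_rel n w f"
  using assms
proof (induction "n * n - inversions n w" arbitrary: w rule: less_induct)
  case less
  show ?case
  proof (cases "\<exists>i. 1 \<le> i \<and> i < n \<and> w i < w (i+1)")
    case True
    then obtain i where i: "1 \<le> i" "i < n" "w i < w (i+1)" by auto
    let ?v = "w \<circ> transpose i (i+1)"
    have v: "?v permutes {1..n}" using less.prems i by (intro permutes_comp_adjacent)
    have "n * n - inversions n ?v < n * n - inversions n w"
      using inversions_adjacent_ascent[OF less.prems i] inversions_le[of n ?v] by simp
    then show ?thesis using less.hyps[OF _ v] schubert_rel_divided_diff[OF less.prems i] by blast
  next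
    case False
    have "w (i+1) < w i" if "1 \<le> i" "i < n" for i
    proof -
      have "w i \<noteq> w (i+1)" using permutes_eq_iff[OF less.prems, of i "i+1"] by simp
      then show ?thesis using False that by (meson linorder_neqE_nat)
    qed
    then show ?thesis using schubert_rel.longest no_ascent_imp_longest[OF less.prems] by blast
  qed
qed

lemma transpose_comp_braid:
  "transpose i (i+1) \<circ> transpose (i+1) (i+2) \<circ> transpose i (i+1) =
   transpose (i+1) (i+2) \<circ> transpose i (i+1) \<circ> transpose (i+1) (i+(2::nat))"
  by (auto simp: fun_eq_iff transpose_def)

lemma transpose_comp_commute:
  "i + 1 < j \<Longrightarrow> transpose i (i+1) \<circ> transpose j (j+1) = transpose j (j+1) \<circ> transpose i (i+(1::nat))"
  by (auto simp: fun_eq_iff transpose_def)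

text \<open>Two ascents \<open>i < j\<close> of \<open>w\<close> have a common upper bound in the weak order, and the two ways down
  from it agree by the commutation and braid relations.\<close>

lemma schubert_rel_diamond:
  assumes w: "w permutes {1..n}" and i: "1 \<le> i" "w i < w (i+1)" and j: "j < n" "w j < w (j+1)" and "i < j"
    and F: "schubert_rel n (w \<circ> transpose i (i+1)) F" and G: "schubert_rel n (w \<circ> transpose j (j+1)) G"
    and uniq: "\<And>v f g. v permutes {1..n} \<Longrightarrow> inversions n w < inversions n v \<Longrightarrow>
      schubert_rel n v f \<Longrightarrow> schubert_rel n v g \<Longrightarrow> f = g"
  shows "divided_diff i F = divided_diff j G"
proof -
  let ?si = "transpose i (i+1)" and ?sj = "transpose j (j+1)"
  have ij: "i < n" "1 \<le> j" using assms by auto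
  have perm: "w \<circ> ?si permutes {1..n}" "w \<circ> ?sj permutes {1..n}"
    using permutes_comp_adjacent w i j ij by blast+
  have inv: "inversions n w < inversions n (w \<circ> ?si)" "inversions n w < inversions n (w \<circ> ?sj)"
    using inversions_adjacent_ascent[OF w i(1) ij(1) i(2)] inversions_adjacent_ascent[OF w ij(2) j]
    by simp_all
  have F': "F = f" if "schubert_rel n (w \<circ> ?si) f" for f using uniq[OF perm(1) inv(1)] F that by blast
  have G': "G = f" if "schubert_rel n (w \<circ> ?sj) f" for f using uniq[OF perm(2) inv(2)] G that by blast
  show ?thesis
  proof (cases "j = i + 1")
    case False
    then have far: "i + 1 < j" using \<open>i < j\<close> by simp
    have comm: "w \<circ> ?si \<circ> ?sj = w \<circ> ?sj \<circ> ?si"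
      by (simp only: comp_assoc transpose_comp_commute[OF far])
    have "w \<circ> ?si \<circ> ?sj permutes {1..n}" using permutes_comp_adjacent[OF perm(1)] ij j by blast
    then obtain H where H: "schubert_rel n (w \<circ> ?si \<circ> ?sj) H" using schubert_rel_exists by blast
    have "F = divided_diff j H"
      using H far j ij perm by (intro F' schubert_rel_divided_diff) auto
    moreover have "G = divided_diff i H"
      using H[unfolded comm] far i ij perm by (intro G' schubert_rel_divided_diff) auto
    ultimately show ?thesis using divided_diff_commute[OF far] by simp
  next
    case True
    have sj: "?sj = transpose (i+1) (i+2)" using True by simp
    have braid: "w \<circ> ?si \<circ> ?sj \<circ> ?si = w \<circ> ?sj \<circ> ?si \<circ> ?sj"
      by (simp only: comp_assoc sj transpose_comp_braid[unfolded comp_assoc])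
    have perm2: "w \<circ> ?si \<circ> ?sj permutes {1..n}" "w \<circ> ?sj \<circ> ?si permutes {1..n}"
      using permutes_comp_adjacent[OF perm(1)] permutes_comp_adjacent[OF perm(2)] i ij j by blast+
    have "w \<circ> ?si \<circ> ?sj \<circ> ?si permutes {1..n}" using permutes_comp_adjacent[OF perm2(1)] ij i by blast
    then obtain H where H: "schubert_rel n (w \<circ> ?si \<circ> ?sj \<circ> ?si) H" using schubert_rel_exists by blast
    \<comment> \<open>Two neighbouring ascents give three increasing values, so along both words of
      the braid relation each of the three steps up from \<open>w\<close> is again an
      ascent.\<close>
    have lt: "w i < w (i+1)" "w (i+1) < w (i+2)" using i j True by simp_all
    have ev: "?si i = i+1" "?si (i+1) = i" "?si (i+2) = i+2" "?sj i = i" "?sj (i+1) = i+2" "?sj (i+2) = i+1"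
      using True by (auto simp: transpose_def)
    have "schubert_rel n (w \<circ> ?si \<circ> ?sj) (divided_diff i H)"
      by (rule schubert_rel_divided_diff[OF perm2(1) i(1) ij(1) _ H]) (simp only: o_apply ev lt)
    then have "schubert_rel n (w \<circ> ?si) (divided_diff j (divided_diff i H))"
      by (rule schubert_rel_divided_diff[OF perm(1) ij(2) j(1), rotated])
         (use True lt ev in \<open>simp add: o_apply\<close>)
    then have FH: "F = divided_diff j (divided_diff i H)" by (rule F')
    have "schubert_rel n (w \<circ> ?sj \<circ> ?si) (divided_diff j H)"
      by (rule schubert_rel_divided_diff[OF perm2(2) ij(2) j(1) _ H[unfolded braid]])
         (use True lt ev in \<open>simp add: o_apply\<close>)
    then have "schubert_rel n (w \<circ> ?sj) (divided_diff i (divided_diff j H))"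
      by (rule schubert_rel_divided_diff[OF perm(2) i(1) ij(1), rotated])
         (use True lt ev in \<open>simp add: o_apply\<close>)
    then have "G = divided_diff i (divided_diff j H)" by (rule G')
    with FH show ?thesis using divided_diff_braid[of i H] True by simp
  qed
qed

text \<open>Induction downwards from the longest permutation. Derivations that end at different
  ascents are reconciled by the diamond lemma, whose hypothesis \<open>uniq\<close> is the induction
  hypothesis.\<close>

lemma schubert_rel_unique:
  assumes "schubert_rel n w f" "schubert_rel n w g"
  shows "f = g"
  using assms
proof (induction "n * n - inversions n w" arbitrary: w f g rule: less_induct)
  case less
  have w: "w permutes {1..n}" using less.prems(1) by (rule schubert_rel_permutes)
  have uniq: "f' = g'" if "v permutes {1..n}" "inversions n w < inversions n v"
    "schubert_rel n v f'" "schubert_rel n v g'" for v f' g'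
    using that less.hyps[of v f' g'] inversions_le[of n v] by simp
  show ?case
    using less.prems(1)
  proof (cases rule: schubert_rel_cases)
    case longest
    note f = this
    show ?thesis using less.prems(2)
    proof (cases rule: schubert_rel_cases)
      case (ascent i F) then show ?thesis using f(1)[OF ascent(1,2)] by simp
    qed (use f in simp)
  next
    case (ascent i F)
    note i = this
    show ?thesis using less.prems(2)
    proof (cases rule: schubert_rel_cases)
      case longest then show ?thesis using i(3) longest(1)[OF i(1,2)] by simp
    next
      case (ascent j G)
      consider "i = j" | "i < j" | "j < i" by linarith
      then show ?thesis
      proof cases
        case 1
        have "inversions n w < inversions n (w \<circ> transpose i (i+1))"
          using inversions_adjacent_ascent[OF w i(1-3)] by simp
        then have "F = G" using uniq i(4) ascent(4) unfolding 1 by (metis schubert_rel_permutes)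
        then show ?thesis using 1 i ascent by simp
      next
        case 2
        show ?thesis unfolding i(5) ascent(5)
          using w i(1,3) ascent(2,3) 2 i(4) ascent(4) uniq by (rule schubert_rel_diamond)
      next
        case 3
        show ?thesis unfolding i(5) ascent(5)
          by (rule sym) (use w ascent(1,3) i(2,3) 3 ascent(4) i(4) uniq in \<open>rule schubert_rel_diamond\<close>)
      qed
    qed
  qed
qed

lemma schubert_eqI: "schubert_rel n w f \<Longrightarrow> schubert n w = f"
  unfolding schubert_def by (rule the_equality) (auto dest: schubert_rel_unique)

lemma schubert_rel_schubert: "w permutes {1..n} \<Longrightarrow> schubert_rel n w (schubert n w)"
  using schubert_rel_exists schubert_eqI by metis

lemma schubert_eq_divided_diff:
  assumes "w permutes {1..n}" "1 \<le> i" "i < n" "w i < w (i+1)"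
  shows "schubert n w = divided_diff i (schubert n (w \<circ> transpose i (i+1)))"
  using assms by (intro schubert_eqI schubert_rel_divided_diff schubert_rel_schubert permutes_comp_adjacent)

text \<open>At an ascent the polynomial is itself a value of \<open>divided_diff i\<close>, hence
  symmetric in the two variables.\<close>

lemma divided_diff_schubert_ascent:
  assumes "w permutes {1..n}" "1 \<le> i" "i < n" "w i < w (i+1)"
  shows "divided_diff i (schubert n w) = 0"
  unfolding schubert_eq_divided_diff[OF assms] by (rule divided_diff_sym) (rule swap_vars_divided_diff)

lemma divided_diff_schubert_descent:
  assumes "w permutes {1..n}" "1 \<le> i" "i < n" "w (i+1) < w i"
  shows "divided_diff i (schubert n w) = schubert n (w \<circ> transpose i (i+1))"
proof -
  let ?v = "w \<circ> transpose i (i+1)"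
  have "schubert n ?v = divided_diff i (schubert n (?v \<circ> transpose i (i+1)))"
    using assms by (intro schubert_eq_divided_diff permutes_comp_adjacent) auto
  then show ?thesis by (simp only: comp_assoc transpose_comp_involutory comp_id)
qed

section \<open>Lehmer codes and dominant permutations\<close>

definition lehmer_code :: "nat \<Rightarrow> (nat \<Rightarrow> nat) \<Rightarrow> nat \<Rightarrow> nat" where
  "lehmer_code n w i = card {j \<in> {i<..n}. w j < w i}"

lemma lehmer_code_split:
  assumes "i < n"
  shows "lehmer_code n w i = card {j \<in> {i+1<..n}. w j < w i} + (if w (i+1) < w i then 1 else 0)"
proof -
  have split: "{j \<in> {i<..n}. w j < w i} = {j \<in> {i+1<..n}. w j < w i} \<union> (if w (i+1) < w i then {i+1} else {})"
    using assms by (auto, metis Suc_lessI)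
  then show ?thesis unfolding lehmer_code_def by (subst split) (auto simp: card_insert_if)
qed

lemma lehmer_code_comp_adjacent:
  assumes "i < n" "w i < w (i+1)"
  shows "lehmer_code n (w \<circ> transpose i (i+1)) i = lehmer_code n w (i+1) + 1"
    and "lehmer_code n (w \<circ> transpose i (i+1)) (i+1) = lehmer_code n w i"
    and "j \<noteq> i \<Longrightarrow> j \<noteq> i+1 \<Longrightarrow> lehmer_code n (w \<circ> transpose i (i+1)) j = lehmer_code n w j"
proof -
  let ?s = "transpose i (i+1)"
  have out: "{j \<in> {i+1<..n}. (w \<circ> ?s) j < y} = {j \<in> {i+1<..n}. w j < y}" for y by auto
  show "lehmer_code n (w \<circ> ?s) i = lehmer_code n w (i+1) + 1"
    unfolding lehmer_code_split[OF assms(1)] out using assms by (simp add: lehmer_code_def)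
  show "lehmer_code n (w \<circ> ?s) (i+1) = lehmer_code n w i"
    unfolding lehmer_code_split[OF assms(1)] using assms out by (simp add: lehmer_code_def)
  assume j: "j \<noteq> i" "j \<noteq> i+1"
  have "bij_betw ?s {l \<in> {j<..n}. (w \<circ> ?s) l < (w \<circ> ?s) j} {l \<in> {j<..n}. w l < w j}"
    by (rule bij_betwI[of _ _ _ ?s]) (use j assms in \<open>auto simp: transpose_def split: if_splits\<close>)
  then show "lehmer_code n (w \<circ> ?s) j = lehmer_code n w j"
    unfolding lehmer_code_def by (rule bij_betw_same_card)
qed

text \<open>The \<open>v i - 1\<close> values below \<open>v i\<close> stand either to the right of
  \<open>i\<close>, where the code counts them, or to the left. For the endpoints of Pieri chains
  the left side is the easier one to count.\<close>

lemma lehmer_code_add_card_less: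
  assumes v: "v permutes {1..n}" and i: "1 \<le> i" "i \<le> n"
  shows "lehmer_code n v i + card {j \<in> {1..<i}. v j < v i} = v i - 1"
proof -
  have "v ` {j \<in> {1..n}. v j < v i} = {1..<v i}"
  proof (intro set_eqI iffI)
    fix y assume y: "y \<in> {1..<v i}"
    have "v i \<le> n" using permutes_apply_in[OF v] i by simp
    then have "y \<in> v ` {1..n}" using y permutes_image[OF v] by simp
    then show "y \<in> v ` {j \<in> {1..n}. v j < v i}" using y by auto
  qed (use permutes_apply_in[OF v] in auto)
  then have "card {j \<in> {1..n}. v j < v i} = v i - 1"
    using card_image[of v "{j \<in> {1..n}. v j < v i}"] permutes_inj[OF v] by (simp add: inj_on_def inj_def)
  moreover have "{j \<in> {1..n}. v j < v i} = {j \<in> {i<..n}. v j < v i} \<union> {j \<in> {1..<i}. v j < v i}"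
    using i by auto (metis less_irrefl linorder_neqE_nat)
  moreover have "card ({j \<in> {i<..n}. v j < v i} \<union> {j \<in> {1..<i}. v j < v i}) =
      lehmer_code n v i + card {j \<in> {1..<i}. v j < v i}"
    unfolding lehmer_code_def by (intro card_Un_disjoint) auto
  ultimately show ?thesis by simp
qed

text \<open>At an ascent \<open>i\<close> a weakly decreasing code has two equal entries c. The
  exchange makes them c + 1 and c, and the divided difference turns the corresponding monomial back
  into the one with exponents c and c.\<close>

lemma schubert_dominant:
  assumes "w permutes {1..n}" "\<And>i. 1 \<le> i \<Longrightarrow> i < n \<Longrightarrow> lehmer_code n w (i+1) \<le> lehmer_code n w i"
  shows "schubert n w = (\<Prod>i=1..n. var i ^ lehmer_code n w i)"
  using assms
proof (induction "n * n - inversions n w" arbitrary: w rule: less_induct)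
  case less
  note w = less.prems(1)
  define P where "P i \<longleftrightarrow> 1 \<le> i \<and> i < n \<and> w i < w (i+1)" for i
  have desc: "w (i+1) < w i" if "1 \<le> i" "i < n" "\<not> P i" for i
  proof -
    have "w i \<noteq> w (i+1)" using permutes_eq_iff[OF w, of i "i+1"] by simp
    then show ?thesis using that unfolding P_def by (meson linorder_neqE_nat)
  qed
  show ?case
  proof (cases "\<exists>i. P i")
    case False
    then have rel: "schubert n w = (\<Prod>i = 1..<n. var i ^ (n - i))"
      using desc by (intro schubert_eqI schubert_rel.longest no_ascent_imp_longest w) auto
    have dec: "w j < w i" if "1 \<le> i" "i < j" "j \<le> n" for i j
      using that(2,3)
    proof (induction j)
      case (Suc j) then show ?case using desc[of j] False that(1) by (cases "i = j") auto
    qed simp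
    have "lehmer_code n w i = n - i" if "1 \<le> i" for i
    proof -
      have "{j \<in> {i<..n}. w j < w i} = {i<..n}" using dec that by auto
      then show ?thesis by (simp add: lehmer_code_def)
    qed
    then have "(\<Prod>i=1..n. var i ^ lehmer_code n w i) = (\<Prod>i = 1..n. var i ^ (n - i) :: nat mpol)" by simp
    also have "\<dots> = (\<Prod>i = 1..<n. var i ^ (n - i))"
      by (rule prod.mono_neutral_right) auto
    finally show ?thesis using rel by simp
  next
    case True
    \<comment> \<open>The first ascent is taken because position i - 1 is then a descent, so its
      code entry exceeds that of \<open>i\<close> and the raised entry at \<open>i\<close> does not
      destroy dominance.\<close>
    define i where "i = (LEAST i. P i)"
    have Pi: "P i" using True unfolding i_def by (meson LeastI_ex)
    have least: "\<not> P j" if "j < i" for j using that not_less_Least unfolding i_def by blast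
    have i: "1 \<le> i" "i < n" "w i < w (i+1)" using Pi unfolding P_def by auto
    let ?v = "w \<circ> transpose i (i+1)"
    let ?c = "lehmer_code n w i"
    have v: "?v permutes {1..n}" using w i by (intro permutes_comp_adjacent)
    have "?c \<le> lehmer_code n w (i+1)"
      unfolding lehmer_code_split[OF i(2), of w] using i by (auto simp: lehmer_code_def intro!: card_mono)
    then have c: "lehmer_code n w (i+1) = ?c" using less.prems(2)[OF i(1,2)] by simp
    note code = lehmer_code_comp_adjacent[where w = w, OF i(2,3)]
    have dom: "lehmer_code n ?v (j+1) \<le> lehmer_code n ?v j" if j: "1 \<le> j" "j < n" for j
    proof -
      consider "j = i" | "j = i + 1" | "j + 1 = i" | "j \<noteq> i" "j \<noteq> i+1" "j + 1 \<noteq> i" by blast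
      then show ?thesis
      proof cases
        case 1 then show ?thesis using code(1,2) c by simp
      next
        case 2
        have "lehmer_code n ?v (j+1) = lehmer_code n w (j+1)" using 2 by (intro code(3)) auto
        then show ?thesis using less.prems(2)[OF j] 2 code(2) c by simp
      next
        case 3
        have "w i < w j" using desc[of j] least[of j] 3 j by auto
        then have "{l \<in> {j+1<..n}. w l < w i} \<subseteq> {l \<in> {j+1<..n}. w l < w j}" by auto
        then have "?c + 1 \<le> lehmer_code n w j"
          unfolding lehmer_code_split[OF j(2), of w] using 3 \<open>w i < w j\<close>
          by (auto simp: lehmer_code_def intro!: card_mono)
        moreover have "lehmer_code n ?v j = lehmer_code n w j" using 3 by (intro code(3)) auto
        ultimately show ?thesis using code(1) c 3 by simp
      next
        case 4
        have "lehmer_code n ?v (j+1) = lehmer_code n w (j+1)" "lehmer_code n ?v j = lehmer_code n w j"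
          using 4 by (intro code(3); simp)+
        then show ?thesis using less.prems(2)[OF j] by simp
      qed
    qed
    have "n * n - inversions n ?v < n * n - inversions n w"
      using inversions_adjacent_ascent[OF w i] inversions_le[of n ?v] by simp
    from less.hyps[OF this v dom]
    have Sv: "schubert n ?v = (\<Prod>j=1..n. var j ^ lehmer_code n ?v j)" .
    let ?S = "{1..n} - {i, i+1}"
    define R where "R = (\<Prod>j\<in>?S. var j ^ lehmer_code n w j :: nat mpol)"
    have split: "(\<Prod>j=1..n. f j) = f i * f (i+1) * (\<Prod>j\<in>?S. f j)" for f :: "nat \<Rightarrow> nat mpol"
    proof -
      have "(\<Prod>j=1..n. f j) = f i * (\<Prod>j\<in>{1..n} - {i}. f j)" using i by (intro prod.remove) auto
      also have "(\<Prod>j\<in>{1..n} - {i}. f j) = f (i+1) * (\<Prod>j\<in>{1..n} - {i} - {i+1}. f j)"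
        using i by (intro prod.remove) auto
      finally show ?thesis by (simp add: Diff_insert2[symmetric] insert_commute mult.assoc)
    qed
    have R: "(\<Prod>j\<in>?S. var j ^ lehmer_code n ?v j) = R"
      unfolding R_def by (intro prod.cong refl arg_cong2[where f = "(^)"] code(3)) auto
    have Rsym: "swap_vars i R = R"
      unfolding R_def swap_vars_prod by (intro prod.cong refl) auto
    have "schubert n ?v = var i ^ (?c + 1) * var (i+1) ^ ?c * R"
      unfolding Sv split R code(1,2) c ..
    moreover have "divided_diff i (var i ^ (?c + 1) * var (i+1) ^ ?c * R) = var i ^ ?c * var (i+1) ^ ?c * R"
      by (rule divided_diff_unique) (simp add: Rsym algebra_simps)
    ultimately show ?thesis
      unfolding schubert_eq_divided_diff[OF w i] split R_def[symmetric] c by simp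
  qed
qed

lemma schubert_id: "schubert n id = 1"
proof -
  have "lehmer_code n id i = 0" for i by (simp add: lehmer_code_def)
  then show ?thesis using schubert_dominant[of id n] by (simp add: permutes_id)
qed

section \<open>Linear independence of the Schubert polynomials\<close>

lemma inversions_eq_0_imp_id:
  assumes "w permutes {1..n}" "inversions n w = 0"
  shows "w = id"
  using exists_reduced_word[OF assms(1)] assms(2) by auto

text \<open>For \<open>w\<close> of maximal length in a relation, the divided difference at a
  descent of \<open>w\<close> produces a relation of smaller maximal length in which the coefficient
  of \<open>w\<close> reappears at the shortened permutation. At length 0 only the identity, with
  polynomial 1, is left.\<close>

lemma schubert_independent:
  assumes "(\<Sum>w | w permutes {1..n}. of_int (c w) * schubert n w) = 0" "w permutes {1..n}"
  shows "c w = 0"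
proof -
  let ?W = "{w. w permutes {1..n}}"
  have fin: "finite ?W" by (rule finite_permutations) simp
  have *: "c w = 0"
    if "(\<Sum>w\<in>?W. of_int (c w) * schubert n w) = 0"
      "\<And>v. v \<in> ?W \<Longrightarrow> inversions n v > L \<Longrightarrow> c v = 0" "w \<in> ?W" "inversions n w = L"
    for L c w
    using that
  proof (induction L arbitrary: c w)
    case 0
    have w: "w = id" using 0 inversions_eq_0_imp_id by auto
    have "(\<Sum>w\<in>?W. of_int (c w) * schubert n w) = (\<Sum>w\<in>{id}. of_int (c w) * schubert n w)"
      using 0(2) inversions_eq_0_imp_id fin by (intro sum.mono_neutral_right) (auto simp: permutes_id)
    then have "(of_int (c id) :: nat mpol) = 0" using 0(1) by (simp add: schubert_id)
    then have "c id = 0" by simp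
    then show ?case by (simp only: w)
  next
    case (Suc L)
    have w: "w permutes {1..n}" using Suc.prems by simp
    have "\<exists>i. 1 \<le> i \<and> i < n \<and> w (i+1) < w i"
    proof (rule ccontr)
      assume no: "\<not> ?thesis"
      have "w i < w (i+1)" if "1 \<le> i" "i < n" for i
      proof -
        have "w i \<noteq> w (i+1)" using permutes_eq_iff[OF w, of i "i+1"] by simp
        then show ?thesis using no that by (meson linorder_neqE_nat)
      qed
      then have "w = id" by (rule no_descent_imp_id[OF w])
      then have "inversions n w = 0" by (simp only: inversions_id)
      then show False using Suc.prems(4) by simp
    qed
    then obtain i where i: "1 \<le> i" "i < n" "w (i+1) < w i" by auto
    let ?s = "transpose i (i+1)"
    let ?A = "{v \<in> ?W. v i < v (i+1)}" and ?D = "{v \<in> ?W. v (i+1) < v i}"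
    \<comment> \<open>Terms with an ascent at \<open>i\<close> are annihilated. The others move to
      permutations with an ascent at \<open>i\<close>, and no two of them are merged.\<close>
    define c' where "c' v = (if v i < v (i+1) then c (v \<circ> ?s) else 0)" for v
    have disj: "v \<in> ?D" if "v \<in> ?W" "v \<notin> ?A" for v
      using that permutes_eq_iff[of v "{1..n}" i "i+1"] by auto
    have "0 = divided_diff i (\<Sum>v\<in>?W. of_int (c v) * schubert n v)"
      unfolding Suc.prems(1) by simp
    also have "\<dots> = (\<Sum>v\<in>?W. of_int (c v) * divided_diff i (schubert n v))"
      by (simp add: divided_diff_sum divided_diff_of_int_mult)
    also have "\<dots> = (\<Sum>v\<in>?W. if v (i+1) < v i then of_int (c v) * schubert n (v \<circ> ?s) else 0)"
    proof (rule sum.cong[OF refl])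
      fix v assume v: "v \<in> ?W"
      show "of_int (c v) * divided_diff i (schubert n v) =
          (if v (i+1) < v i then of_int (c v) * schubert n (v \<circ> ?s) else 0)"
      proof (cases "v i < v (i+1)")
        case True
        then show ?thesis using divided_diff_schubert_ascent[of v n i] v i by simp
      next
        case False
        then show ?thesis using divided_diff_schubert_descent[of v n i] disj[of v] v i by simp
      qed
    qed
    also have "\<dots> = (\<Sum>v\<in>?D. of_int (c v) * schubert n (v \<circ> ?s))"
      by (rule sum.inter_filter[OF fin, symmetric])
    also have "\<dots> = (\<Sum>v\<in>?A. of_int (c' v) * schubert n v)"
      by (rule sum.reindex_bij_witness[of _ "\<lambda>v. v \<circ> ?s" "\<lambda>v. v \<circ> ?s"])
         (use i permutes_comp_adjacent[of _ n i] in
           \<open>auto simp: c'_def comp_assoc simp del: Suc_eq_plus1[symmetric]\<close>)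
    also have "\<dots> = (\<Sum>v\<in>?W. of_int (c' v) * schubert n v)"
      using fin by (intro sum.mono_neutral_left) (auto simp: c'_def)
    finally have sum': "(\<Sum>v\<in>?W. of_int (c' v) * schubert n v) = 0" ..
    have "c' (w \<circ> ?s) = 0"
    proof (rule Suc.IH[OF sum'])
      fix v assume v: "v \<in> ?W" "L < inversions n v"
      show "c' v = 0"
      proof (cases "v i < v (i+1)")
        case True
        then have "inversions n (v \<circ> ?s) = inversions n v + 1"
          using inversions_adjacent_ascent[of v n i] v i by simp
        then have "Suc L < inversions n (v \<circ> ?s)" using v(2) by linarith
        moreover have "v \<circ> ?s \<in> ?W" using v(1) i permutes_comp_adjacent[of v n i] by blast
        ultimately have "c (v \<circ> ?s) = 0" using Suc.prems(2) by blast
        then show ?thesis unfolding c'_def by (simp only: if_cancel)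
      qed (simp add: c'_def)
    next
      show "w \<circ> ?s \<in> ?W" using permutes_comp_adjacent[OF w i(1,2)] by simp
      show "inversions n (w \<circ> ?s) = L"
        using inversions_adjacent_descent[OF i(1,2) permutes_inj[OF w] i(3)] Suc.prems(4) by simp
    qed
    then show ?case using i by (simp add: c'_def comp_assoc)
  qed
  show ?thesis
  proof (rule ccontr)
    assume "c w \<noteq> 0"
    then have "\<exists>v. (v \<in> ?W \<and> c v \<noteq> 0) \<and> (\<forall>y. y \<in> ?W \<and> c y \<noteq> 0 \<longrightarrow> inversions n y \<le> inversions n v)"
      using assms(2) inversions_le by (intro ex_has_greatest_nat[of _ w _ "n * n + 1"]) (auto simp: less_Suc_eq_le)
    then obtain v where v: "v \<in> ?W" "c v \<noteq> 0" "\<And>y. y \<in> ?W \<Longrightarrow> c y \<noteq> 0 \<Longrightarrow> inversions n y \<le> inversions n v" by blast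
    then have "c v = 0" using assms(1) by (intro *[of c "inversions n v" v]) (auto simp: not_less[symmetric])
    with v show False by simp
  qed
qed

section \<open>Pieri chains\<close>

definition pieri_values :: "nat \<Rightarrow> nat \<Rightarrow> (nat \<Rightarrow> nat) \<Rightarrow> nat set \<Rightarrow> nat set" where
  "pieri_values n m u B = u ` (B \<union> {m<..n})"

definition next_value :: "nat \<Rightarrow> nat \<Rightarrow> (nat \<Rightarrow> nat) \<Rightarrow> nat set \<Rightarrow> nat \<Rightarrow> nat" where
  "next_value n m u B x = Min {y \<in> pieri_values n m u B. x < y}"

text \<open>The default 0 lies below all values of \<open>u\<close> on {1..n}, so the first tail
  position receives the least occupied value.\<close>

definition tail_pred :: "nat \<Rightarrow> (nat \<Rightarrow> nat) \<Rightarrow> nat \<Rightarrow> nat" where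
  "tail_pred m u c = (if c = m + 1 then 0 else u (c - 1))"

text \<open>The result of a Pieri chain depends only on the set \<open>B\<close> of its left positions: each value at
  a position of \<open>B\<close> moves up to the next value occupied by \<open>B\<close> or the tail \<open>{m<..n}\<close>, and the tail
  receives the values that become free.\<close>

definition pieri_perm :: "nat \<Rightarrow> nat \<Rightarrow> (nat \<Rightarrow> nat) \<Rightarrow> nat set \<Rightarrow> nat \<Rightarrow> nat" where
  "pieri_perm n m u B i =
     (if i \<in> B then next_value n m u B (u i)
      else if i \<in> {m<..n} then next_value n m u B (tail_pred m u i) else u i)"

text \<open>A left position moves only once, from \<open>u b\<close> to its final value, and a
  position outside \<open>B\<close> up to \<open>m\<close> never moves. For such pairs the covering
  condition of the Bruhat order can therefore be read off from the endpoint.\<close>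

definition pieri_admissible :: "nat \<Rightarrow> nat \<Rightarrow> (nat \<Rightarrow> nat) \<Rightarrow> nat set \<Rightarrow> bool" where
  "pieri_admissible n m u B \<longleftrightarrow>
     (\<forall>b\<in>B. \<forall>j\<in>{b<..m} - B. \<not> (u b < u j \<and> u j < pieri_perm n m u B b))"

text \<open>By \<open>fix_n\<close> the largest value sits in the tail, so every smaller value has a
  next occupied one and no chain has to leave {1..n}.\<close>

locale sorted_tail =
  fixes n m :: nat and u :: "nat \<Rightarrow> nat"
  assumes perm: "u permutes {1..n}" and m_less: "m < n" and fix_n: "u n = n"
    and tail: "\<And>i j. m < i \<Longrightarrow> i < j \<Longrightarrow> j \<le> n \<Longrightarrow> u i < u j"
begin

abbreviation "V \<equiv> pieri_values n m u"
abbreviation "nxt \<equiv> next_value n m u"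
abbreviation "tp \<equiv> tail_pred m u"
abbreviation "pv \<equiv> pieri_perm n m u"
abbreviation "adm \<equiv> pieri_admissible n m u"

lemma eq_iff: "u i = u j \<longleftrightarrow> i = j"
  by (rule permutes_eq_iff[OF perm])

lemma u_less: "1 \<le> i \<Longrightarrow> i \<le> n \<Longrightarrow> i \<noteq> n \<Longrightarrow> u i < n"
  using permutes_apply_in[OF perm, of i] eq_iff[of i n] fix_n by (simp add: le_neq_implies_less)

lemma u_pos: "1 \<le> i \<Longrightarrow> i \<le> n \<Longrightarrow> 0 < u i"
  using permutes_apply_in[OF perm, of i] by simp

lemma n_in_V: "n \<in> V B"
  using m_less fix_n by (auto simp: pieri_values_def image_iff intro!: bexI[of _ n])

lemma finite_V: "B \<subseteq> {1..m} \<Longrightarrow> finite (V B)"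
  by (auto simp: pieri_values_def intro: finite_subset)

lemma V_le: "B \<subseteq> {1..m} \<Longrightarrow> y \<in> V B \<Longrightarrow> y \<le> n"
proof -
  assume "B \<subseteq> {1..m}" "y \<in> V B"
  then obtain i where "y = u i" "i \<in> {1..n}" using m_less by (force simp: pieri_values_def)
  then show ?thesis using permutes_apply_in[OF perm, of i] by simp
qed

lemma in_V: "i \<in> B \<Longrightarrow> u i \<in> V B" "m < i \<Longrightarrow> i \<le> n \<Longrightarrow> u i \<in> V B"
  by (auto simp: pieri_values_def)

lemma u_in_V_iff: "1 \<le> i \<Longrightarrow> i \<le> m \<Longrightarrow> u i \<in> V B \<longleftrightarrow> i \<in> B"
  by (auto simp: pieri_values_def eq_iff)

lemma V_insert: "V (insert b B) = insert (u b) (V B)"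
  by (auto simp: pieri_values_def)

lemma nxt:
  assumes "B \<subseteq> {1..m}" "x < n"
  shows "nxt B x \<in> V B" "x < nxt B x" "\<And>y. y \<in> V B \<Longrightarrow> x < y \<Longrightarrow> nxt B x \<le> y"
proof -
  have fin: "finite {y \<in> V B. x < y}" using finite_V[OF assms(1)] by simp
  have "{y \<in> V B. x < y} \<noteq> {}" using n_in_V assms by blast
  from Min_in[OF fin this] show "nxt B x \<in> V B" "x < nxt B x" by (auto simp: next_value_def)
  show "nxt B x \<le> y" if "y \<in> V B" "x < y" for y
    unfolding next_value_def using fin that by (intro Min_le) auto
qed

lemma nxt_eqI:
  assumes "B \<subseteq> {1..m}" "z \<in> V B" "x < z" "\<And>y. y \<in> V B \<Longrightarrow> x < y \<Longrightarrow> z \<le> y"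
  shows "nxt B x = z"
  unfolding next_value_def using finite_V[OF assms(1)] assms by (intro Min_eqI) auto

lemma tp_less: "m < c \<Longrightarrow> c \<le> n \<Longrightarrow> tp c < n"
  using u_less[of "c - 1"] m_less by (auto simp: tail_pred_def)

lemma tp_in_V: "m < c \<Longrightarrow> c \<le> n \<Longrightarrow> tp c = 0 \<or> tp c \<in> V B"
  by (auto simp: tail_pred_def intro: in_V(2))

lemma tp_mono: "m < c \<Longrightarrow> c < d \<Longrightarrow> d \<le> n \<Longrightarrow> tp c < tp d \<and> tp d \<in> V B"
  using u_pos[of "d - 1"] tail[of "c - 1" "d - 1"] by (auto simp: tail_pred_def intro: in_V(2))

lemma tp_less_u: "m < c \<Longrightarrow> c \<le> n \<Longrightarrow> tp c < u c"
  using u_pos[of c] tail[of "c - 1" c] by (auto simp: tail_pred_def)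

lemma pv_in: "i \<in> B \<Longrightarrow> pv B i = nxt B (u i)"
  by (simp add: pieri_perm_def)

lemma pv_tail: "B \<subseteq> {1..m} \<Longrightarrow> m < i \<Longrightarrow> i \<le> n \<Longrightarrow> pv B i = nxt B (tp i)"
  by (auto simp: pieri_perm_def)

lemma pv_out: "i \<notin> B \<Longrightarrow> i \<le> m \<Longrightarrow> pv B i = u i"
  by (simp add: pieri_perm_def)

lemma pv_greater:
  assumes "B \<subseteq> {1..m}" "i \<in> B"
  shows "u i < pv B i" "pv B i \<in> V B"
  using assms nxt[OF assms(1), of "u i"] u_less[of i] m_less by (auto simp: pv_in)

lemma pv_tail_mono:
  assumes B: "B \<subseteq> {1..m}" and "m < i" "i < j" "j \<le> n"
  shows "pv B i < pv B j"
proof -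
  have "pv B i \<le> tp j" using nxt(3)[OF B, of "tp i" "tp j"] tp_mono[of i j B] tp_less[of i] assms
    by (simp add: pv_tail)
  also have "\<dots> < pv B j" using nxt(2)[OF B tp_less] assms by (simp add: pv_tail)
  finally show ?thesis .
qed

lemma pv_empty: "pv {} = u"
proof
  fix i
  show "pv {} i = u i"
  proof (cases "i \<in> {m<..n}")
    case True
    have "nxt {} (tp i) = u i"
    proof (rule nxt_eqI)
      fix y assume "y \<in> V {}" "tp i < y"
      then obtain j where j: "y = u j" "m < j" "j \<le> n" by (auto simp: pieri_values_def)
      show "u i \<le> y"
      proof (cases "j < i")
        case True
        then have "u j \<le> tp i" using tail[of j "i - 1"] j \<open>i \<in> _\<close>
          by (cases "j = i - 1") (force simp: tail_pred_def)+
        then show ?thesis using \<open>tp i < y\<close> j by simp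
      next
        case False
        then show ?thesis using tail[of i j] j True by (cases "i = j") auto
      qed
    qed (use True tp_less_u in \<open>auto intro: in_V\<close>)
    then show ?thesis using True by (simp add: pieri_perm_def)
  qed (auto simp: pieri_perm_def)
qed

text \<open>The right position \<open>c\<close> that a chain step with left position \<open>b\<close> must use: no value occupied by
  \<open>B\<close> or the tail lies between \<open>tail_pred m u c\<close> and \<open>u b\<close>.\<close>

definition slot :: "nat set \<Rightarrow> nat \<Rightarrow> nat \<Rightarrow> bool" where
  "slot B b c \<longleftrightarrow> m < c \<and> c \<le> n \<and> tp c < u b \<and> (\<forall>y\<in>V B. tp c < y \<longrightarrow> u b < y)"

lemma slot_nxt:
  assumes "B \<subseteq> {1..m}" "slot B b c"
  shows "pv B c \<in> V B" "u b < pv B c" "\<And>y. y \<in> V B \<Longrightarrow> u b < y \<Longrightarrow> pv B c \<le> y"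
  using assms nxt[OF assms(1) tp_less, of c] unfolding slot_def by (auto simp: pv_tail)

text \<open>The new value \<open>u b\<close> splits a single gap between occupied values, the one
  above \<open>tp c\<close>. Its upper end passes from \<open>c\<close> to \<open>b\<close>, its new
  lower part ends at \<open>u b\<close>, which goes to \<open>c\<close>, and all other next values
  stay the same.\<close>

lemma pv_insert:
  assumes B: "B \<subseteq> {1..m}" and b: "b \<in> {1..m}" "b \<notin> B" and c: "slot B b c"
  shows "pv (insert b B) = pv B \<circ> transpose b c"
proof -
  let ?B = "insert b B"
  have B': "?B \<subseteq> {1..m}" using B b by auto
  have c': "m < c" "c \<le> n" "tp c < u b" and above: "\<And>y. y \<in> V B \<Longrightarrow> tp c < y \<Longrightarrow> u b < y"
    using c by (auto simp: slot_def)
  have ub: "u b < n" using b m_less by (intro u_less) auto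
  have nb: "nxt ?B (u b) = nxt B (tp c)"
    using slot_nxt[OF B c] c' B by (intro nxt_eqI[OF B']) (auto simp: V_insert pv_tail)
  have nc: "nxt ?B (tp c) = u b"
    using c' above by (intro nxt_eqI[OF B']) (auto simp: V_insert dest: above less_imp_le)
  have other: "nxt ?B x = nxt B x" if x: "x < n" "x = 0 \<or> x \<in> V B" "x \<noteq> tp c" for x
  proof (rule nxt_eqI[OF B'])
    show "nxt B x \<in> V ?B" "x < nxt B x" using nxt[OF B x(1)] by (auto simp: V_insert)
    fix y assume y: "y \<in> V ?B" "x < y"
    show "nxt B x \<le> y"
    proof (cases "y \<in> V B")
      case True then show ?thesis using nxt(3)[OF B x(1)] y by simp
    next
      case False
      then have yb: "y = u b" using y by (simp add: V_insert)
      then have "x < tp c" using x above[of x] y c' by (metis gr_zeroI linorder_neqE_nat not_less_iff_gr_or_eq)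
      then have "nxt B x \<le> tp c" using nxt(3)[OF B x(1)] tp_in_V[OF c'(1,2), of B] by auto
      then show ?thesis using c' yb by simp
    qed
  qed
  show ?thesis
  proof
    fix i
    consider "i = b" | "i = c" | "i \<in> B" | "m < i" "i \<le> n" "i \<noteq> c" | "i \<notin> ?B" "i \<notin> {m<..n}" by auto
    then show "pv ?B i = (pv B \<circ> transpose b c) i"
    proof cases
      case 1 then show ?thesis using nb c' B by (simp add: pv_in pv_tail)
    next
      case 2
      have "pv ?B c = u b" using nc c' B' by (simp add: pv_tail)
      then show ?thesis using 2 b by (simp add: pv_out)
    next
      case 3
      have i: "1 \<le> i" "i \<le> m" "i \<noteq> b" "i \<noteq> c" using 3 B b c' by auto
      have "u i \<noteq> tp c" using u_pos[of i] i m_less eq_iff[of i "c - 1"] c' by (auto simp: tail_pred_def)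
      then have "nxt ?B (u i) = nxt B (u i)" using 3 i m_less by (intro other u_less) (auto intro: in_V)
      then show ?thesis using 3 i by (simp add: pv_in)
    next
      case 4
      have "tp i \<noteq> tp c" using tp_mono[of i c B] tp_mono[of c i B] 4 c' by (metis less_irrefl linorder_neqE_nat)
      then have "nxt ?B (tp i) = nxt B (tp i)" using 4 by (intro other tp_less tp_in_V)
      then show ?thesis using 4 b B B' by (simp add: pv_tail)
    next
      case 5
      then have "i \<noteq> b" "i \<noteq> c" using c' by auto
      then show ?thesis using 5 unfolding pieri_perm_def by (simp split del: if_split add: if_not_P)
    qed
  qed
qed

text \<open>Take the largest occupied value below \<open>u b\<close>, or 0 if there is none. It
  cannot sit at a position of \<open>B\<close>, because that position would then jump over
  \<open>u b\<close>; so it belongs to the tail, and the slot is the tail position after it.\<close>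

lemma exists_slot:
  assumes B: "B \<subseteq> {1..m}" and b: "b \<in> {1..m}" "b \<notin> B"
    and nopred: "\<And>b'. b' \<in> B \<Longrightarrow> \<not> (u b' < u b \<and> u b < pv B b')"
  shows "\<exists>c. slot B b c"
proof -
  let ?X = "insert 0 {y \<in> V B. y < u b}"
  define x where "x = Max ?X"
  have fin: "finite ?X" using finite_V[OF B] by simp
  have x: "x \<in> ?X" unfolding x_def using fin by (intro Max_in) auto
  have max: "y \<le> x" if "y \<in> ?X" for y unfolding x_def using fin that by (intro Max_ge)
  have ub: "0 < u b" "u b < n" using b m_less by (auto intro: u_pos u_less)
  have notin: "u b \<notin> V B" using b by (simp add: u_in_V_iff)
  have above: "u b < y" if "y \<in> V B" "x < y" for y
    using max[of y] that notin by (metis (mono_tags, lifting) insertI2 leD linorder_neqE_nat mem_Collect_eq)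
  have "\<exists>c. m < c \<and> c \<le> n \<and> tp c = x"
  proof (cases "x = 0")
    case True then show ?thesis using m_less by (intro exI[of _ "m+1"]) (auto simp: tail_pred_def)
  next
    case False
    then have xV: "x \<in> V B" "x < u b" using x by auto
    then obtain i where i: "x = u i" "i \<in> B \<or> (m < i \<and> i \<le> n)" by (auto simp: pieri_values_def)
    have "i \<notin> B"
    proof
      assume iB: "i \<in> B"
      then have "u b < pv B i" using pv_greater[OF B iB] above i by simp
      then show False using nopred[OF iB] xV i by simp
    qed
    moreover have "i \<noteq> n" using i xV ub fix_n by auto
    ultimately show ?thesis using i by (intro exI[of _ "i+1"]) (auto simp: tail_pred_def)
  qed
  then show ?thesis using above x ub by (auto simp: slot_def)
qed

text \<open>The set is built by decreasing value of \<open>u\<close>. A new position then lies below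
  all earlier ones, so no earlier position can have jumped over it and a slot exists.\<close>

lemma subset_ranking_induct [consumes 1, case_names empty insert]:
  assumes "B \<subseteq> {1..m}" and "P {}"
    and "\<And>b S. S \<subseteq> {1..m} \<Longrightarrow> b \<in> {1..m} \<Longrightarrow> b \<notin> S \<Longrightarrow> (\<And>y. y \<in> S \<Longrightarrow> u b < u y) \<Longrightarrow> P S \<Longrightarrow> P (insert b S)"
  shows "P B"
proof -
  have "finite B" using assms(1) finite_subset by blast
  then show ?thesis using assms(1)
  proof (induction rule: finite_ranking_induct[where f = "\<lambda>b. n - u b"])
    case empty show ?case by (rule assms(2))
  next
    case (insert b S)
    show ?case
    proof (cases "b \<in> S")
      case True then show ?thesis using insert by (simp add: insert_absorb)
    next
      case False
      have "u b < u y" if y: "y \<in> S" for y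
      proof -
        have "u y \<noteq> u b" "u y \<le> n" "u b \<le> n"
          using eq_iff False y insert.prems permutes_apply_in[OF perm, of y] permutes_apply_in[OF perm, of b] m_less
          by auto
        then show ?thesis using insert.hyps(2)[OF y] by linarith
      qed
      then show ?thesis using insert False by (intro assms(3)) auto
    qed
  qed
qed

lemma exists_slot_least:
  assumes "B \<subseteq> {1..m}" "b \<in> {1..m}" "b \<notin> B" "\<And>y. y \<in> B \<Longrightarrow> u b < u y"
  shows "\<exists>c. slot B b c"
proof (rule exists_slot[OF assms(1-3)])
  fix b' assume "b' \<in> B"
  then show "\<not> (u b' < u b \<and> u b < pv B b')" using assms(4)[of b'] by simp
qed

lemma pv_permutes: "B \<subseteq> {1..m} \<Longrightarrow> pv B permutes {1..n}"
proof (induction rule: subset_ranking_induct)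
  case empty show ?case by (simp only: pv_empty perm)
next
  case (insert b S)
  obtain c where c: "slot S b c" using exists_slot_least[OF insert.hyps] by blast
  have "b \<in> {1..n}" "c \<in> {1..n}" using c insert m_less by (auto simp: slot_def)
  then show ?case unfolding pv_insert[OF insert(1-3) c] using insert.IH by (intro permutes_comp_transpose)
qed

lemma pv_eq_iff: "B \<subseteq> {1..m} \<Longrightarrow> pv B i = pv B j \<longleftrightarrow> i = j"
  by (rule permutes_eq_iff[OF pv_permutes])

text \<open>Values on \<open>B\<close> strictly rise, so \<open>B\<close> is the set of positions up
  to \<open>m\<close> whose value has changed.\<close>

lemma pv_inj:
  assumes "B \<subseteq> {1..m}" "B' \<subseteq> {1..m}" "pv B = pv B'"
  shows "B = B'"
proof -
  have "B = {i \<in> {1..m}. pv B i \<noteq> u i}" if "B \<subseteq> {1..m}" for B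
    using that pv_greater[OF that] pv_out[of _ B] by fastforce
  then show ?thesis using assms by metis
qed

definition valid_step :: "nat set \<Rightarrow> nat \<Rightarrow> nat \<Rightarrow> bool" where
  "valid_step B b c \<longleftrightarrow>
     pv B b < pv B c \<and> (\<forall>j. b < j \<and> j < c \<longrightarrow> \<not> (pv B b < pv B j \<and> pv B j < pv B c))"

text \<open>Three kinds of positions lie between \<open>b\<close> and \<open>c\<close>. Those in
  \<open>B\<close> carry occupied values and are excluded by minimality of the next value, the
  unmoved ones by admissibility, and those of the tail have values below \<open>u b\<close>.\<close>

lemma valid_step_slot:
  assumes B: "B \<subseteq> {1..m}" and b: "b \<in> {1..m}" "b \<notin> B" and c: "slot B b c"
    and adm: "adm (insert b B)"
  shows "valid_step B b c"
  unfolding valid_step_def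
proof (intro conjI allI impI)
  have c': "m < c" "c \<le> n" "tp c < u b" using c by (auto simp: slot_def)
  have pb: "pv B b = u b" using b by (simp add: pv_out)
  show "pv B b < pv B c" using pb slot_nxt[OF B c] by simp
  fix j assume j: "b < j \<and> j < c"
  consider "j \<in> B" | "j \<le> m" "j \<notin> B" | "m < j" by linarith
  then show "\<not> (pv B b < pv B j \<and> pv B j < pv B c)"
  proof cases
    case 1 then show ?thesis using pv_greater[OF B 1] slot_nxt(3)[OF B c] pb by force
  next
    case 2
    have "pv (insert b B) b = pv B c" unfolding pv_insert[OF B b c] by simp
    then show ?thesis using 2 adm j pb by (auto simp: pieri_admissible_def pv_out)
  next
    case 3
    have "pv B j \<le> tp c" using nxt(3)[OF B, of "tp j" "tp c"] tp_mono[of j c B] tp_less[of j] 3 j c' B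
      by (simp add: pv_tail)
    then show ?thesis using pb c' by simp
  qed
qed

text \<open>Without \<open>b\<close> in the set, \<open>b\<close> is an unmoved position, which can
  obstruct only jumps that start below \<open>u b\<close>. There are none, as \<open>u b\<close> is
  least.\<close>

lemma adm_insert_least:
  assumes B: "B \<subseteq> {1..m}" and b: "b \<in> {1..m}" "b \<notin> B" and least: "\<And>y. y \<in> B \<Longrightarrow> u b < u y"
    and c: "slot B b c" and adm: "adm (insert b B)"
  shows "adm B"
  unfolding pieri_admissible_def
proof (intro ballI)
  fix b' j assume bj: "b' \<in> B" "j \<in> {b'<..m} - B"
  have "b' \<noteq> b" "b' \<noteq> c" using bj B b c by (auto simp: slot_def)
  then have "pv (insert b B) b' = pv B b'" unfolding pv_insert[OF B b c] by simp
  then show "\<not> (u b' < u j \<and> u j < pv B b')"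
    using adm bj least[OF bj(1)] unfolding pieri_admissible_def by (cases "j = b") auto
qed

text \<open>A given chain may move its positions in any order, so \<open>u b\<close> need not be
  least here. A position of \<open>B\<close> that jumped over \<open>u b\<close> would, by
  admissibility, stand to the right of \<open>b\<close> and obstruct the step; hence a slot
  \<open>d\<close> exists. If \<open>d\<close> were not \<open>c\<close>, it would stand between
  \<open>b\<close> and \<open>c\<close> and obstruct the step as well.\<close>

lemma valid_step_imp:
  assumes B: "B \<subseteq> {1..m}" and adm: "adm B" and b: "b \<in> {1..m}" "b \<notin> B" and c: "m < c" "c \<le> n"
    and valid: "valid_step B b c"
  shows "slot B b c" and "adm (insert b B)"
proof -
  have pb: "pv B b = u b" using b by (simp add: pv_out)
  have pc: "pv B c \<in> V B" using nxt(1)[OF B tp_less] c B by (simp add: pv_tail)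
  have lt: "u b < pv B c" and between: "\<And>j. b < j \<Longrightarrow> j < c \<Longrightarrow> u b < pv B j \<Longrightarrow> pv B c \<le> pv B j"
    using valid pb by (auto simp: valid_step_def not_less)
  have "\<exists>c. slot B b c"
  proof (rule exists_slot[OF B b])
    fix b' assume b': "b' \<in> B"
    show "\<not> (u b' < u b \<and> u b < pv B b')"
    proof
      assume less: "u b' < u b \<and> u b < pv B b'"
      have bm: "1 \<le> b'" "b' \<le> m" "b' \<noteq> b" using b' B b by auto
      then have "b < b'" using adm b' b less unfolding pieri_admissible_def
        by (metis DiffI atLeastAtMost_iff greaterThanAtMost_iff linorder_neqE_nat)
      then have "pv B c \<le> pv B b'" using between[of b'] less bm c by simp
      moreover have "pv B b' \<le> pv B c" using nxt(3)[OF B, of "u b'"] b' pc less lt u_less[of b'] bm m_less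
        by (simp add: pv_in)
      ultimately show False using pv_eq_iff[OF B, of b' c] bm c by simp
    qed
  qed
  then obtain d where d: "slot B b d" ..
  have d': "m < d" "d \<le> n" using d by (auto simp: slot_def)
  have "d = c"
  proof (rule ccontr)
    assume "d \<noteq> c"
    have "pv B d \<le> pv B c" using slot_nxt(3)[OF B d pc lt] .
    then have "d < c" using pv_tail_mono[OF B c(1), of d] d' \<open>d \<noteq> c\<close> by (meson linorder_neqE_nat not_less)
    then have "pv B c \<le> pv B d" using between[of d] slot_nxt(2)[OF B d] b d' by simp
    then show False using pv_tail_mono[OF B d'(1) \<open>d < c\<close> c(2)] by simp
  qed
  with d show slot: "slot B b c" by simp
  show "adm (insert b B)"
    unfolding pieri_admissible_def
  proof (intro ballI)
    fix b' j assume bj: "b' \<in> insert b B" "j \<in> {b'<..m} - insert b B"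
    have pj: "pv B j = u j" using bj by (auto simp: pv_out)
    show "\<not> (u b' < u j \<and> u j < pv (insert b B) b')"
    proof (cases "b' = b")
      case True
      then have "pv (insert b B) b' = pv B c" unfolding pv_insert[OF B b slot] by simp
      then show ?thesis using between[of j] bj True pj c by (cases "u b < u j") auto
    next
      case False
      then have "pv (insert b B) b' = pv B b'" using bj B c unfolding pv_insert[OF B b slot] by auto
      then show ?thesis using adm bj False by (auto simp: pieri_admissible_def)
    qed
  qed
qed

lemma coxeter_length_valid_step:
  assumes "B \<subseteq> {1..m}" "b \<in> {1..m}" "m < c" "c \<le> n"
  shows "coxeter_length n (pv B \<circ> transpose b c) = coxeter_length n (pv B) + 1 \<longleftrightarrow> valid_step B b c"
  unfolding valid_step_def using assms pv_permutes[OF assms(1)]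
  by (intro coxeter_length_Suc_iff) auto

definition pieri_chain :: "nat \<Rightarrow> (nat \<Rightarrow> nat) \<Rightarrow> (nat \<Rightarrow> nat) \<Rightarrow> bool" where
  "pieri_chain l b c \<longleftrightarrow>
     (\<forall>i\<in>{1..l}. b i \<in> {1..m} \<and> c i \<in> {m<..n} \<and>
        coxeter_length n (chain u b c i) = coxeter_length n u + i) \<and> inj_on b {1..l}"

lemma pieri_chain_length:
  "pieri_chain l b c \<Longrightarrow> i \<le> l \<Longrightarrow> coxeter_length n (chain u b c i) = coxeter_length n u + i"
  by (cases "i = 0") (auto simp: pieri_chain_def)

lemma pieri_chain_imp:
  "pieri_chain l b c \<Longrightarrow> chain u b c l = pv (b ` {1..l}) \<and> adm (b ` {1..l})"
proof (induction l)
  case 0 show ?case by (simp add: pv_empty pieri_admissible_def)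
next
  case (Suc l)
  let ?B = "b ` {1..l}" and ?b = "b (Suc l)" and ?c = "c (Suc l)"
  have "pieri_chain l b c" using Suc.prems by (auto simp: pieri_chain_def inj_on_def)
  then have IH: "chain u b c l = pv ?B" "adm ?B" using Suc.IH by auto
  have B: "?B \<subseteq> {1..m}" using Suc.prems by (auto simp: pieri_chain_def)
  have b: "?b \<in> {1..m}" and c: "m < ?c" "?c \<le> n"
    using Suc.prems by (auto simp: pieri_chain_def)
  have "inj_on b (insert (Suc l) {1..l})"
    using Suc.prems by (simp add: pieri_chain_def atLeastAtMostSuc_conv)
  then have nb: "?b \<notin> ?B" by (simp add: inj_on_insert)
  note b = b nb
  have "coxeter_length n (pv ?B) = coxeter_length n u + l"
    using pieri_chain_length[OF Suc.prems, of l] IH(1) by simp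
  moreover have "coxeter_length n (pv ?B \<circ> transpose ?b ?c) = coxeter_length n u + Suc l"
    using pieri_chain_length[OF Suc.prems order_refl] IH(1) by simp
  ultimately have "valid_step ?B ?b ?c"
    using coxeter_length_valid_step[OF B b(1) c] by simp
  note step = valid_step_imp[OF B IH(2) b c this]
  have "b ` {1..Suc l} = insert ?b ?B" by (simp add: atLeastAtMostSuc_conv)
  then show ?case using step IH(1) pv_insert[OF B b step(1)] by simp
qed

lemma chain_cong: "(\<And>i. 1 \<le> i \<Longrightarrow> i \<le> l \<Longrightarrow> b i = b' i \<and> c i = c' i) \<Longrightarrow> chain u b c l = chain u b' c' l"
  by (induction l) auto

text \<open>Moving the left positions by decreasing value ensures that each next step has a slot and
  that admissibility passes to all intermediate sets.\<close>

lemma exists_pieri_chain: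
  assumes "B \<subseteq> {1..m}" "adm B"
  shows "\<exists>b c. pieri_chain (card B) b c \<and> chain u b c (card B) = pv B \<and> b ` {1..card B} = B"
  using assms
proof (induction rule: subset_ranking_induct)
  case empty show ?case by (simp add: pieri_chain_def pv_empty)
next
  case (insert x S)
  obtain y where y: "slot S x y" using exists_slot_least[OF insert.hyps] by blast
  have "adm S" using adm_insert_least[OF insert.hyps y insert.prems] .
  then obtain b c where bc: "pieri_chain (card S) b c" "chain u b c (card S) = pv S" "b ` {1..card S} = S"
    using insert.IH by blast
  define l where "l = card S"
  have card: "card (insert x S) = Suc l" using insert finite_subset[of S "{1..m}"] by (simp add: l_def)
  let ?b = "b(Suc l := x)" and ?c = "c(Suc l := y)"
  have pre: "chain u ?b ?c i = chain u b c i" if "i \<le> l" for i using that by (intro chain_cong) auto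
  have y': "m < y" "y \<le> n" using y by (auto simp: slot_def)
  have valid: "valid_step S x y" using valid_step_slot[OF insert.hyps(1-3) y insert.prems] .
  have len: "coxeter_length n (pv S) = coxeter_length n u + l"
    using pieri_chain_length[OF bc(1) order_refl] bc(2) by (simp only: l_def)
  have last: "chain u ?b ?c (Suc l) = pv (insert x S)"
    using bc(2) pre[of l] unfolding pv_insert[OF insert(1-3) y] by (simp add: l_def)
  have Suc_range: "{1..Suc l} = insert (Suc l) {1..l}" by auto
  have "?b ` {1..l} = b ` {1..l}" by (rule image_cong) auto
  then have im: "?b ` {1..l} = S" using bc(3) by (simp only: l_def)
  have "pieri_chain (Suc l) ?b ?c"
    unfolding pieri_chain_def
  proof (intro conjI ballI)
    fix i assume i: "i \<in> {1..Suc l}"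
    show "?b i \<in> {1..m}" "?c i \<in> {m<..n}"
      using i bc(1) insert.hyps y' unfolding pieri_chain_def l_def[symmetric] by auto
    show "coxeter_length n (chain u ?b ?c i) = coxeter_length n u + i"
    proof (cases "i = Suc l")
      case True
      have "coxeter_length n (pv (insert x S)) = coxeter_length n (pv S) + 1"
        using coxeter_length_valid_step[of S x y] valid insert.hyps y' pv_insert[OF insert(1-3) y] by simp
      then show ?thesis using True last len by simp
    next
      case False
      then show ?thesis using i pre[of i] pieri_chain_length[OF bc(1), of i] by (simp add: l_def)
    qed
  next
    have "inj_on ?b {1..l} \<longleftrightarrow> inj_on b {1..l}" by (rule inj_on_cong) auto
    then have "inj_on ?b {1..l}" using bc(1) by (simp only: pieri_chain_def l_def)
    moreover have "{1..l} - {Suc l} = {1..l}" by auto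
    ultimately show "inj_on ?b {1..Suc l}" unfolding Suc_range inj_on_insert using im insert.hyps(3)
      by (simp only: fun_upd_same) simp
  qed
  moreover have "?b ` {1..Suc l} = insert x S"
    unfolding Suc_range image_insert im by (simp only: fun_upd_same)
  ultimately show ?case using last unfolding card by blast
qed

end

lemma cycle_perm_apply:
  assumes "r \<le> m"
  shows "cycle_perm r m i = (if i < r \<or> m + 1 < i then i else if i = m + 1 then r else i + 1)"
  using assms
proof (induction m arbitrary: i rule: nat_induct_at_least)
  case base
  show ?case by (auto simp: cycle_perm_def transpose_def)
next
  case (Suc m)
  have "cycle_perm r (Suc m) = cycle_perm r m \<circ> transpose (Suc m) (Suc m + 1)"
    using Suc.hyps by (simp add: cycle_perm_def simple_word_append comp_assoc)
  then show ?case using Suc by (auto simp: transpose_def)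
qed

text \<open>\<open>pieri_step\<close> quantifies over all presentations of \<open>\<alpha>\<close>
  as a cycle. They coincide, since m + 1 is the largest point moved and \<open>r\<close> is its
  image.\<close>

lemma cycle_perm_inj:
  assumes "r \<le> m" "r' \<le> m'" "cycle_perm r m = cycle_perm r' m'"
  shows "r = r' \<and> m = m'"
proof -
  have le: "m' \<le> m" if "r \<le> m" "r' \<le> m'" "cycle_perm r m = cycle_perm r' m'" for r m r' m'
  proof (rule ccontr)
    assume "\<not> m' \<le> m"
    then have "cycle_perm r m (m' + 1) = m' + 1" using that by (subst cycle_perm_apply) auto
    moreover have "cycle_perm r' m' (m' + 1) = r'" using that by (subst cycle_perm_apply) auto
    ultimately show False using that by simp
  qed
  have m: "m = m'" using le[OF assms] le[OF assms(2,1) assms(3)[symmetric]] by simp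
  have r: "cycle_perm r m (m + 1) = r" "cycle_perm r' m' (m' + 1) = r'"
    using assms(1,2) by (simp_all add: cycle_perm_apply)
  have "cycle_perm r m (m + 1) = cycle_perm r' m' (m' + 1)" unfolding assms(3) unfolding m ..
  then have "r = r'" by (simp only: r)
  with m show ?thesis by simp
qed

lemma (in sorted_tail) pieri_step_iff:
  assumes r: "1 \<le> r" "r \<le> m"
  shows "{v. pieri_step n (cycle_perm r m) u v} =
    pv ` {B. B \<subseteq> {1..m} \<and> card B = m - r + 1 \<and> adm B}"
proof (intro set_eqI iffI)
  fix v assume "v \<in> {v. pieri_step n (cycle_perm r m) u v}"
  then obtain r' m' b c where rm: "r' \<le> m'" "cycle_perm r m = cycle_perm r' m'"
    and bc: "\<forall>i\<in>{1..m' - r' + 1}. b i \<in> {1..n} \<and> c i \<in> {1..n} \<and> b i \<le> m' \<and> m' < c i"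
      "v = chain u b c (m' - r' + 1)"
      "\<forall>i\<in>{1..m' - r' + 1}. coxeter_length n (chain u b c i) = coxeter_length n u + i"
      "inj_on b {1..m' - r' + 1}"
    unfolding pieri_step_def mem_Collect_eq by blast
  have "r' = r" "m' = m" using cycle_perm_inj[OF r(2) rm] by auto
  note bc = bc[unfolded this]
  have "pieri_chain (m - r + 1) b c" unfolding pieri_chain_def using bc by simp
  note pieri_chain_imp[OF this]
  moreover have "card (b ` {1..m - r + 1}) = m - r + 1" using bc(4) by (simp add: card_image)
  moreover have "b ` {1..m - r + 1} \<subseteq> {1..m}" using bc(1) by auto
  ultimately show "v \<in> pv ` {B. B \<subseteq> {1..m} \<and> card B = m - r + 1 \<and> adm B}" using bc(2) by blast
next
  fix v assume "v \<in> pv ` {B. B \<subseteq> {1..m} \<and> card B = m - r + 1 \<and> adm B}"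
  then obtain B where B: "B \<subseteq> {1..m}" "card B = m - r + 1" "adm B" "v = pv B" by blast
  then obtain b c where bc: "pieri_chain (m - r + 1) b c" "chain u b c (m - r + 1) = v"
    using exists_pieri_chain[OF B(1,3)] by auto
  have "\<forall>i\<in>{1..m - r + 1}. b i \<in> {1..n} \<and> c i \<in> {1..n} \<and> b i \<le> m \<and> m < c i"
    using bc(1) m_less unfolding pieri_chain_def by fastforce
  then have "\<exists>b c. (\<forall>i\<in>{1..m - r + 1}. b i \<in> {1..n} \<and> c i \<in> {1..n} \<and> b i \<le> m \<and> m < c i) \<and>
      v = chain u b c (m - r + 1) \<and>
      (\<forall>i\<in>{1..m - r + 1}. coxeter_length n (chain u b c i) = coxeter_length n u + i) \<and>
      inj_on b {1..m - r + 1}"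
    using bc unfolding pieri_chain_def by (intro exI[of _ b] exI[of _ c]) simp
  moreover have "v permutes {1..n}" using pv_permutes[OF B(1)] B(4) by simp
  ultimately show "v \<in> {v. pieri_step n (cycle_perm r m) u v}"
    using r m_less perm unfolding pieri_step_def mem_Collect_eq
    by (intro conjI exI[of _ r] exI[of _ m]) simp_all
qed

section \<open>Pieri's formula\<close>

lemma pieri_values_comp_transpose:
  assumes "i < m"
  shows "pieri_values n m (u \<circ> transpose i (i+1)) (transpose i (i+1) ` B) = pieri_values n m u B"
proof -
  have "transpose i (i+1) ` {m<..n} = {m<..n}" using assms by (intro transpose_image_eq) auto
  then have "transpose i (i+1) ` (transpose i (i+1) ` B \<union> {m<..n}) = B \<union> {m<..n}"
    by (simp add: image_Un image_image)
  then show ?thesis by (simp only: pieri_values_def image_comp[symmetric])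
qed

text \<open>The construction works with occupied values; exchanging two positions up to
  \<open>m\<close> merely relabels \<open>B\<close> and leaves these values and the tail
  untouched.\<close>

lemma pieri_perm_comp_transpose:
  assumes "i < m"
  shows "pieri_perm n m (u \<circ> transpose i (i+1)) (transpose i (i+1) ` B) =
    pieri_perm n m u B \<circ> transpose i (i+1)"
proof
  fix x
  let ?s = "transpose i (i+1)"
  have mem: "x \<in> ?s ` B \<longleftrightarrow> ?s x \<in> B" by (simp add: in_transpose_image_iff)
  have nv: "next_value n m (u \<circ> ?s) (?s ` B) = next_value n m u B"
    unfolding next_value_def pieri_values_comp_transpose[OF assms] ..
  have tail: "?s x = x" "tail_pred m (u \<circ> ?s) x = tail_pred m u x" if "x \<in> {m<..n}"
    using that assms by (auto simp: tail_pred_def transpose_def)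
  have iff: "?s x \<in> {m<..n} \<longleftrightarrow> x \<in> {m<..n}" using assms by (auto simp: transpose_def)
  show "pieri_perm n m (u \<circ> ?s) (?s ` B) x = (pieri_perm n m u B \<circ> ?s) x"
  proof (cases "x \<in> {m<..n}")
    case True
    show ?thesis unfolding pieri_perm_def nv mem o_apply iff tail(1)[OF True] tail(2)[OF True, unfolded o_def]
      by (simp only: tail(2)[OF True])
  next
    case False
    show ?thesis unfolding pieri_perm_def nv mem o_apply iff by (simp only: False if_False)
  qed
qed

context sorted_tail
begin

lemma sorted_tail_comp_transpose:
  assumes "1 \<le> i" "i < m"
  shows "sorted_tail n m (u \<circ> transpose i (i+1))"
proof
  show "u \<circ> transpose i (i+1) permutes {1..n}"
    using permutes_comp_adjacent[OF perm, of i] assms m_less by simp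
  show "(u \<circ> transpose i (i+1)) n = n" using assms m_less fix_n by simp
qed (use m_less tail assms in \<open>auto simp: transpose_def\<close>)

text \<open>The value at \<open>i\<close> cannot jump over \<open>u (i+1)\<close>: if i + 1 is in
  \<open>B\<close>, that value is occupied, and otherwise admissibility forbids it.\<close>

lemma pv_ascent:
  assumes B: "B \<subseteq> {1..m}" and adm: "adm B" and i: "1 \<le> i" "i < m" "u i < u (i+1)"
  shows "pv B i < pv B (i+1)"
proof (cases "i \<in> B")
  case True
  have un: "u i < n" using i m_less by (intro u_less) auto
  show ?thesis
  proof (cases "i + 1 \<in> B")
    case iB: True
    have "pv B i \<le> u (i+1)" using nxt(3)[OF B un in_V(1)[OF iB]] i(3) True by (simp add: pv_in)
    then show ?thesis using pv_greater(1)[OF B iB] by simp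
  next
    case False
    then have "\<not> (u i < u (i+1) \<and> u (i+1) < pv B i)"
      using adm True i unfolding pieri_admissible_def by auto
    then have "pv B i \<le> pv B (i+1)" using i False by (simp add: pv_out)
    then show ?thesis using pv_eq_iff[OF B, of i "i+1"] by simp
  qed
next
  case False
  have "u (i+1) \<le> pv B (i+1)" using pv_greater(1)[OF B, of "i+1"] pv_out[of "i+1" B] i
    by (cases "i+1 \<in> B") auto
  then show ?thesis using False i by (simp add: pv_out)
qed

text \<open>The exchange reverses the order of positions only for the pair i, i + 1. The extra
  requirement for \<open>u\<close> is that \<open>i\<close> does not jump over an unmoved i + 1, and
  the ascent of the endpoint expresses it. In Pieri's formula it selects the terms that survive the
  divided difference.\<close>

lemma adm_comp_transpose_iff:
  assumes B: "B \<subseteq> {1..m}" and i: "1 \<le> i" "i < m" "u i < u (i+1)"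
  shows "adm B \<longleftrightarrow> pieri_admissible n m (u \<circ> transpose i (i+1)) (transpose i (i+1) ` B) \<and>
    pv B i < pv B (i+1)"
proof -
  let ?s = "transpose i (i+1)"
  have mem: "x \<in> ?s ` B \<longleftrightarrow> ?s x \<in> B" for x by (simp add: in_transpose_image_iff)
  have adm': "pieri_admissible n m (u \<circ> ?s) (?s ` B) \<longleftrightarrow>
      (\<forall>b\<in>B. \<forall>j. ?s b < j \<and> j \<le> m \<and> ?s j \<notin> B \<longrightarrow> \<not> (u b < u (?s j) \<and> u (?s j) < pv B b))"
  proof -
    have "pieri_admissible n m (u \<circ> ?s) (?s ` B) \<longleftrightarrow> (\<forall>b\<in>?s ` B. \<forall>j. b < j \<and> j \<le> m \<and> ?s j \<notin> B \<longrightarrow>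
        \<not> (u (?s b) < u (?s j) \<and> u (?s j) < pv B (?s b)))"
      unfolding pieri_admissible_def pieri_perm_comp_transpose[OF i(2)] Ball_def Diff_iff
        greaterThanAtMost_iff mem o_apply by blast
    then show ?thesis by (simp only: ball_simps(9) transpose_involutory)
  qed
  have order: "?s x < ?s y" if "x < y" "x \<noteq> i \<or> y \<noteq> i+1" for x y
    using that by (auto simp: transpose_def)
  have le: "?s x \<le> m" if "x \<le> m" for x using that i by (auto simp: transpose_def)
  show ?thesis
  proof (intro iffI conjI)
    assume adm: "adm B"
    then show "pv B i < pv B (i+1)" using pv_ascent[OF B _ i] by simp
    show "pieri_admissible n m (u \<circ> ?s) (?s ` B)"
      unfolding adm'
    proof (intro ballI allI impI)
      fix b j assume b: "b \<in> B" and j: "?s b < j \<and> j \<le> m \<and> ?s j \<notin> B"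
      show "\<not> (u b < u (?s j) \<and> u (?s j) < pv B b)"
      proof (cases "?s b = i \<and> j = i+1")
        case True
        then have "?s (?s b) = ?s i" "?s j = i" by simp_all
        then have "b = i+1" "?s j = i" by simp_all
        then show ?thesis using i by simp
      next
        case False
        then have "b < ?s j" using order[of "?s b" j] j by simp
        then show ?thesis using adm b j le[of j] unfolding pieri_admissible_def by auto
      qed
    qed
  next
    assume *: "pieri_admissible n m (u \<circ> ?s) (?s ` B) \<and> pv B i < pv B (i+1)"
    show "adm B" unfolding pieri_admissible_def
    proof (intro ballI)
      fix b j assume b: "b \<in> B" and j: "j \<in> {b<..m} - B"
      show "\<not> (u b < u j \<and> u j < pv B b)"
      proof (cases "b = i \<and> j = i+1")
        case True
        then show ?thesis using * j by (simp add: pv_out)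
      next
        case False
        then have "?s b < ?s j" using order[of b j] j by auto
        then show ?thesis using * b j le[of j] unfolding adm' by fastforce
      qed
    qed
  qed
qed

lemma lehmer_code_pv_tail:
  assumes "B \<subseteq> {1..m}" "m < i"
  shows "lehmer_code n (pv B) i = 0"
proof -
  have "\<not> pv B j < pv B i" if "j \<in> {i<..n}" for j
    using pv_tail_mono[OF assms, of j] that by auto
  then have "{j \<in> {i<..n}. pv B j < pv B i} = {}" by blast
  then show ?thesis by (simp add: lehmer_code_def)
qed

text \<open>All values to the left of \<open>i\<close> start above \<open>u i\<close>. If
  \<open>i\<close> moves up to z, the earlier positions that end below z carry precisely the values
  strictly between \<open>u i\<close> and z. Subtracting their number from z - 1 leaves
  \<open>u i\<close>, one more than for an unmoved position.\<close>

lemma lehmer_code_pv_decreasing: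
  assumes B: "B \<subseteq> {1..m}" and dec: "\<And>i j. 1 \<le> i \<Longrightarrow> i < j \<Longrightarrow> j \<le> m \<Longrightarrow> u j < u i" and i: "1 \<le> i" "i \<le> m"
  shows "lehmer_code n (pv B) i = u i - 1 + (if i \<in> B then 1 else 0)"
proof -
  have i': "i \<le> n" using i m_less by simp
  have ge: "u j \<le> pv B j" if "1 \<le> j" "j \<le> m" for j
    using pv_greater(1)[OF B, of j] pv_out[of j B] that by (cases "j \<in> B") auto
  show ?thesis
  proof (cases "i \<in> B")
    case False
    have "{j \<in> {1..<i}. pv B j < pv B i} = {}"
    proof -
      have "pv B i \<le> pv B j" if "1 \<le> j" "j < i" for j
        using dec[of j i] ge[of j] that i pv_out[OF False] by simp
      then show ?thesis by (auto simp: not_less[symmetric])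
    qed
    then have "card {j \<in> {1..<i}. pv B j < pv B i} = 0" by (simp only: card.empty)
    then show ?thesis using lehmer_code_add_card_less[OF pv_permutes[OF B] i(1) i'] False
      by (simp only: pv_out[OF False i(2)] if_False add_0_right)
  next
    case True
    define z where "z = pv B i"
    have un: "u i < n" using i m_less by (intro u_less) auto
    have z: "z = nxt B (u i)" "z \<in> V B" "u i < z" using pv_greater[OF B True] True by (auto simp: z_def pv_in)
    have zle: "z \<le> n" using V_le[OF B z(2)] .
    have "u ` {j \<in> {1..<i}. pv B j < z} = {u i<..<z}"
    proof (intro set_eqI iffI)
      fix y assume "y \<in> u ` {j \<in> {1..<i}. pv B j < z}"
      then obtain j where j: "y = u j" "1 \<le> j" "j < i" "pv B j < z" by auto
      then show "y \<in> {u i<..<z}" using dec[of j i] ge[of j] i by auto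
    next
      fix y assume y: "y \<in> {u i<..<z}"
      then have "y \<in> u ` {1..n}" using permutes_image[OF perm] zle by simp
      then obtain j where j: "y = u j" "1 \<le> j" "j \<le> n" by auto
      have "y \<notin> V B" using nxt(3)[OF B un] y z(1) by (meson greaterThanLessThan_iff not_less)
      then have jB: "j \<notin> B" "j \<le> m" using j in_V[of j] by (auto simp: not_less[symmetric])
      have "j \<noteq> i" using jB True by auto
      then have "j < i" using dec[of i j] jB i y j by (meson greaterThanLessThan_iff less_asym linorder_neqE_nat)
      then show "y \<in> u ` {j \<in> {1..<i}. pv B j < z}" using j jB y by (auto simp: pv_out)
    qed
    then have "card {j \<in> {1..<i}. pv B j < z} = z - u i - 1"
      using card_image[of u "{j \<in> {1..<i}. pv B j < z}"] eq_iff by (simp add: inj_on_def)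
    then have "lehmer_code n (pv B) i + (z - u i - 1) = z - 1"
      using lehmer_code_add_card_less[OF pv_permutes[OF B] i(1) i'] by (simp add: z_def)
    then show ?thesis using True z(3) u_pos[OF i(1) i'] by simp
  qed
qed

text \<open>The entries \<open>u i - 1\<close> decrease strictly, so adding the indicator of
  \<open>B\<close> keeps the code weakly decreasing and \<open>pv B\<close> is dominant.\<close>

lemma schubert_pv_decreasing:
  assumes B: "B \<subseteq> {1..m}" and dec: "\<And>i j. 1 \<le> i \<Longrightarrow> i < j \<Longrightarrow> j \<le> m \<Longrightarrow> u j < u i"
  shows "schubert n (pv B) = (\<Prod>i=1..m. var i ^ (u i - 1)) * (\<Prod>i\<in>B. var i)"
proof -
  note code = lehmer_code_pv_decreasing[OF B dec]
  have "schubert n (pv B) = (\<Prod>i=1..n. var i ^ lehmer_code n (pv B) i)"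
  proof (rule schubert_dominant[OF pv_permutes[OF B]])
    fix i assume i: "1 \<le> i" "i < n"
    show "lehmer_code n (pv B) (i+1) \<le> lehmer_code n (pv B) i"
    proof (cases "i < m")
      case True
      then show ?thesis using code[of i] code[of "i+1"] dec[of i "i+1"] u_pos[of "i+1"] m_less i by auto
    next
      case False then show ?thesis using lehmer_code_pv_tail[OF B, of "i+1"] by simp
    qed
  qed
  also have "\<dots> = (\<Prod>i=1..m. var i ^ lehmer_code n (pv B) i)"
    using lehmer_code_pv_tail[OF B] m_less by (intro prod.mono_neutral_right) auto
  also have "\<dots> = (\<Prod>i=1..m. var i ^ (u i - 1) * (if i \<in> B then var i else 1))"
    using code by (intro prod.cong) auto
  also have "\<dots> = (\<Prod>i=1..m. var i ^ (u i - 1)) * (\<Prod>i=1..m. if i \<in> B then var i else 1)"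
    by (rule prod.distrib)
  also have "(\<Prod>i=1..m. if i \<in> B then var i else (1 :: nat mpol)) = (\<Prod>i\<in>B. var i)"
    using B by (intro prod.mono_neutral_cong_right) auto
  finally show ?thesis .
qed

end

text \<open>Every permutation with sorted tail is reached from one that decreases on \<open>{1..m}\<close> by
  adjacent transpositions to the left of \<open>m\<close>. These fix \<open>elem_sym m l\<close>, so the divided differences
  carry the formula down from the decreasing case, where all terms are monomials.\<close>

theorem schubert_pieri:
  assumes "sorted_tail n m u"
  shows "elem_sym m l * schubert n u =
    (\<Sum>B | B \<subseteq> {1..m} \<and> card B = l \<and> pieri_admissible n m u B. schubert n (pieri_perm n m u B))"
  using assms
proof (induction "n * n - inversions n u" arbitrary: u rule: less_induct)
  case less
  interpret sorted_tail n m u by (rule less.prems)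
  define S where "S u = {B. B \<subseteq> {1..m} \<and> card B = l \<and> pieri_admissible n m u B}" for u
  have finS: "finite (S u)" for u unfolding S_def by (rule finite_subset[of _ "Pow {1..m}"]) auto
  have goal: "?case \<longleftrightarrow> elem_sym m l * schubert n u = (\<Sum>B\<in>S u. schubert n (pv B))" by (simp add: S_def)
  show ?case
  proof (cases "\<exists>i. 1 \<le> i \<and> i < m \<and> u i < u (i+1)")
    case True
    then obtain i where i: "1 \<le> i" "i < m" "u i < u (i+1)" by auto
    have i': "i < n" using i m_less by simp
    let ?s = "transpose i (i+1)"
    let ?u = "u \<circ> ?s"
    interpret u': sorted_tail n m ?u using sorted_tail_comp_transpose i by blast
    have s_sub: "?s ` B \<subseteq> {1..m}" if "B \<subseteq> {1..m}" for B using that i by (auto simp: transpose_def)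
    have s_card: "card (?s ` B) = card B" for B by (simp add: card_image inj_on_transpose)
    have s_inv: "?s ` ?s ` B = B" for B by (simp add: image_image)
    have "n * n - inversions n ?u < n * n - inversions n u"
      using inversions_adjacent_ascent[OF perm i(1) i' i(3)] inversions_le[of n ?u] by simp
    from less.hyps[OF this u'.sorted_tail_axioms]
    have IH: "elem_sym m l * schubert n ?u = (\<Sum>B\<in>S ?u. schubert n (pieri_perm n m ?u B))" by (simp add: S_def)
    have "elem_sym m l * schubert n u = divided_diff i (elem_sym m l * schubert n ?u)"
      using divided_diff_mult_sym[OF swap_vars_elem_sym[OF i(1,2)]] schubert_eq_divided_diff[OF perm i(1) i' i(3)]
      by simp
    also have "\<dots> = (\<Sum>B\<in>S ?u. divided_diff i (schubert n (pieri_perm n m ?u B)))"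
      unfolding IH divided_diff_sum ..
    also have "\<dots> = (\<Sum>B\<in>S ?u. if pieri_perm n m ?u B (i+1) < pieri_perm n m ?u B i
        then schubert n (pieri_perm n m ?u B \<circ> ?s) else 0)"
    proof (rule sum.cong[OF refl])
      fix B assume "B \<in> S ?u"
      then have B: "B \<subseteq> {1..m}" by (simp add: S_def)
      note v = u'.pv_permutes[OF B]
      show "divided_diff i (schubert n (pieri_perm n m ?u B)) =
        (if pieri_perm n m ?u B (i+1) < pieri_perm n m ?u B i then schubert n (pieri_perm n m ?u B \<circ> ?s) else 0)"
      proof (cases "pieri_perm n m ?u B i < pieri_perm n m ?u B (i+1)")
        case True
        then show ?thesis using divided_diff_schubert_ascent[OF v i(1) i'] by simp
      next
        case False
        then have "pieri_perm n m ?u B (i+1) < pieri_perm n m ?u B i"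
          using u'.pv_eq_iff[OF B, of i "i+1"] by simp
        then show ?thesis using divided_diff_schubert_descent[OF v i(1) i'] by simp
      qed
    qed
    also have "\<dots> = (\<Sum>B\<in>{B \<in> S ?u. pieri_perm n m ?u B (i+1) < pieri_perm n m ?u B i}.
        schubert n (pieri_perm n m ?u B \<circ> ?s))"
      by (rule sum.inter_filter[OF finS, symmetric])
    also have "\<dots> = (\<Sum>B\<in>S u. schubert n (pv B))"
    proof (rule sum.reindex_bij_witness[of _ "image ?s" "image ?s"])
      fix B assume "B \<in> S u"
      then have B: "B \<subseteq> {1..m}" "card B = l" "adm B" by (auto simp: S_def)
      then show "?s ` B \<in> {B \<in> S ?u. pieri_perm n m ?u B (i+1) < pieri_perm n m ?u B i}"
        using adm_comp_transpose_iff[OF B(1) i] s_sub[OF B(1)] s_card[of B]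
        unfolding S_def mem_Collect_eq pieri_perm_comp_transpose[OF i(2)] o_apply
          transpose_apply_first transpose_apply_second by blast
    next
      fix B assume B: "B \<in> {B \<in> S ?u. pieri_perm n m ?u B (i+1) < pieri_perm n m ?u B i}"
      define C where "C = ?s ` B"
      have BC: "B = ?s ` C" by (simp only: C_def s_inv)
      have "C \<subseteq> {1..m}" "card C = l" using B s_sub[of B] s_card[of B] by (simp_all add: C_def S_def)
      moreover have "pieri_admissible n m ?u (?s ` C) \<and> pv C i < pv C (i+1)"
        using B unfolding BC S_def mem_Collect_eq pieri_perm_comp_transpose[OF i(2)] o_apply
          transpose_apply_first transpose_apply_second by blast
      ultimately show "?s ` B \<in> S u"
        unfolding C_def[symmetric] S_def using adm_comp_transpose_iff[of C i] i by simp
      have "pieri_perm n m ?u (?s ` C) \<circ> ?s = pv C"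
        unfolding pieri_perm_comp_transpose[OF i(2)] by (simp only: comp_assoc transpose_comp_involutory comp_id)
      then show "schubert n (pv (?s ` B)) = schubert n (pieri_perm n m ?u B \<circ> ?s)"
        unfolding C_def[symmetric] BC[symmetric] by simp
    qed (simp_all only: s_inv)
    finally show ?thesis unfolding goal .
  next
    case False
    have step: "u (i+1) < u i" if "1 \<le> i" "i < m" for i
    proof -
      have "u i \<noteq> u (i+1)" using eq_iff[of i "i+1"] by simp
      then show ?thesis using False that by (meson linorder_neqE_nat)
    qed
    have dec: "u j < u i" if "1 \<le> i" "i < j" "j \<le> m" for i j
      using that(2,3)
    proof (induction j)
      case (Suc j) then show ?case using step[of j] that(1) by (cases "i = j") auto
    qed simp
    \<comment> \<open>Here admissibility is vacuous: no position up to \<open>m\<close> to the right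
      of \<open>b\<close> has a larger value.\<close>
    have S: "S u = {B. B \<subseteq> {1..m} \<and> card B = l}"
      using dec unfolding S_def pieri_admissible_def by (auto simp: not_less) (metis atLeastAtMost_iff less_imp_le subsetD)
    let ?M = "\<Prod>i=1..m. var i ^ (u i - 1) :: nat mpol"
    have Su: "schubert n u = ?M" using schubert_pv_decreasing[of "{}"] dec by (simp add: pv_empty)
    have "(\<Sum>B\<in>S u. schubert n (pv B)) = (\<Sum>B\<in>S u. ?M * (\<Prod>i\<in>B. var i))"
      by (rule sum.cong[OF refl], rule schubert_pv_decreasing) (use dec in \<open>auto simp: S_def\<close>)
    then have "elem_sym m l * schubert n u = (\<Sum>B\<in>S u. schubert n (pv B))"
      unfolding Su elem_sym_def S by (simp add: sum_distrib_left mult.commute)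
    then show ?thesis unfolding goal .
  qed
qed

section \<open>The transition identity\<close>

locale flag =
  fixes n k :: nat and a :: "nat \<Rightarrow> nat"
  assumes a_0: "a 0 = 0" and a_last: "a (k + 1) = n" and a_strict: "strict_mono_on {0..k + 1} a"
begin

abbreviation "Sn \<equiv> perms_with_descents_in n k a"

lemma a_less: "p < q \<Longrightarrow> q \<le> k + 1 \<Longrightarrow> a p < a q"
  using a_strict by (simp add: strict_mono_on_def)

lemma a_le: "p \<le> q \<Longrightarrow> q \<le> k + 1 \<Longrightarrow> a p \<le> a q"
  using a_less[of p q] by (cases "p = q") auto

lemma a_le_n: "p \<le> k + 1 \<Longrightarrow> a p \<le> n"
  using a_le[of p "k+1"] a_last by simp

lemma a_less_n: "p \<le> k \<Longrightarrow> a p < n"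
  using a_less[of p "k+1"] a_last by simp

lemma exists_block:
  assumes "1 \<le> t" "t \<le> n"
  shows "\<exists>p\<le>k. a p < t \<and> t \<le> a (p + 1)"
proof -
  define q where "q = (LEAST q. t \<le> a q)"
  have ex: "t \<le> a (k+1)" using assms a_last by simp
  have q: "t \<le> a q" unfolding q_def using ex by (rule LeastI)
  have "q \<le> k + 1" unfolding q_def using ex by (rule Least_le)
  moreover have "q \<noteq> 0" using q assms a_0 by (intro notI) simp
  moreover have "a (q - 1) < t"
    using not_less_Least[of "q - 1" "\<lambda>q. t \<le> a q"] \<open>q \<noteq> 0\<close> unfolding q_def[symmetric] by (simp add: not_le)
  ultimately show ?thesis using q by (intro exI[of _ "q - 1"]) auto
qed

lemma block_interior:
  assumes "p \<le> k" "a p < i" "i < a (p + 1)"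
  shows "i \<notin> a ` {1..k}"
proof
  assume "i \<in> a ` {1..k}"
  then obtain q where q: "i = a q" "q \<le> k" by auto
  then have "\<not> q \<le> p" "\<not> p + 1 \<le> q" using assms a_le[of q p] a_le[of "p+1" q] by auto
  then show False by simp
qed

lemma block_unique:
  assumes "p \<le> k" "a p < t" "t \<le> a (p + 1)" "q \<le> k" "a q < t" "t \<le> a (q + 1)"
  shows "p = q"
  using assms a_le[of "p+1" q] a_le[of "q+1" p] by (cases p q rule: linorder_cases) auto

lemma Sn_permutes: "w \<in> Sn \<Longrightarrow> w permutes {1..n}"
  by (simp add: perms_with_descents_in_def)

lemma Sn_ascent:
  assumes "w \<in> Sn" "1 \<le> i" "i < n" "i \<notin> a ` {1..k}"
  shows "w i < w (i + 1)"
proof -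
  have "w i \<noteq> w (i+1)" using permutes_eq_iff[OF Sn_permutes[OF assms(1)], of i "i+1"] by simp
  then show ?thesis using assms unfolding perms_with_descents_in_def by (force simp: not_less[symmetric])
qed

lemma SnI:
  assumes "w permutes {1..n}" "\<And>i. 1 \<le> i \<Longrightarrow> i < n \<Longrightarrow> i \<notin> a ` {1..k} \<Longrightarrow> w i < w (i + 1)"
  shows "w \<in> Sn"
  using assms unfolding perms_with_descents_in_def by (force dest: less_asym)

lemma Sn_block_mono:
  assumes "w \<in> Sn" "p \<le> k" "a p < i" "i \<le> j" "j \<le> a (p + 1)"
  shows "w i + (j - i) \<le> w j"
  using assms(4,5)
proof (induction j rule: dec_induct)
  case (step j)
  have "w j < w (j+1)"
    using step assms a_le_n[of "p+1"] by (intro Sn_ascent block_interior[of p]) auto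
  then show ?case using step by simp
qed simp

text \<open>\<open>w\<close> preserves {1..N}, and on the block its values rise by at least one per
  position. Hence the first value of the block is at most \<open>a p + 1\<close>, and equality
  leaves no freedom for the others.\<close>

lemma Sn_fixed_above:
  assumes w: "w \<in> Sn" and p: "p \<le> k" "a p < N" "N \<le> a (p + 1)" and fixN: "\<And>i. N < i \<Longrightarrow> w i = i"
  shows "w (a p + 1) \<le> a p + 1" and "w (a p + 1) = a p + 1 \<Longrightarrow> a p < i \<Longrightarrow> w i = i"
proof -
  have wN: "w N \<le> N"
  proof (rule ccontr)
    assume "\<not> w N \<le> N"
    then have "w (w N) = w N" using fixN by simp
    then show False using permutes_eq_iff[OF Sn_permutes[OF w]] \<open>\<not> w N \<le> N\<close> by simp
  qed
  have lo: "w (a p + 1) + (i - (a p + 1)) \<le> w i" if "a p < i" "i \<le> N" for i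
    using that p by (intro Sn_block_mono[OF w p(1)]) auto
  have hi: "w i + (N - i) \<le> w N" if "a p < i" "i \<le> N" for i
    using that p by (intro Sn_block_mono[OF w p(1)]) auto
  show "w (a p + 1) \<le> a p + 1" using lo[of N] wN p by simp
  show "w i = i" if "w (a p + 1) = a p + 1" "a p < i"
    using fixN[of i] lo[of i] hi[of i] wN that by (cases "i \<le> N") auto
qed

end

text \<open>The theorem itself takes \<open>N = a (p + 1)\<close>. Other values of \<open>N\<close>
  are needed because the recursion lowers the bound by one each time it passes from \<open>w\<close>
  to \<open>u\<close>.\<close>

locale transition = flag +
  fixes w u :: "nat \<Rightarrow> nat" and p N :: nat
  assumes w: "w \<in> Sn" and p: "p \<le> k" "a p < N" "N \<le> a (p + 1)"
    and fixN: "\<And>i. N < i \<Longrightarrow> w i = i" and r_le: "w (a p + 1) \<le> a p"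
    and u_def: "u = (\<lambda>i. if i \<le> a p \<and> w i < w (a p + 1) then w i
                  else if i \<le> a p \<and> w i > w (a p + 1) then w i - 1
                  else w (i + 1) - 1)"
begin

abbreviation "m \<equiv> a p"
abbreviation "r \<equiv> w (a p + 1)"

lemma m_less_n: "m < n" using a_less_n p by simp

lemma N_le_n: "N \<le> n" using a_le_n[of "p+1"] p by simp

lemma w_perm: "w permutes {1..n}" by (rule Sn_permutes[OF w])

lemma w_eq_iff: "w i = w j \<longleftrightarrow> i = j" by (rule permutes_eq_iff[OF w_perm])

lemma w_0: "w 0 = 0" using w_perm by (rule permutes_not_in) simp

lemma r_pos: "1 \<le> r" using permutes_apply_in[OF w_perm, of "m + 1"] m_less_n by simp

lemma p_pos: "1 \<le> p" using r_pos r_le a_0 by (cases p) auto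

lemma w_tail_Suc: "m < i \<Longrightarrow> w i < w (i + 1)"
proof -
  assume i: "m < i"
  have "w N \<le> N"
  proof (rule ccontr)
    assume "\<not> w N \<le> N"
    then show False using fixN[of "w N"] w_eq_iff[of "w N" N] by simp
  qed
  moreover have "w i < w (i+1)" if "i < N"
    using Sn_block_mono[OF w p(1) i, of "i+1"] that p by simp
  ultimately show ?thesis using fixN[of i] fixN[of "i+1"] by (cases i N rule: linorder_cases) auto
qed

lemma w_tail: "m < i \<Longrightarrow> i < j \<Longrightarrow> w i < w j"
proof (induction j)
  case (Suc j) then show ?case using w_tail_Suc[of j] by (cases "i = j") auto
qed simp

lemma w_tail_r: "m + 1 < i \<Longrightarrow> r < w i"
  using w_tail[of "m+1" i] by simp

lemma u_low: "i \<le> m \<Longrightarrow> w i < r \<Longrightarrow> u i = w i"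
  and u_mid: "i \<le> m \<Longrightarrow> r < w i \<Longrightarrow> u i = w i - 1"
  and u_tail: "m < i \<Longrightarrow> u i = w (i + 1) - 1"
  by (auto simp: u_def)

lemma w_ne_r: "i \<le> m \<Longrightarrow> w i \<noteq> r"
  using w_eq_iff[of i "m+1"] by simp

text \<open>This form shows what \<open>u\<close> is: position m + 1 and its value \<open>r\<close>
  are deleted from \<open>w\<close>, and the remaining positions and values are closed up.\<close>

lemma u_eq: "u i = (let x = w (if i \<le> m then i else i + 1) in if x < r then x else x - 1)"
  using w_ne_r[of i] w_tail_r[of "i+1"] by (auto simp: u_def Let_def)

lemma u_fix: "N \<le> i \<Longrightarrow> u i = i"
  using p u_tail[of i] fixN[of "i+1"] by simp

lemma inj_u: "inj u"
proof (rule injI)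
  fix i j assume eq: "u i = u j"
  define g where "g i = (if i \<le> m then i else i + 1)" for i
  have ne: "w (g i) \<noteq> r" for i using w_eq_iff[of "g i" "m+1"] by (auto simp: g_def)
  have "u i = (if w (g i) < r then w (g i) else w (g i) - 1)" for i unfolding u_eq Let_def g_def ..
  then have "w (g i) = w (g j)" using eq ne[of i] ne[of j] by (auto split: if_splits)
  then have "g i = g j" by (simp only: w_eq_iff)
  then show "i = j" by (auto simp: g_def split: if_splits)
qed

lemma u_permutes: "u permutes {1..n}"
proof -
  have out: "u i = i" if "i \<notin> {1..n}" for i
    using that u_fix[of i] N_le_n u_low[of 0] w_0 r_pos by (cases "i = 0") auto
  have "u ` {1..n} \<subseteq> {1..n}"
  proof
    fix y assume "y \<in> u ` {1..n}"
    then obtain i where i: "y = u i" "1 \<le> i" "i \<le> n" by auto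
    have "y \<noteq> 0" using i out[of 0] inj_u by (metis injD atLeastAtMost_iff not_one_le_zero)
    moreover have "y \<le> n"
    proof (rule ccontr)
      assume "\<not> y \<le> n"
      then have "u y = u i" using out[of y] i by simp
      then have "y = i" by (rule injD[OF inj_u])
      then show False using i \<open>\<not> y \<le> n\<close> by simp
    qed
    ultimately show "y \<in> {1..n}" by simp
  qed
  moreover have inj: "inj_on u {1..n}" using inj_u by (rule inj_on_subset) simp
  ultimately have "u ` {1..n} = {1..n}" by (intro endo_inj_surj) simp_all
  then have "bij_betw u {1..n} {1..n}" using inj by (simp add: bij_betw_def)
  then show ?thesis using out by (rule bij_imp_permutes)
qed

lemma u_tail_mono: "m < i \<Longrightarrow> i < j \<Longrightarrow> u i < u j"
  using w_tail[of "i+1" "j+1"] w_tail_r[of "i+1"] by (simp add: u_tail)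

sublocale T: sorted_tail n m u
  by unfold_locales (use u_permutes m_less_n u_fix[OF N_le_n] u_tail_mono in auto)

lemma u_mem: "u \<in> Sn"
proof (rule SnI[OF u_permutes])
  fix i assume i: "1 \<le> i" "i < n" "i \<notin> a ` {1..k}"
  have "i \<noteq> m" using i p p_pos by auto
  then consider "i < m" | "m < i" by linarith
  then show "u i < u (i + 1)"
  proof cases
    case 1
    then show ?thesis using Sn_ascent[OF w i] w_ne_r[of i] w_ne_r[of "i+1"] by (auto simp: u_eq Let_def)
  next
    case 2 then show ?thesis by (intro u_tail_mono) auto
  qed
qed

definition B where "B = {i \<in> {1..m}. r < w i}"

lemma B_sub: "B \<subseteq> {1..m}" by (auto simp: B_def)

lemma B_iff: "i \<in> {1..m} \<Longrightarrow> i \<in> B \<longleftrightarrow> r \<le> u i"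
  using w_ne_r[of i] by (auto simp: B_def u_eq Let_def)

text \<open>As every value from \<open>r\<close> on is occupied, moving to the next value adds
  exactly one. This undoes the lowering of values in the definition of \<open>u\<close>, so
  \<open>B\<close> leads back to \<open>w\<close>.\<close>

lemma V_B: "T.V B = {r..n}"
proof (intro set_eqI iffI)
  fix y assume "y \<in> T.V B"
  then obtain i where i: "y = u i" "i \<in> B \<or> (m < i \<and> i \<le> n)" by (auto simp: pieri_values_def)
  then have "r \<le> y" using B_iff[of i] B_sub w_tail_r[of "i+1"] u_tail[of i] by auto
  then show "y \<in> {r..n}" using T.V_le[OF B_sub \<open>y \<in> _\<close>] by simp
next
  fix y assume y: "y \<in> {r..n}"
  then have "y \<in> u ` {1..n}" using permutes_image[OF u_permutes] r_pos by simp
  then obtain i where i: "y = u i" "i \<in> {1..n}" by auto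
  then show "y \<in> T.V B" using B_iff[of i] y T.in_V[of i B] by (cases "i \<le> m") auto
qed

lemma nxt_B: "r - 1 \<le> x \<Longrightarrow> x < n \<Longrightarrow> T.nxt B x = x + 1"
proof -
  assume "r - 1 \<le> x" "x < n"
  then have "x + 1 \<in> T.V B" unfolding V_B by simp
  then show ?thesis by (rule T.nxt_eqI[OF B_sub]) simp_all
qed

lemma pv_B: "T.pv B = w"
proof
  fix i
  consider "i \<in> B" | "i \<notin> B" "i \<le> m" | "i = m + 1" | "m + 1 < i" "i \<le> n" | "n < i" by linarith
  then show "T.pv B i = w i"
  proof cases
    case 1
    then have i: "i \<le> m" "1 \<le> i" "r < w i" by (auto simp: B_def)
    then have "u i = w i - 1" "u i < n" using T.u_less[of i] m_less_n by (auto simp: u_mid)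
    then show ?thesis using nxt_B[of "u i"] i 1 by (simp add: T.pv_in)
  next
    case 2
    have "w i < r"
    proof (cases "i = 0")
      case False then show ?thesis using 2 w_ne_r[of i] by (auto simp: B_def)
    qed (use w_0 r_pos in simp)
    then show ?thesis using 2 by (simp add: T.pv_out u_low)
  next
    case 3
    have "T.nxt B 0 = r"
      using r_pos r_le m_less_n by (intro T.nxt_eqI[OF B_sub]) (auto simp: V_B)
    then show ?thesis using 3 m_less_n B_sub by (simp add: T.pv_tail tail_pred_def)
  next
    case 4
    then have "u (i - 1) = w i - 1" "u (i - 1) < n" "r < w i"
      using u_tail[of "i - 1"] T.u_less[of "i - 1"] w_tail_r[of i] by auto
    then show ?thesis using 4 B_sub nxt_B[of "u (i - 1)"] by (simp add: T.pv_tail tail_pred_def)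
  next
    case 5
    then show ?thesis
      using permutes_apply_out[OF w_perm] permutes_apply_out[OF T.pv_permutes[OF B_sub]] by simp
  qed
qed

text \<open>No value below \<open>z\<close> is occupied, so all of them stand at unmoved positions
  up to \<open>m\<close>.\<close>

lemma card_low_values:
  assumes "B' \<subseteq> {1..m}" "\<And>y. y \<in> T.V B' \<Longrightarrow> z \<le> y" "1 \<le> z" "z \<le> n"
  shows "card {i \<in> {1..m} - B'. u i < z} = z - 1"
proof -
  have "u ` {i \<in> {1..m} - B'. u i < z} = {1..<z}"
  proof (intro set_eqI iffI)
    fix y assume y: "y \<in> {1..<z}"
    then have "y \<in> u ` {1..n}" using permutes_image[OF u_permutes] assms by simp
    then obtain i where i: "y = u i" "i \<in> {1..n}" by auto
    have "y \<notin> T.V B'" using assms(2)[of y] y by auto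
    then have "i \<notin> B'" "i \<le> m" using i T.in_V[of i B'] by (auto simp: not_less[symmetric])
    then show "y \<in> u ` {i \<in> {1..m} - B'. u i < z}" using i y by auto
  next
    fix y assume "y \<in> u ` {i \<in> {1..m} - B'. u i < z}"
    then show "y \<in> {1..<z}" using T.u_pos m_less_n by (force simp: Suc_le_eq)
  qed
  then show ?thesis
    using card_image[of u "{i \<in> {1..m} - B'. u i < z}"] inj_u by (simp add: inj_on_def inj_def)
qed

lemma r_le_n: "r \<le> n" using r_le m_less_n by simp

lemma card_B: "card B = m - r + 1"
proof -
  have "{i \<in> {1..m} - B. u i < r} = {1..m} - B" using B_iff by (auto simp: not_le[symmetric])
  then have "card ({1..m} - B) = r - 1"
    using card_low_values[OF B_sub, of r] r_pos r_le_n by (simp add: V_B)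
  then have "m - card B = r - 1" using B_sub by (simp add: card_Diff_subset finite_subset)
  moreover have "card B \<le> m" using card_mono[OF _ B_sub] by simp
  ultimately show ?thesis using r_pos r_le by linarith
qed

lemma adm_B: "T.adm B"
  unfolding pieri_admissible_def
proof (intro ballI)
  fix b j assume bj: "b \<in> B" "j \<in> {b<..m} - B"
  then have "b \<in> {1..m}" "j \<in> {1..m}" using B_sub by auto
  then have "r \<le> u b" "u j < r" using bj B_iff[of b] B_iff[of j] by simp_all
  then show "\<not> (u b < u j \<and> u j < T.pv B b)" by simp
qed

text \<open>The value z at m + 1 is the least occupied one, so z - 1 unmoved positions have values
  below it, while there are only r - 1 unmoved positions. If z = r, the unmoved positions are
  exactly those with values below \<open>r\<close>, which forces B' = B. This strict decrease drives
  the recursion over the other endpoints.\<close>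

lemma pv_first_less:
  assumes B': "B' \<subseteq> {1..m}" "card B' = m - r + 1" and ne: "T.pv B' \<noteq> w"
  shows "T.pv B' (m + 1) < r"
proof -
  define z where "z = T.pv B' (m + 1)"
  have z: "z = T.nxt B' 0" using m_less_n B' by (simp add: T.pv_tail tail_pred_def z_def)
  have n0: "0 < n" using m_less_n by simp
  have zV: "z \<in> T.V B'" "1 \<le> z" using T.nxt(1,2)[OF B'(1) n0] z by auto
  have min: "z \<le> y" if y: "y \<in> T.V B'" for y
  proof -
    obtain i where "y = u i" "i \<in> B' \<or> (m < i \<and> i \<le> n)" using y by (auto simp: pieri_values_def)
    then have "0 < y" using T.u_pos[of i] B'(1) m_less_n by auto
    then show ?thesis using T.nxt(3)[OF B'(1) n0 y] z by simp
  qed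
  let ?J = "{i \<in> {1..m} - B'. u i < z}"
  have J: "card ?J = z - 1" by (rule card_low_values[OF B'(1) min zV(2) T.V_le[OF B'(1) zV(1)]])
  have C: "card ({1..m} - B') = r - 1"
    using B' r_le r_pos by (simp add: card_Diff_subset finite_subset)
  have "card ?J \<le> card ({1..m} - B')" by (intro card_mono) auto
  then have "z \<le> r" using J C zV(2) r_pos by linarith
  moreover have "z \<noteq> r"
  proof
    assume "z = r"
    then have J_eq: "?J = {1..m} - B'" using J C by (intro card_subset_eq) auto
    have "i \<in> B' \<longleftrightarrow> r \<le> u i" if "i \<in> {1..m}" for i
    proof (cases "i \<in> B'")
      case True
      then show ?thesis using min[OF T.in_V(1)[OF True]] \<open>z = r\<close> by simp
    next
      case False
      then have "i \<in> ?J" unfolding J_eq using that by blast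
      then show ?thesis using False \<open>z = r\<close> by simp
    qed
    then have "B' = B" using B_iff B'(1) B_sub by blast
    then show False using ne pv_B by simp
  qed
  ultimately show ?thesis by (simp add: z_def)
qed

lemma pv_mem:
  assumes "B' \<subseteq> {1..m}" "T.adm B'"
  shows "T.pv B' \<in> Sn"
proof (rule SnI[OF T.pv_permutes[OF assms(1)]])
  fix i assume i: "1 \<le> i" "i < n" "i \<notin> a ` {1..k}"
  have "i \<noteq> m" using i p p_pos by auto
  then consider "i < m" | "m < i" by linarith
  then show "T.pv B' i < T.pv B' (i + 1)"
  proof cases
    case 1 then show ?thesis using T.pv_ascent[OF assms i(1)] Sn_ascent[OF u_mem i] by simp
  next
    case 2 then show ?thesis using T.pv_tail_mono[OF assms(1)] i by simp
  qed
qed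

lemma pv_fix:
  assumes "B' \<subseteq> {1..m}" "N < i"
  shows "T.pv B' i = i"
proof (cases "i \<le> n")
  case True
  have i: "m + 1 < i" "N \<le> i - 1" using assms p by auto
  have "T.nxt B' (i - 1) = i"
    using T.in_V(2)[of i B'] u_fix[of i] assms i True by (intro T.nxt_eqI[OF assms(1)]) auto
  then show ?thesis using i True assms(1) u_fix[OF i(2)] by (simp add: T.pv_tail tail_pred_def)
next
  case False then show ?thesis using permutes_apply_out[OF T.pv_permutes[OF assms(1)]] by simp
qed

abbreviation "covers \<equiv> {v. pieri_step n (cycle_perm r m) u v}"

lemma covers_eq: "covers = T.pv ` {B. B \<subseteq> {1..m} \<and> card B = m - r + 1 \<and> T.adm B}"
  by (rule T.pieri_step_iff[OF r_pos r_le])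

lemma finite_covers: "finite covers"
  unfolding covers_eq by (rule finite_imageI, rule finite_subset[of _ "Pow {1..m}"]) auto

lemma w_in_covers: "w \<in> covers"
proof -
  have "B \<in> {B. B \<subseteq> {1..m} \<and> card B = m - r + 1 \<and> T.adm B}"
    using B_sub card_B adm_B by blast
  then have "T.pv B \<in> covers" unfolding covers_eq by (rule imageI)
  then show ?thesis by (simp only: pv_B)
qed

lemma covers_mem: "v \<in> covers \<Longrightarrow> v \<in> Sn"
  unfolding covers_eq using pv_mem by blast

lemma covers_fix: "v \<in> covers \<Longrightarrow> N < i \<Longrightarrow> v i = i"
  unfolding covers_eq using pv_fix by blast

lemma covers_less: "v \<in> covers \<Longrightarrow> v \<noteq> w \<Longrightarrow> v (m + 1) < r"
  unfolding covers_eq using pv_first_less by blast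

lemma pieri_covers: "elem_sym m (m + 1 - r) * schubert n u = (\<Sum>v\<in>covers. schubert n v)"
proof -
  let ?S = "{B. B \<subseteq> {1..m} \<and> card B = m - r + 1 \<and> T.adm B}"
  have "inj_on T.pv ?S" by (rule inj_onI) (metis (mono_tags, lifting) T.pv_inj mem_Collect_eq)
  then have "(\<Sum>v\<in>covers. schubert n v) = (\<Sum>B\<in>?S. schubert n (T.pv B))"
    unfolding covers_eq by (simp only: sum.reindex o_def)
  also have "\<dots> = elem_sym m (m - r + 1) * schubert n u"
    using schubert_pieri[OF T.sorted_tail_axioms] by simp
  finally show ?thesis using r_le by (simp add: Suc_diff_le)
qed

lemma schubert_transition:
  "schubert n w = elem_sym m (m + 1 - r) * schubert n u - (\<Sum>v\<in>covers - {w}. schubert n v)"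
  unfolding pieri_covers sum.remove[OF finite_covers w_in_covers] by simp

end

lemma (in flag) cycle_perm_mem:
  assumes "1 \<le> p" "p \<le> k" "1 \<le> r" "r \<le> a p"
  shows "cycle_perm r (a p) \<in> Sn"
proof (rule SnI)
  have "a p < n" using a_less_n assms by simp
  then show "cycle_perm r (a p) permutes {1..n}"
    unfolding cycle_perm_def using assms by (intro simple_word_permutes) auto
  fix i assume "i \<notin> a ` {1..k}"
  then have "i \<noteq> a p" using assms by auto
  then show "cycle_perm r (a p) i < cycle_perm r (a p) (i + 1)"
    using assms by (auto simp: cycle_perm_apply)
qed

section \<open>Quantization\<close>

lemma exists_permutes_with_code:
  assumes "\<And>t. 1 \<le> t \<Longrightarrow> t \<le> n \<Longrightarrow> d t < t"
  shows "\<exists>w. w permutes {1..n} \<and> (\<forall>t\<in>{1..n}. card {i \<in> {1..<t}. w t < w i} = d t)"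
  using assms
proof (induction n)
  case 0 show ?case by (intro exI[of _ id]) (auto simp: permutes_id)
next
  case (Suc n)
  then obtain w' where w': "w' permutes {1..n}" "\<And>t. t \<in> {1..n} \<Longrightarrow> card {i \<in> {1..<t}. w' t < w' i} = d t"
    by auto
  have dn: "d (Suc n) < Suc n" using Suc.prems by simp
  define x where "x = Suc n - d (Suc n)"
  have x: "1 \<le> x" "x \<le> Suc n" using dn by (auto simp: x_def)
  \<comment> \<open>\<open>g\<close> makes room for the value \<open>x\<close> at the last position:
    it raises the values from \<open>x\<close> to n by one, preserves the order of the old values,
    and sends n + 1 to \<open>x\<close>.\<close>
  define g where "g = (if x = Suc n then id else cycle_perm x n)"
  have g: "g y = (if y < x then y else y + 1)" if "y \<le> n" for y
    using that x by (auto simp: g_def cycle_perm_apply)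
  have g_less: "g y < g z \<longleftrightarrow> y < z" if "y \<le> n" "z \<le> n" for y z
    using g[OF that(1)] g[OF that(2)] by auto
  have g_ge: "x < g y \<longleftrightarrow> x \<le> y" if "y \<le> n" for y
    using g[OF that] by auto
  have gn: "g (Suc n) = x" using x by (auto simp: g_def cycle_perm_apply)
  have gp: "g permutes {1..Suc n}"
  proof (cases "x = Suc n")
    case True then show ?thesis by (simp add: g_def permutes_id)
  next
    case False
    show ?thesis unfolding g_def cycle_perm_def if_not_P[OF False]
      by (rule simple_word_permutes) (use x in auto)
  qed
  let ?w = "g \<circ> w'"
  have "w' permutes {1..Suc n}" using w'(1) by (rule permutes_subset) auto
  then have wp: "?w permutes {1..Suc n}" using gp by (rule permutes_compose)
  have w'n: "w' (Suc n) = Suc n" using permutes_apply_out[OF w'(1)] by simp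
  have le: "w' i \<le> n" if "i \<in> {1..n}" for i using permutes_apply_in[OF w'(1), of i] that by simp
  have "card {i \<in> {1..<t}. ?w t < ?w i} = d t" if t: "t \<in> {1..Suc n}" for t
  proof (cases "t = Suc n")
    case False
    then have "?w t < ?w i \<longleftrightarrow> w' t < w' i" if "i \<in> {1..<t}" for i
      using t that le[of t] le[of i] g_less[of "w' t" "w' i"] by simp
    then have "{i \<in> {1..<t}. ?w t < ?w i} = {i \<in> {1..<t}. w' t < w' i}" by blast
    then show ?thesis using w'(2)[of t] t False by simp
  next
    case True
    have "?w t < ?w i \<longleftrightarrow> x \<le> w' i" if "i \<in> {1..n}" for i
      using g_ge[OF le[OF that]] True by (simp add: w'n gn)
    moreover have "{1..<t} = {1..n}" using True by auto
    ultimately have "{i \<in> {1..<t}. ?w t < ?w i} = {i \<in> {1..n}. x \<le> w' i}" by blast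
    then have "card {i \<in> {1..<t}. ?w t < ?w i} = card {i \<in> {1..n}. x \<le> w' i}" by (rule arg_cong)
    also have "\<dots> = card (w' ` {i \<in> {1..n}. x \<le> w' i})"
      by (rule card_image[OF inj_on_subset[OF permutes_inj[OF w'(1)] subset_UNIV], symmetric])
    also have "w' ` {i \<in> {1..n}. x \<le> w' i} = {x..n}"
    proof (intro set_eqI iffI)
      fix y assume y: "y \<in> {x..n}"
      then have "y \<in> w' ` {1..n}" using permutes_image[OF w'(1)] x by simp
      then show "y \<in> w' ` {i \<in> {1..n}. x \<le> w' i}" using y by auto
    qed (use le in auto)
    finally show ?thesis using True dn by (simp add: x_def)
  qed
  then show ?case using wp by blast
qed

text \<open>Elimination without division: the pivot \<open>M x0 b\<close> clears column
  \<open>b\<close> in the other rows, and scaling their coefficients by the pivot keeps the solution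
  integral and nonzero.\<close>

lemma exists_int_kernel:
  fixes M :: "'a \<Rightarrow> 'b \<Rightarrow> int"
  assumes "finite B" "finite A" "card B < card A"
  shows "\<exists>c. (\<exists>x\<in>A. c x \<noteq> 0) \<and> (\<forall>y\<in>B. (\<Sum>x\<in>A. c x * M x y) = 0)"
  using assms
proof (induction B arbitrary: A M rule: finite_induct)
  case empty
  then have "A \<noteq> {}" by auto
  then show ?case by (intro exI[of _ "\<lambda>_. 1"]) auto
next
  case (insert b B)
  show ?case
  proof (cases "\<forall>x\<in>A. M x b = 0")
    case True
    then show ?thesis using insert.IH[of A M] insert.prems insert.hyps by auto
  next
    case False
    then obtain x0 where x0: "x0 \<in> A" "M x0 b \<noteq> 0" by auto
    let ?A = "A - {x0}"
    define M' where "M' x y = M x0 b * M x y - M x b * M x0 y" for x y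
    have "card B < card ?A" using insert x0 by simp
    then obtain c' where c': "\<exists>x\<in>?A. c' x \<noteq> 0" "\<And>y. y \<in> B \<Longrightarrow> (\<Sum>x\<in>?A. c' x * M' x y) = 0"
      using insert.IH[of ?A M'] insert.prems(1) by blast
    define c where "c x = (if x = x0 then - (\<Sum>x\<in>?A. c' x * M x b) else M x0 b * c' x)" for x
    have sum: "(\<Sum>x\<in>A. c x * M x y) = (\<Sum>x\<in>?A. c' x * M' x y)" for y
    proof -
      have "(\<Sum>x\<in>A. c x * M x y) = c x0 * M x0 y + (\<Sum>x\<in>?A. c x * M x y)"
        using insert.prems(1) x0(1) by (rule sum.remove)
      also have "(\<Sum>x\<in>?A. c x * M x y) = (\<Sum>x\<in>?A. c' x * (M x0 b * M x y))"
        by (rule sum.cong) (auto simp: c_def)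
      also have "c x0 * M x0 y = - (\<Sum>x\<in>?A. c' x * (M x b * M x0 y))"
        by (simp add: c_def sum_distrib_right mult.assoc)
      finally show ?thesis by (simp add: M'_def right_diff_distrib sum_subtractf)
    qed
    have "(\<Sum>x\<in>A. c x * M x y) = 0" if "y \<in> insert b B" for y
      unfolding sum using that c'(2) by (auto simp: M'_def)
    moreover have "\<exists>x\<in>A. c x \<noteq> 0" using c'(1) x0 by (auto simp: c_def)
    ultimately show ?thesis by blast
  qed
qed

lemma qE_neg: "i < 0 \<Longrightarrow> qE a j i = 0"
  by (induction a j i rule: qE.induct) auto

text \<open>Sorted insertion of \<open>l\<close> into a block of fixed length that ends before
  \<open>b\<close>: entries up to \<open>l\<close> move one place to the left, and \<open>l\<close>
  takes the place of the last of them. The entry that drops out at the start of the block is a 0 in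
  the application.\<close>

definition insert_index :: "nat \<Rightarrow> nat \<Rightarrow> (nat \<Rightarrow> nat) \<Rightarrow> nat \<Rightarrow> nat" where
  "insert_index b l I r = (if r + 1 < b \<and> I (r + 1) \<le> l then I (r + 1) else max l (I r))"

lemma prod_insert_index:
  fixes F :: "nat \<Rightarrow> 'c :: comm_monoid_mult"
  assumes "c < b" "mono_on {c..<b} I" "I c = 0"
  shows "(\<Prod>r=c..<b. F (insert_index b l I r)) = F l * (\<Prod>r=c+1..<b. F (I r))"
  using assms
proof (induction b)
  case (Suc b)
  show ?case
  proof (cases "c = b")
    case True then show ?thesis using Suc.prems by (simp add: insert_index_def)
  next
    case False
    then have cb: "c < b" using Suc.prems by simp
    have mono: "mono_on {c..<b} I" using Suc.prems(2) by (rule mono_on_subset) auto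
    note IH = Suc.IH[OF cb mono Suc.prems(3)]
    obtain e where e: "b = Suc e" using cb by (cases b) auto
    have Ie: "I e \<le> I b" using Suc.prems(2) cb e by (auto simp: mono_on_def)
    have pre: "(\<Prod>r=c..<e. F (insert_index (Suc b) l I r)) = (\<Prod>r=c..<e. F (insert_index b l I r))"
      by (intro prod.cong refl arg_cong[of _ _ F]) (auto simp: insert_index_def e)
    have split: "(\<Prod>r=c..<b. G r) = (\<Prod>r=c..<e. G r) * G e" for G :: "nat \<Rightarrow> 'c"
      using cb e by simp
    have "(\<Prod>r=c..<Suc b. F (insert_index (Suc b) l I r)) =
        (\<Prod>r=c..<e. F (insert_index b l I r)) * F (insert_index (Suc b) l I e) * F (insert_index (Suc b) l I b)"
      using cb by (simp add: split pre)
    also have "\<dots> = (\<Prod>r=c..<b. F (insert_index b l I r)) * F (I b)"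
    \<comment> \<open>If the last entry is at most \<open>l\<close>, it moves to the left and
      \<open>l\<close> becomes last; otherwise it stays and the insertion happens in the shorter
      block.\<close>
    proof (cases "I b \<le> l")
      case True
      then have "insert_index (Suc b) l I e = I b" "insert_index (Suc b) l I b = l" "insert_index b l I e = l"
        using Ie by (auto simp: insert_index_def e)
      then show ?thesis by (simp add: split ac_simps)
    next
      case False
      then have "insert_index (Suc b) l I e = insert_index b l I e" "insert_index (Suc b) l I b = I b"
        by (auto simp: insert_index_def e)
      then show ?thesis by (simp add: split)
    qed
    finally show ?thesis unfolding IH using cb by (simp add: ac_simps)
  qed
qed simp

context flag
begin

abbreviation "std \<equiv> std_indices k a"
abbreviation "block q \<equiv> {a q..<a (q + 1)}"

lemma exists_block_index:
  assumes "r \<in> {a 1..<a (k + 1)}"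
  shows "\<exists>q\<in>{1..k}. r \<in> block q"
proof -
  obtain q where q: "q \<le> k" "a q < r + 1" "r + 1 \<le> a (q + 1)"
    using exists_block[of "r + 1"] assms a_last by auto
  have "q \<noteq> 0" using q assms by (intro notI) simp
  then show ?thesis using q by (intro bexI[of _ q]) auto
qed

lemma block_index_unique:
  assumes "q \<le> k" "q' \<le> k" "r \<in> block q" "r \<in> block q'"
  shows "q = q'"
  using block_unique[of q "r + 1" q'] assms by simp

lemma block_subset: "1 \<le> q \<Longrightarrow> q \<le> k \<Longrightarrow> block q \<subseteq> {a 1..<a (k + 1)}"
  using a_le[of 1 q] a_le[of "q+1" "k+1"] by auto

lemma std_le: "I \<in> std \<Longrightarrow> q \<in> {1..k} \<Longrightarrow> r \<in> block q \<Longrightarrow> I r \<le> a q"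
  by (simp add: std_indices_def)

lemma std_mono: "I \<in> std \<Longrightarrow> q \<in> {1..k} \<Longrightarrow> mono_on (block q) I"
  by (simp add: std_indices_def)

lemma std_out: "I \<in> std \<Longrightarrow> r \<notin> {a 1..<a (k + 1)} \<Longrightarrow> I r = 0"
  unfolding std_indices_def by blast

lemma finite_std: "finite std"
proof (rule finite_subset)
  show "std \<subseteq> {f. \<forall>x. (x \<in> {a 1..<a (k+1)} \<longrightarrow> f x \<in> {..n}) \<and> (x \<notin> {a 1..<a (k+1)} \<longrightarrow> f x = 0)}"
  proof (intro subsetI CollectI allI conjI impI)
    fix I x assume I: "I \<in> std"
    show "I x = 0" if "x \<notin> {a 1..<a (k+1)}" using I that by (rule std_out)
    assume "x \<in> {a 1..<a (k+1)}"
    then obtain q where "q \<in> {1..k}" "x \<in> block q" using exists_block_index by blast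
    then have "I x \<le> a q" "a q \<le> n" using std_le[OF I] a_le_n[of q] by auto
    then show "I x \<in> {..n}" by simp
  qed
qed (intro finite_set_of_finite_funs, auto)

text \<open>The index sequences that occur in the expansion of a permutation fixing all points above
  \<open>N\<close>: only the last \<open>N - a q\<close> entries of block \<open>q\<close> may be nonzero.\<close>

definition slack :: "nat \<Rightarrow> (nat \<Rightarrow> nat) set" where
  "slack N = {I \<in> std. \<forall>q\<in>{1..k}. \<forall>r\<in>block q. I r \<noteq> 0 \<longrightarrow> a q + a (q + 1) \<le> r + N}"

lemma finite_slack: "finite (slack N)"
  using finite_std by (simp add: slack_def)

lemma slack_mono: "N \<le> N' \<Longrightarrow> slack N \<subseteq> slack N'"
  by (force simp: slack_def)

lemma slack_n: "slack n = std"
  unfolding slack_def using a_le_n by (force intro: add_mono)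

definition shift_in :: "nat \<Rightarrow> nat \<Rightarrow> (nat \<Rightarrow> nat) \<Rightarrow> nat \<Rightarrow> nat" where
  "shift_in p l I r = (if r \<in> block p then insert_index (a (p + 1)) l I r else I r)"

text \<open>Insertion moves entries of block \<open>p\<close> by at most one place to the left, and
  raising the bound from \<open>N - 1\<close> to \<open>N\<close> permits exactly one more nonzero
  place at the left. The inserted \<open>l\<close> itself stands at the end of the block or just
  before a nonzero entry.\<close>

lemma shift_in_slack:
  assumes I: "I \<in> slack (N - 1)" and p: "1 \<le> p" "p \<le> k" "a p < N" "N \<le> a (p + 1)" and l: "l \<le> a p"
  shows "shift_in p l I \<in> slack N"
proof -
  let ?J = "shift_in p l I"
  have Istd: "I \<in> std" and Islack: "\<And>q r. q \<in> {1..k} \<Longrightarrow> r \<in> block q \<Longrightarrow> I r \<noteq> 0 \<Longrightarrow> a q + a (q + 1) \<le> r + (N - 1)"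
    using I by (auto simp: slack_def)
  have pk: "p \<in> {1..k}" using p by simp
  have other: "?J r = I r" if "q \<in> {1..k}" "r \<in> block q" "q \<noteq> p" for q r
    using block_index_unique[of q p r] that p by (auto simp: shift_in_def)
  have "?J \<in> std"
    unfolding std_indices_def
  proof (intro CollectI conjI allI ballI impI)
    fix r assume r: "r \<notin> {a 1..<a (k + 1)}"
    then have "r \<notin> block p" using block_subset[OF p(1,2)] by blast
    then show "?J r = 0" using std_out[OF Istd r] unfolding shift_in_def by (simp only: if_False)
  next
    fix q r assume qr: "q \<in> {1..k}" "r \<in> block q"
    show "?J r \<le> a q"
    proof (cases "q = p")
      case True
      then show ?thesis using std_le[OF Istd pk] qr l by (auto simp: shift_in_def insert_index_def)
    next
      case False then show ?thesis using other[OF qr] std_le[OF Istd qr] by simp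
    qed
  next
    fix q assume q: "q \<in> {1..k}"
    show "mono_on (block q) ?J"
    proof (cases "q = p")
      case False
      then show ?thesis using other[OF q] std_mono[OF Istd q] unfolding mono_on_def by metis
    next
      case True
      have mono: "I r \<le> I r'" if "a p \<le> r" "r \<le> r'" "r' < a (p+1)" for r r'
        using std_mono[OF Istd pk] that by (auto simp: mono_on_def)
      show ?thesis
      proof (rule mono_onI)
        fix r r' assume r: "r \<in> block q" "r' \<in> block q" "r \<le> r'"
        show "?J r \<le> ?J r'"
        proof (cases "r = r'")
          case False
          then have r': "r + 1 \<le> r'" "a p \<le> r" "r' < a (p+1)" using r True by auto
          have "?J r \<le> I (r + 1)"
            using r' mono[of r "r+1"] by (auto simp: shift_in_def insert_index_def)
          also have "\<dots> \<le> I r'" using r' by (intro mono) auto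
          also have "\<dots> \<le> ?J r'" using r' mono[of r' "r'+1"] by (auto simp: shift_in_def insert_index_def)
          finally show ?thesis .
        qed simp
      qed
    qed
  qed
  moreover have "a q + a (q + 1) \<le> r + N" if qr: "q \<in> {1..k}" "r \<in> block q" "?J r \<noteq> 0" for q r
  proof (cases "q = p")
    case False
    then show ?thesis using Islack[OF qr(1,2)] other[OF qr(1,2)] qr(3) by simp
  next
    case True
    show ?thesis
    proof (rule ccontr)
      assume less: "\<not> ?thesis"
      then have r: "r + 1 < a (p + 1)" using True p by simp
      then have "r + 1 \<in> block p" using qr True by auto
      then have "I (r + 1) = 0" using Islack[OF pk, of "r+1"] less True p by (intro ccontr[of "_ = _"]) simp
      then have "?J r = 0" using r qr True by (simp add: shift_in_def insert_index_def)
      then show False using qr by simp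
    qed
  qed
  ultimately show ?thesis by (simp add: slack_def)
qed

text \<open>The family \<open>G\<close> is kept general so that the same computation serves for
  \<open>elem_sym\<close> and for \<open>qE\<close>.\<close>

lemma prod_shift_in:
  fixes G :: "nat \<Rightarrow> nat \<Rightarrow> 'c :: comm_ring_1"
  assumes I: "I \<in> slack (N - 1)" and p: "1 \<le> p" "p \<le> k" "a p < N" "N \<le> a (p + 1)" and G: "G p 0 = 1"
  shows "(\<Prod>q=1..k. \<Prod>r=a q..<a (q+1). G q (shift_in p l I r)) =
    G p l * (\<Prod>q=1..k. \<Prod>r=a q..<a (q+1). G q (I r))"
proof -
  have pk: "p \<in> {1..k}" and fin: "finite {1..k}" using p by auto
  have Istd: "I \<in> std" using I by (simp add: slack_def)
  \<comment> \<open>A nonzero index at the start of the block would require a (p+1) \<le> N - 1,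
    contrary to N \<le> a (p+1).\<close>
  have "\<not> a p + a (p + 1) \<le> a p + (N - 1)" using p by simp
  moreover have "a p \<in> block p" using a_less[of p "p+1"] p by simp
  ultimately have I0: "I (a p) = 0" using I pk unfolding slack_def by blast
  have "(\<Prod>r=a p..<a (p+1). G p (I r)) = (\<Prod>r=a p+1..<a (p+1). G p (I r))"
    using a_less[of p "p+1"] p I0 G by (simp add: prod.atLeast_Suc_lessThan)
  then have "(\<Prod>r=a p..<a (p+1). G p (insert_index (a (p+1)) l I r)) = G p l * (\<Prod>r=a p..<a (p+1). G p (I r))"
    using prod_insert_index[OF _ std_mono[OF Istd pk] I0, of "G p" l] a_less[of p "p+1"] p by simp
  moreover have "(\<Prod>r=a p..<a (p+1). G p (shift_in p l I r)) = (\<Prod>r=a p..<a (p+1). G p (insert_index (a (p+1)) l I r))"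
    by (rule prod.cong) (auto simp: shift_in_def)
  moreover have "(\<Prod>q\<in>{1..k} - {p}. \<Prod>r=a q..<a (q+1). G q (shift_in p l I r)) =
      (\<Prod>q\<in>{1..k} - {p}. \<Prod>r=a q..<a (q+1). G q (I r))"
  proof (intro prod.cong refl)
    fix q r assume "q \<in> {1..k} - {p}" "r \<in> block q"
    then have "r \<notin> block p" using block_index_unique[of q p r] p by auto
    then show "G q (shift_in p l I r) = G q (I r)" unfolding shift_in_def by (simp only: if_False)
  qed
  ultimately show ?thesis unfolding prod.remove[OF fin pk] by (simp add: mult.assoc)
qed

text \<open>In degree 0 the terms with the variables y have negative index, and so does the quantum
  correction, because \<open>a\<close> increases strictly.\<close>

lemma qE_0: "j \<le> k + 1 \<Longrightarrow> qE a j 0 = 1"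
proof (induction j rule: less_induct)
  case (less j)
  consider "j = 0" | "j = Suc 0" | i where "j = Suc (Suc i)" by (metis not0_implies_Suc)
  then show ?case
  proof cases
    case 3
    have "a i < a (i + 2)" using a_less[of i "i+2"] less.prems 3 by simp
    then have "qE a i (0 - int (a (i + 2)) + int (a i)) = 0" by (intro qE_neg) simp
    moreover have "qE a (Suc i) 0 = 1" using less 3 by simp
    ultimately show ?thesis using 3 by (simp add: qE_neg)
  qed simp_all
qed

text \<open>Quantization sends \<open>elem_prod\<close> to \<open>qE_prod\<close>. As long as the products are not known to be
  independent, it is only a relation.\<close>

definition quantizes :: "nat \<Rightarrow> nat mpol \<Rightarrow> qvar mpol \<Rightarrow> bool" where
  "quantizes N f g \<longleftrightarrow>
     (\<exists>c :: (nat \<Rightarrow> nat) \<Rightarrow> int. f = (\<Sum>I\<in>slack N. of_int (c I) * elem_prod k a I) \<and>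
       g = (\<Sum>I\<in>slack N. of_int (c I) * qE_prod k a I))"

lemma quantizes_base: "I \<in> slack N \<Longrightarrow> quantizes N (elem_prod k a I) (qE_prod k a I)"
  unfolding quantizes_def using finite_slack[of N]
  by (intro exI[of _ "\<lambda>J. if J = I then 1 else 0"])
     (simp add: if_distrib[of of_int] if_distrib[of "\<lambda>x. x * _"] cong: if_cong)

lemma quantizes_add:
  assumes "quantizes N f g" "quantizes N f' g'"
  shows "quantizes N (f + f') (g + g')"
proof -
  obtain c c' where "f = (\<Sum>I\<in>slack N. of_int (c I) * elem_prod k a I)" "g = (\<Sum>I\<in>slack N. of_int (c I) * qE_prod k a I)"
    "f' = (\<Sum>I\<in>slack N. of_int (c' I) * elem_prod k a I)" "g' = (\<Sum>I\<in>slack N. of_int (c' I) * qE_prod k a I)"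
    using assms unfolding quantizes_def by blast
  then show ?thesis unfolding quantizes_def
    by (intro exI[of _ "\<lambda>I. c I + c' I"]) (simp add: distrib_right sum.distrib)
qed

lemma quantizes_scale:
  assumes "quantizes N f g"
  shows "quantizes N (of_int z * f) (of_int z * g)"
proof -
  obtain c where "f = (\<Sum>I\<in>slack N. of_int (c I) * elem_prod k a I)" "g = (\<Sum>I\<in>slack N. of_int (c I) * qE_prod k a I)"
    using assms unfolding quantizes_def by blast
  then show ?thesis unfolding quantizes_def
    by (intro exI[of _ "\<lambda>I. z * c I"]) (simp add: sum_distrib_left mult.assoc)
qed

lemma quantizes_0: "quantizes N 0 0"
  unfolding quantizes_def by (intro exI[of _ "\<lambda>_. 0"]) simp

lemma quantizes_sum: "(\<And>x. x \<in> A \<Longrightarrow> quantizes N (f x) (g x)) \<Longrightarrow> quantizes N (sum f A) (sum g A)"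
  by (induction A rule: infinite_finite_induct) (auto intro: quantizes_add quantizes_0)

lemma quantizes_diff: "quantizes N f g \<Longrightarrow> quantizes N f' g' \<Longrightarrow> quantizes N (f - f') (g - g')"
  using quantizes_add[OF _ quantizes_scale[of N f' g' "-1"], of f g] by simp

lemma quantizes_mono:
  assumes "quantizes N f g" "N \<le> N'"
  shows "quantizes N' f g"
proof -
  obtain c where c: "f = (\<Sum>I\<in>slack N. of_int (c I) * elem_prod k a I)" "g = (\<Sum>I\<in>slack N. of_int (c I) * qE_prod k a I)"
    using assms unfolding quantizes_def by blast
  show ?thesis unfolding c using slack_mono[OF assms(2)]
    by (intro quantizes_sum quantizes_scale quantizes_base) auto
qed

text \<open>On both sides the new factor changes each product by the same reindexing
  \<open>shift_in\<close>, so one family of coefficients still serves for both.\<close>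

lemma quantizes_mult:
  assumes "quantizes (N - 1) f g" and p: "1 \<le> p" "p \<le> k" "a p < N" "N \<le> a (p + 1)" and l: "l \<le> a p"
  shows "quantizes N (elem_sym (a p) l * f) (g * qE a p (int l))"
proof -
  obtain c where c: "f = (\<Sum>I\<in>slack (N - 1). of_int (c I) * elem_prod k a I)"
      "g = (\<Sum>I\<in>slack (N - 1). of_int (c I) * qE_prod k a I)"
    using assms(1) unfolding quantizes_def by blast
  have "elem_prod k a (shift_in p l I) = elem_sym (a p) l * elem_prod k a I" if "I \<in> slack (N - 1)" for I
    unfolding elem_prod_def
    by (rule prod_shift_in[OF that p, where G = "\<lambda>q. elem_sym (a q)"]) simp
  then have e: "elem_sym (a p) l * f = (\<Sum>I\<in>slack (N - 1). of_int (c I) * elem_prod k a (shift_in p l I))"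
    unfolding c by (simp add: sum_distrib_left mult.left_commute)
  have "qE_prod k a (shift_in p l I) = qE a p (int l) * qE_prod k a I" if "I \<in> slack (N - 1)" for I
    unfolding qE_prod_def
    by (rule prod_shift_in[OF that p, where G = "\<lambda>q i. qE a q (int i)"]) (use p in \<open>simp add: qE_0\<close>)
  then have q: "g * qE a p (int l) = (\<Sum>I\<in>slack (N - 1). of_int (c I) * qE_prod k a (shift_in p l I))"
    unfolding c sum_distrib_right by (intro sum.cong refl) (simp add: mult_ac)
  show ?thesis unfolding e q using p l
    by (intro quantizes_sum quantizes_scale quantizes_base shift_in_slack)
qed

lemma quantizes_1: "quantizes 0 1 1"
proof -
  have "(\<lambda>_. 0) \<in> slack 0" by (auto simp: slack_def std_indices_def mono_on_def)
  moreover have "elem_prod k a (\<lambda>_. 0) = 1" by (simp add: elem_prod_def)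
  moreover have "qE_prod k a (\<lambda>_. 0) = 1" by (auto simp: qE_prod_def qE_0 intro!: prod.neutral)
  ultimately show ?thesis using quantizes_base[of "\<lambda>_. 0" 0] by simp
qed

text \<open>A double induction, on \<open>N\<close> and then on \<open>w (a p + 1)\<close>. In the
  transition identity \<open>u\<close> has the smaller bound \<open>N - 1\<close>, and the other
  endpoints keep \<open>N\<close> but have a smaller value at \<open>a p + 1\<close>. If that value
  exceeds \<open>a p\<close>, then \<open>w\<close> fixes everything above \<open>a p\<close> and
  the bound drops at once.\<close>

lemma exists_quantizes_schubert:
  assumes "N \<le> n" "w \<in> Sn" "\<And>i. N < i \<Longrightarrow> w i = i"
  shows "\<exists>g. quantizes N (schubert n w) g"
  using assms
proof (induction N arbitrary: w rule: less_induct)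
  case (less N)
  show ?case
  proof (cases "N = 0")
    case True
    have "w i = i" for i
      using less.prems(3)[of i] permutes_not_in[OF Sn_permutes[OF less.prems(2)], of 0] True by (cases i) auto
    then have "w = id" by auto
    then have "schubert n w = 1" by (simp only: schubert_id)
    then show ?thesis using quantizes_1 True by auto
  next
    case False
    then obtain p where p: "p \<le> k" "a p < N" "N \<le> a (p + 1)" using exists_block[of N] less.prems(1) by auto
    show ?thesis using less.prems(2,3)
    proof (induction "w (a p + 1)" arbitrary: w rule: less_induct)
      case (less w)
      note outer = \<open>\<And>y w. y < N \<Longrightarrow> y \<le> n \<Longrightarrow> w \<in> Sn \<Longrightarrow> (\<And>i. y < i \<Longrightarrow> w i = i) \<Longrightarrow> \<exists>g. quantizes y (schubert n w) g\<close>
      show ?case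
      proof (cases "w (a p + 1) \<le> a p")
        case False
        then have "w (a p + 1) = a p + 1" using Sn_fixed_above(1)[OF less.prems(1) p less.prems(2)] by simp
        then have "w i = i" if "a p < i" for i using Sn_fixed_above(2)[OF less.prems(1) p less.prems(2)] that by blast
        then obtain g where "quantizes (a p) (schubert n w) g"
          using outer[of "a p" w] p(2) a_le_n[of p] p(1) less.prems(1) by auto
        then show ?thesis using quantizes_mono p(2) by (meson less_imp_le)
      next
        case True
        define u where "u = (\<lambda>i. if i \<le> a p \<and> w i < w (a p + 1) then w i
                  else if i \<le> a p \<and> w i > w (a p + 1) then w i - 1
                  else w (i + 1) - 1)"
        interpret transition n k a w u p N
          by unfold_locales (use less.prems p True u_def in auto)
        have "N - 1 < N" "N - 1 \<le> n" using p(2) N_le_n by auto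
        moreover have "u i = i" if "N - 1 < i" for i using u_fix that by simp
        ultimately obtain g where g: "quantizes (N - 1) (schubert n u) g"
          using outer u_mem by blast
        have v: "\<exists>h. quantizes N (schubert n v) h" if "v \<in> covers - {w}" for v
          using that covers_less covers_mem covers_fix by (intro less.hyps) auto
        then obtain h where h: "\<And>v. v \<in> covers - {w} \<Longrightarrow> quantizes N (schubert n v) (h v)" by metis
        have "m + 1 - r \<le> m" using r_pos by simp
        then have "quantizes N (schubert n w) (g * qE a p (int (m + 1 - r)) - (\<Sum>v\<in>covers - {w}. h v))"
          unfolding schubert_transition using g p_pos p h
          by (intro quantizes_diff quantizes_mult quantizes_sum)
        then show ?thesis ..
      qed
    qed
  qed
qed

end

section \<open>Independence of the elementary products and uniqueness of the quantization\<close>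

context flag
begin

text \<open>Positions in the initial block, which carry no index, get code 0, so the permutation
  starts with an increasing run.\<close>

definition std_code :: "(nat \<Rightarrow> nat) \<Rightarrow> nat \<Rightarrow> nat" where
  "std_code I t = (let q = (THE q. q \<le> k \<and> a q < t \<and> t \<le> a (q + 1))
    in if q = 0 then 0 else I (a q + a (q + 1) - t))"

lemma std_code_eq:
  assumes "q \<le> k" "a q < t" "t \<le> a (q + 1)"
  shows "std_code I t = (if q = 0 then 0 else I (a q + a (q + 1) - t))"
proof -
  have "(THE q. q \<le> k \<and> a q < t \<and> t \<le> a (q + 1)) = q"
  proof (rule the_equality)
    fix q' assume "q' \<le> k \<and> a q' < t \<and> t \<le> a (q' + 1)"
    then show "q' = q" using block_unique[of q' t q] assms by simp
  qed (use assms in simp)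
  then show ?thesis by (simp add: std_code_def)
qed

lemma reflect_block: "a q < t \<Longrightarrow> t \<le> a (q + 1) \<Longrightarrow> a q + a (q + 1) - t \<in> block q"
  by auto

text \<open>Reading each block backwards turns an index sequence into the inversion code of a
  permutation whose descents respect the blocks.\<close>

lemma card_std_le: "card std \<le> card Sn"
proof -
  have ex: "\<exists>w. w \<in> Sn \<and> (\<forall>t\<in>{1..n}. card {i \<in> {1..<t}. w t < w i} = std_code I t)" if I: "I \<in> std" for I
  proof -
    have "std_code I t < t" if t: "1 \<le> t" "t \<le> n" for t
    proof -
      obtain q where q: "q \<le> k" "a q < t" "t \<le> a (q + 1)" using exists_block[OF t] by blast
      show ?thesis
      proof (cases "q = 0")
        case True then show ?thesis using std_code_eq[OF q] t by simp
      next
        case False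
        then have "I (a q + a (q + 1) - t) \<le> a q" using std_le[OF I _ reflect_block[OF q(2,3)]] q by simp
        then show ?thesis using std_code_eq[OF q, of I] False q by simp
      qed
    qed
    then obtain w where w: "w permutes {1..n}" "\<And>t. t \<in> {1..n} \<Longrightarrow> card {i \<in> {1..<t}. w t < w i} = std_code I t"
      using exists_permutes_with_code[of n "std_code I"] by blast
    have "w \<in> Sn"
    proof (rule SnI[OF w(1)])
      fix t assume t: "1 \<le> t" "t < n" "t \<notin> a ` {1..k}"
      obtain q where q: "q \<le> k" "a q < t" "t \<le> a (q + 1)" using exists_block[of t] t by auto
      have "t \<noteq> a (q + 1)"
      proof
        assume "t = a (q + 1)"
        then show False using t q a_last by (cases "q = k") auto
      qed
      then have q': "a q < t + 1" "t + 1 \<le> a (q + 1)" using q by auto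
      have code: "std_code I (t + 1) \<le> std_code I t"
      proof (cases "q = 0")
        case True then show ?thesis using std_code_eq[OF q(1) q'] by simp
      next
        case False
        then have "mono_on (block q) I" using std_mono[OF I] q by simp
        then have "I (a q + a (q + 1) - (t + 1)) \<le> I (a q + a (q + 1) - t)"
          using reflect_block[OF q(2,3)] reflect_block[OF q'] by (intro mono_onD[of "block q" I]) auto
        then show ?thesis using std_code_eq[OF q(1) q', of I] std_code_eq[OF q, of I] False by simp
      qed
      show "w t < w (t + 1)"
      proof (rule ccontr)
        assume "\<not> w t < w (t + 1)"
        then have gt: "w (t + 1) < w t" using permutes_eq_iff[OF w(1), of t "t+1"] by simp
        \<comment> \<open>A descent at \<open>t\<close> would make \<open>t\<close> itself, and
          everything counted for \<open>t\<close>, count for t + 1, although the code does not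
          increase inside a block.\<close>
        have "card (insert t {i \<in> {1..<t}. w t < w i}) \<le> card {i \<in> {1..<t+1}. w (t+1) < w i}"
          using gt t by (intro card_mono) auto
        then have "std_code I t + 1 \<le> std_code I (t + 1)" using w(2)[of t] w(2)[of "t+1"] t by simp
        then show False using code by simp
      qed
    qed
    then show ?thesis using w(2) by blast
  qed
  then obtain f where f: "\<And>I. I \<in> std \<Longrightarrow> f I \<in> Sn"
    "\<And>I t. I \<in> std \<Longrightarrow> t \<in> {1..n} \<Longrightarrow> card {i \<in> {1..<t}. f I t < f I i} = std_code I t" by metis
  have "inj_on f std"
  proof (rule inj_onI)
    fix I J assume I: "I \<in> std" and J: "J \<in> std" and eq: "f I = f J"
    have "I r = J r" for r
    proof (cases "r \<in> {a 1..<a (k + 1)}")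
      case True
      then obtain q where q: "q \<in> {1..k}" "r \<in> block q" using exists_block_index by blast
      define t where "t = a q + a (q + 1) - r"
      have t: "q \<le> k" "a q < t" "t \<le> a (q + 1)" "a q + a (q + 1) - t = r" "q \<noteq> 0"
        using q by (auto simp: t_def)
      have "t \<in> {1..n}" using t a_le_n[of "q+1"] by simp
      then have "std_code I t = std_code J t" using f(2)[OF I] f(2)[OF J] eq by metis
      then show ?thesis using std_code_eq[OF t(1-3)] t(4,5) by simp
    next
      case False then show ?thesis using std_out[OF I False] std_out[OF J False] by simp
    qed
    then show "I = J" by auto
  qed
  moreover have "finite Sn"
    using finite_permutations[of "{1..n}"] by (rule finite_subset[rotated]) (auto dest: Sn_permutes)
  ultimately show ?thesis using f(1) by (intro card_inj_on_le[of f]) auto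
qed

lemma exists_expansion:
  assumes "w \<in> Sn"
  shows "\<exists>c :: (nat \<Rightarrow> nat) \<Rightarrow> int. schubert n w = (\<Sum>I\<in>std. of_int (c I) * elem_prod k a I)"
proof -
  have "\<exists>g. quantizes n (schubert n w) g"
    using assms permutes_apply_out[OF Sn_permutes[OF assms]] by (intro exists_quantizes_schubert) auto
  then show ?thesis unfolding quantizes_def slack_n by blast
qed

text \<open>There are at least as many independent Schubert polynomials in the span as there are products,
  so a relation between the products would make some Schubert polynomials dependent.\<close>

lemma elem_prod_independent:
  fixes d :: "(nat \<Rightarrow> nat) \<Rightarrow> int"
  assumes d: "(\<Sum>I\<in>std. of_int (d I) * elem_prod k a I) = 0" and J: "J \<in> std"
  shows "d J = 0"
proof (rule ccontr)
  assume dJ: "d J \<noteq> 0"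
  obtain M :: "(nat \<Rightarrow> nat) \<Rightarrow> (nat \<Rightarrow> nat) \<Rightarrow> int"
    where M: "\<And>w. w \<in> Sn \<Longrightarrow> schubert n w = (\<Sum>I\<in>std. of_int (M w I) * elem_prod k a I)"
    using exists_expansion by metis
  define P where "P = {w :: nat \<Rightarrow> nat. w permutes {1..n}}"
  have finP: "finite P" unfolding P_def by (rule finite_permutations) simp
  have sub: "Sn \<subseteq> P" using Sn_permutes by (auto simp: P_def)
  then have finS: "finite Sn" using finP finite_subset by blast
  have "card (std - {J}) < card Sn"
    using card_std_le J finite_std card_gt_0_iff[of std] by (auto simp: card_Diff_singleton)
  \<comment> \<open>Row \<open>w\<close> is \<open>d J\<close> times the expansion of the Schubert
    polynomial, corrected by the relation \<open>d\<close> so that the entry at \<open>J\<close>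
    vanishes. One column fewer than rows is left, which forces a nontrivial combination.\<close>
  then obtain c where c: "\<exists>w\<in>Sn. c w \<noteq> 0"
      "\<And>I. I \<in> std - {J} \<Longrightarrow> (\<Sum>w\<in>Sn. c w * (d J * M w I - M w J * d I)) = 0"
    using exists_int_kernel[of "std - {J}" Sn "\<lambda>w I. d J * M w I - M w J * d I"] finite_std finS by auto
  have c': "(\<Sum>w\<in>Sn. c w * (d J * M w I - M w J * d I)) = 0" if "I \<in> std" for I
    using that c(2)[of I] by (cases "I = J") (auto simp: mult.commute)
  define b where "b w = (if w \<in> Sn then c w * d J else 0)" for w
  have "(\<Sum>w\<in>P. of_int (b w) * schubert n w) = (\<Sum>w\<in>Sn. of_int (c w * d J) * schubert n w)"
    using sub finP by (intro sum.mono_neutral_cong_right) (auto simp: b_def)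
  also have "\<dots> = (\<Sum>w\<in>Sn. of_int (c w * d J) * schubert n w
      - of_int (c w * M w J) * (\<Sum>I\<in>std. of_int (d I) * elem_prod k a I))" unfolding d by simp
  also have "\<dots> = (\<Sum>w\<in>Sn. \<Sum>I\<in>std. of_int (c w * (d J * M w I - M w J * d I)) * elem_prod k a I)"
    using M by (intro sum.cong refl)
      (simp add: sum_distrib_left sum_subtractf[symmetric] algebra_simps)
  also have "\<dots> = (\<Sum>I\<in>std. \<Sum>w\<in>Sn. of_int (c w * (d J * M w I - M w J * d I)) * elem_prod k a I)"
    by (rule sum.swap)
  also have "\<dots> = (\<Sum>I\<in>std. of_int (\<Sum>w\<in>Sn. c w * (d J * M w I - M w J * d I)) * elem_prod k a I)"
    by (simp only: sum_distrib_right of_int_sum)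
  also have "\<dots> = 0" using c' by simp
  finally have zero: "(\<Sum>w | w permutes {1..n}. of_int (b w) * schubert n w) = 0" by (simp only: P_def)
  have "b w = 0" if "w \<in> Sn" for w by (rule schubert_independent[OF zero Sn_permutes[OF that]])
  then show False using c(1) dJ by (auto simp: b_def)
qed

lemma quantizes_unique:
  assumes "quantizes n f g" "quantizes n f g'"
  shows "g = g'"
proof -
  obtain c c' where c: "f = (\<Sum>I\<in>std. of_int (c I) * elem_prod k a I)" "g = (\<Sum>I\<in>std. of_int (c I) * qE_prod k a I)"
    "f = (\<Sum>I\<in>std. of_int (c' I) * elem_prod k a I)" "g' = (\<Sum>I\<in>std. of_int (c' I) * qE_prod k a I)"
    using assms unfolding quantizes_def slack_n by blast
  have "(\<Sum>I\<in>std. of_int (c I - c' I) * elem_prod k a I) = 0"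
    using c(1,3) by (simp add: left_diff_distrib sum_subtractf)
  then have "c I = c' I" if "I \<in> std" for I using elem_prod_independent[of "\<lambda>I. c I - c' I"] that by simp
  then show ?thesis unfolding c(2,4) by simp
qed

lemma quantizes_qschubert:
  assumes w: "w \<in> Sn"
  shows "quantizes n (schubert n w) (qschubert n k a w)"
proof -
  let ?P = "\<lambda>c. (\<forall>I. I \<notin> std \<longrightarrow> c I = 0) \<and> schubert n w = (\<Sum>I\<in>std. of_int (c I) * elem_prod k a I)"
  obtain c :: "(nat \<Rightarrow> nat) \<Rightarrow> int" where c: "schubert n w = (\<Sum>I\<in>std. of_int (c I) * elem_prod k a I)"
    using exists_expansion[OF w] by blast
  have "\<exists>!c. ?P c"
  proof (rule ex1I)
    show "?P (\<lambda>I. if I \<in> std then c I else 0)" using c by simp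
    fix c' assume c': "?P c'"
    then have "(\<Sum>I\<in>std. of_int (c' I) * elem_prod k a I) = (\<Sum>I\<in>std. of_int (c I) * elem_prod k a I)"
      using c by metis
    then have "(\<Sum>I\<in>std. of_int (c' I - c I) * elem_prod k a I) = 0"
      by (simp add: left_diff_distrib sum_subtractf)
    then have "c' I = c I" if "I \<in> std" for I using elem_prod_independent[of "\<lambda>I. c' I - c I"] that by simp
    then show "c' = (\<lambda>I. if I \<in> std then c I else 0)" using c' by auto
  qed
  then have "?P (schubert_coeffs n k a w)" unfolding schubert_coeffs_def by (rule theI')
  then show ?thesis unfolding quantizes_def slack_n qschubert_def by blast
qed

end

context transition
begin

lemma qschubert_transition:
  "qschubert n k a w = qschubert n k a u * qE a p (int (m + 1 - r)) - (\<Sum>v\<in>covers - {w}. qschubert n k a v)"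
proof (rule quantizes_unique)
  show "quantizes n (schubert n w) (qschubert n k a w)" by (rule quantizes_qschubert[OF w])
  have "N - 1 \<le> n" "\<And>i. N - 1 < i \<Longrightarrow> u i = i" using N_le_n u_fix by auto
  then obtain g where g: "quantizes (N - 1) (schubert n u) g"
    using exists_quantizes_schubert u_mem by blast
  have "quantizes n (schubert n u) g" using g N_le_n by (auto elim: quantizes_mono)
  \<comment> \<open>\<open>quantizes_qschubert\<close> gives an expansion of \<open>u\<close> over
    all of \<open>std\<close>, while the multiplication needs one over \<open>slack (N - 1)\<close>.
    Uniqueness shows that the latter yields the same quantum polynomial.\<close>
  then have "g = qschubert n k a u" using quantizes_qschubert[OF u_mem] by (rule quantizes_unique)
  moreover have "m + 1 - r \<le> m" using r_pos by simp
  ultimately have "quantizes N (elem_sym m (m + 1 - r) * schubert n u) (qschubert n k a u * qE a p (int (m + 1 - r)))"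
    using g p_pos p by (intro quantizes_mult) auto
  then have "quantizes n (elem_sym m (m + 1 - r) * schubert n u) (qschubert n k a u * qE a p (int (m + 1 - r)))"
    using N_le_n by (rule quantizes_mono)
  then show "quantizes n (schubert n w)
      (qschubert n k a u * qE a p (int (m + 1 - r)) - (\<Sum>v\<in>covers - {w}. qschubert n k a v))"
    unfolding schubert_transition using covers_mem
    by (intro quantizes_diff quantizes_sum quantizes_qschubert) auto
qed

end

text \<open>From the last block leftwards, a fixed first position makes the whole block fixed, so
  maximality of \<open>p\<close> fixes everything above \<open>a (p + 1)\<close>. If no level
  qualified, the same argument would reach the initial block, where \<open>w 1 \<ge> 1\<close>
  completes it, and \<open>w\<close> would be the identity; so the maximum is over a nonempty
  set.\<close>

lemma (in flag) transition_level:
  assumes w: "w \<in> Sn" "w \<noteq> id" and p: "p = Max {p \<in> {1..k}. w (a p + 1) \<noteq> a p + 1}"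
  shows "p \<le> k" "\<And>i. a (p + 1) < i \<Longrightarrow> w i = i" "w (a p + 1) \<le> a p"
proof -
  let ?X = "{p \<in> {1..k}. w (a p + 1) \<noteq> a p + 1}"
  have fin: "finite ?X" by simp
  have above: "\<forall>i>a q. w i = i" if "1 \<le> q" "q \<le> k + 1" "\<And>q'. q \<le> q' \<Longrightarrow> q' \<le> k \<Longrightarrow> w (a q' + 1) = a q' + 1" for q
    using that(2,1,3)
  proof (induction q rule: inc_induct)
    case base then show ?case using permutes_apply_out[OF Sn_permutes[OF w(1)]] a_last by simp
  next
    case (step q)
    have q: "q \<le> k" "a q < a (q + 1)" using step.hyps a_less[of q "q+1"] by auto
    have IH: "\<forall>i>a (Suc q). w i = i"
    proof (rule step.IH)
      fix q' assume "Suc q \<le> q'" "q' \<le> k"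
      then show "w (a q' + 1) = a q' + 1" by (intro step.prems(2)) simp_all
    qed simp
    have wq: "w (a q + 1) = a q + 1" using order_refl q(1) by (rule step.prems(2))
    show ?case
    proof (intro allI impI)
      fix i assume "a q < i"
      then show "w i = i" using Sn_fixed_above(2)[OF w(1) q order_refl _ wq] IH by simp
    qed
  qed
  have ne: "?X \<noteq> {}"
  proof
    assume empty: "?X = {}"
    have fixed: "w (a q + 1) = a q + 1" if "1 \<le> q" "q \<le> k" for q
    proof (rule ccontr)
      assume "w (a q + 1) \<noteq> a q + 1"
      then have "q \<in> ?X" using that by simp
      then show False unfolding empty by (rule emptyE)
    qed
    have "\<forall>i>a 1. w i = i" by (rule above) (simp_all add: fixed del: One_nat_def)
    then have fix1: "\<And>i. a 1 < i \<Longrightarrow> w i = i" by blast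
    have a1: "a 0 < a 1" using a_less[of 0 1] by simp
    have "w (a 0 + 1) \<le> a 0 + 1"
      using Sn_fixed_above(1)[OF w(1), of 0 "a 1"] a1 fix1 by simp
    moreover have "1 \<le> w 1" using permutes_apply_in[OF Sn_permutes[OF w(1)], of 1] a1 a_le_n[of 1] a_0 by simp
    ultimately have "w (a 0 + 1) = a 0 + 1" using a_0 by simp
    then have "w i = i" if "0 < i" for i
      using Sn_fixed_above(2)[OF w(1), of 0 "a 1" i] a1 fix1 a_0 that by simp
    moreover have "w 0 = 0" using Sn_permutes[OF w(1)] by (rule permutes_not_in) simp
    ultimately have "w i = id i" for i by (cases i) auto
    then show False using w(2) by auto
  qed
  have pX: "p \<in> ?X" unfolding p using fin ne by (rule Max_in)
  then show pk: "p \<le> k" by simp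
  have max: "w (a q + 1) = a q + 1" if "p < q" "q \<le> k" for q
  proof (rule ccontr)
    assume "w (a q + 1) \<noteq> a q + 1"
    then have "q \<in> ?X" using that by auto
    then have "q \<le> p" unfolding p using fin by (intro Max_ge)
    then show False using that by simp
  qed
  have "\<forall>i>a (p + 1). w i = i" using pk by (intro above max) simp_all
  then show fix_above: "\<And>i. a (p + 1) < i \<Longrightarrow> w i = i" by blast
  have "w (a p + 1) \<le> a p + 1"
    using Sn_fixed_above(1)[OF w(1) pk _ order_refl fix_above] a_less[of p "p+1"] pk by simp
  then show "w (a p + 1) \<le> a p" using pX by simp
qed

theorem mainTheorem5:
  fixes n k p :: nat and a w u \<alpha> :: "nat \<Rightarrow> nat"
  assumes "a 0 = 0" and "a (k + 1) = n" and "strict_mono_on {0..k + 1} a"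
    and "w \<in> perms_with_descents_in n k a" and "w \<noteq> id"
    and "p = Max {p \<in> {1..k}. w (a p + 1) \<noteq> a p + 1}"
    and "u = (\<lambda>i. if i \<le> a p \<and> w i < w (a p + 1) then w i
                  else if i \<le> a p \<and> w i > w (a p + 1) then w i - 1
                  else w (i + 1) - 1)"
    and "\<alpha> = cycle_perm (w (a p + 1)) (a p)"
  shows "u \<in> perms_with_descents_in n k a \<and> \<alpha> \<in> perms_with_descents_in n k a \<and>
    qschubert n k a w =
      qschubert n k a u * qE a p (int (a p) + 1 - int (w (a p + 1)))
      - (\<Sum>v | pieri_step n \<alpha> u v \<and> v \<noteq> w. qschubert n k a v)"
proof -
  interpret flag n k a using assms(1-3) by unfold_locales
  note level = transition_level[OF assms(4-6)]
  interpret transition n k a w u p "a (p + 1)"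
    using assms(4,7) level a_less[of p "p + 1"] by unfold_locales auto
  have "{v. pieri_step n \<alpha> u v \<and> v \<noteq> w} = covers - {w}" using assms(8) by auto
  moreover have "int (m + 1 - r) = int m + 1 - int r" using r_le by simp
  ultimately show ?thesis
    using u_mem cycle_perm_mem[OF p_pos p(1) r_pos r_le] qschubert_transition assms(8) by simp
qed

end
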